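(* Let $d\in\{1,2,3\}$, let $N^d$ be the $d$-dimensional normal distribution manifold equipped with its Fisher metric $g$, and let $\nabla$ be the Levi-Civita connection of $g$. Let $H_d$ be the Riemannian holonomy group and $H_d^0$ the restricted Riemannian holonomy group of $(N^d,g)$. Then $$H_d=H_d^0=SO\left(\frac{d(d+3)}{2}\right).$$
   Context: Let $PD(d,\mathbb{R})$ be the set of real symmetric positive definite $d\times d$ matrices. The $d$-dimensional normal distribution manifold is the family of densities on $\mathbb{R}^d$ $$N^d=\left\{p(x;\mu,\Sigma)=\frac{\exp\{-\frac12(x-\mu)^T\Sigma^{-1}(x-\mu)\}}{(2\pi)^{d/2}(\det\Sigma)^{1/2}} : \mu\in\mathbb{R}^d,\ \Sigma\in PD(d,\mathbb{R})\right\},$$ a smooth manifold of dimension $\frac{d(d+3)}{2}$ identified with the open subset $\mathbb{R}^d\times PD(d,\mathbb{R})$ of $\mathbb{R}^{d(d+3)/2}$ (so $d$ is the dimension of the sample space, not of the manifold). The Fisher metric in coordinates $\theta=(\theta_i)$ is $g_{ij}(\theta)=\int(\partial_i l)(\partial_j l)\,p(x;\theta)\,dx$, where $l=\log p(x;\theta)$ and $\partial_i=\partial/\partial\theta_i$. For a connected Riemannian manifold $(M,g)$ with Levi-Civita connection $\nabla$, the Riemannian holonomy group at $x\in M$ is the group of parallel transports $P_\gamma\in GL(T_xM)$ along piecewise smooth loops $\gamma$ based at $x$; the restricted holonomy group is the subgroup given by contractible loops. With an orthonormal basis of $T_xM$ these are subgroups of $O(\dim M)$, well defined up to conjugation, and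 the base point is omitted; equalities of holonomy groups with subgroups of $O(\dim M)$ are understood up to conjugation. *)

theory Defs
  imports "HOL-Analysis.Analysis" "HOL-Library.Uprod"
begin

section \<open>Smoothness\<close>

text \<open>Meant for open \<open>S\<close>: \<open>f\<close> is \<open>k\<close> times continuously differentiable on \<open>S\<close>.\<close>

primrec Ck_on ::
  "nat \<Rightarrow> 'a::euclidean_space set \<Rightarrow> ('a \<Rightarrow> 'b::real_normed_vector) \<Rightarrow> bool" where
  "Ck_on 0 S f \<longleftrightarrow> continuous_on S f"
| "Ck_on (Suc k) S f \<longleftrightarrow>
     (\<forall>x\<in>S. f differentiable (at x)) \<and> (\<forall>v. Ck_on k S (\<lambda>x. frechet_derivative f (at x) v))"

definition smooth_on ::
  "'a::euclidean_space set \<Rightarrow> ('a \<Rightarrow> 'b::real_normed_vector) \<Rightarrow> bool" where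
  "smooth_on S f \<longleftrightarrow> (\<forall>k. Ck_on k S f)"

text \<open>A smooth curve on a closed interval has derivatives of all orders, one-sided at the two
  endpoints; \<open>D k\<close> is the \<open>k\<close>-th derivative.\<close>

definition smooth_curve_on :: "real \<Rightarrow> real \<Rightarrow> (real \<Rightarrow> 'a::real_normed_vector) \<Rightarrow> bool" where
  "smooth_curve_on a b \<gamma> \<longleftrightarrow>
     (\<exists>D. (\<forall>t\<in>{a..b}. D 0 t = \<gamma> t) \<and>
          (\<forall>k. \<forall>t\<in>{a..b}. (D k has_vector_derivative D (Suc k) t) (at t within {a..b})))"

definition piecewise_smooth :: "(real \<Rightarrow> 'a::real_normed_vector) \<Rightarrow> bool" where
  "piecewise_smooth \<gamma> \<longleftrightarrow>
     (\<exists>N (s :: nat \<Rightarrow> real). s 0 = 0 \<and> s N = 1 \<and>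
        (\<forall>i<N. s i < s (Suc i) \<and> smooth_curve_on (s i) (s (Suc i)) \<gamma>))"

section \<open>Riemannian geometry of an open subset of a Euclidean space\<close>

text \<open>The manifold is an open set \<open>M\<close> in a Euclidean space \<open>'a\<close>, so that every tangent space is
  \<open>'a\<close>. Vector fields and functions are total functions that only matter on \<open>M\<close>, and
  \<open>X(f)\<close> at \<open>p\<close> is \<open>frechet_derivative f (at p) (X p)\<close>.\<close>

type_synonym 'a connection = "('a \<Rightarrow> 'a) \<Rightarrow> ('a \<Rightarrow> 'a) \<Rightarrow> 'a \<Rightarrow> 'a"
type_synonym 'a metric_tensor = "'a \<Rightarrow> 'a \<Rightarrow> 'a \<Rightarrow> real"

text \<open>The second conjunct says that the values of \<open>nabla X Y\<close> on \<open>M\<close> depend only on the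
  restrictions of \<open>X\<close> and \<open>Y\<close> to \<open>M\<close>.\<close>

definition affine_connection :: "'a::euclidean_space set \<Rightarrow> 'a connection \<Rightarrow> bool" where
  "affine_connection M nabla \<longleftrightarrow>
     (\<forall>X Y. smooth_on M X \<and> smooth_on M Y \<longrightarrow> smooth_on M (nabla X Y)) \<and>
     (\<forall>X X' Y Y'. smooth_on M X \<and> smooth_on M X' \<and> smooth_on M Y \<and> smooth_on M Y' \<and>
        (\<forall>p\<in>M. X p = X' p \<and> Y p = Y' p) \<longrightarrow> (\<forall>p\<in>M. nabla X Y p = nabla X' Y' p)) \<and>
     (\<forall>(f :: 'a \<Rightarrow> real) X X' Y.
        smooth_on M f \<and> smooth_on M X \<and> smooth_on M X' \<and> smooth_on M Y \<longrightarrow>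
        (\<forall>p\<in>M. nabla (\<lambda>q. f q *\<^sub>R X q + X' q) Y p = f p *\<^sub>R nabla X Y p + nabla X' Y p)) \<and>
     (\<forall>(f :: 'a \<Rightarrow> real) X Y Y'.
        smooth_on M f \<and> smooth_on M X \<and> smooth_on M Y \<and> smooth_on M Y' \<longrightarrow>
        (\<forall>p\<in>M. nabla X (\<lambda>q. f q *\<^sub>R Y q + Y' q) p =
           frechet_derivative f (at p) (X p) *\<^sub>R Y p + f p *\<^sub>R nabla X Y p + nabla X Y' p))"

definition lie_bracket :: "('a \<Rightarrow> 'a) \<Rightarrow> ('a \<Rightarrow> 'a) \<Rightarrow> 'a::real_normed_vector \<Rightarrow> 'a" where
  "lie_bracket X Y p = frechet_derivative Y (at p) (X p) - frechet_derivative X (at p) (Y p)"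

definition torsion_free :: "'a::euclidean_space set \<Rightarrow> 'a connection \<Rightarrow> bool" where
  "torsion_free M nabla \<longleftrightarrow>
     (\<forall>X Y. smooth_on M X \<and> smooth_on M Y \<longrightarrow>
        (\<forall>p\<in>M. nabla X Y p - nabla Y X p = lie_bracket X Y p))"

definition metric_compatible ::
  "'a::euclidean_space set \<Rightarrow> 'a metric_tensor \<Rightarrow> 'a connection \<Rightarrow> bool" where
  "metric_compatible M g nabla \<longleftrightarrow>
     (\<forall>X Y Z. smooth_on M X \<and> smooth_on M Y \<and> smooth_on M Z \<longrightarrow>
        (\<forall>p\<in>M. frechet_derivative (\<lambda>q. g q (Y q) (Z q)) (at p) (X p) =
           g p (nabla X Y p) (Z p) + g p (Y p) (nabla X Z p)))"

definition levi_civita ::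
  "'a::euclidean_space set \<Rightarrow> 'a metric_tensor \<Rightarrow> 'a connection \<Rightarrow> bool" where
  "levi_civita M g nabla \<longleftrightarrow>
     affine_connection M nabla \<and> torsion_free M nabla \<and> metric_compatible M g nabla"

text \<open>Constant vector fields are the combinations of the coordinate fields with constant
  coefficients, so this is the bilinear map with the Christoffel symbols as coefficients.\<close>

definition christoffel :: "'a connection \<Rightarrow> 'a \<Rightarrow> 'a \<Rightarrow> 'a \<Rightarrow> 'a" where
  "christoffel nabla p u v = nabla (\<lambda>_. u) (\<lambda>_. v) p"

text \<open>\<open>W\<close> is the covariant derivative at time \<open>t\<close> of the vector field \<open>V\<close> along \<open>\<gamma>\<close>.\<close>

definition has_cov_derivative ::
  "'a::euclidean_space connection \<Rightarrow> (real \<Rightarrow> 'a) \<Rightarrow> (real \<Rightarrow> 'a) \<Rightarrow> real \<Rightarrow> 'a \<Rightarrow> bool" where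
  "has_cov_derivative nabla \<gamma> V t W \<longleftrightarrow>
     (\<exists>\<gamma>' V'. (\<gamma> has_vector_derivative \<gamma>') (at t within {0..1}) \<and>
             (V has_vector_derivative V') (at t within {0..1}) \<and>
             W = V' + christoffel nabla (\<gamma> t) \<gamma>' (V t))"

text \<open>The finite exceptional set accommodates the corners of \<open>\<gamma>\<close>, across which \<open>V\<close> is continuous.\<close>

definition parallel_along ::
  "'a::euclidean_space connection \<Rightarrow> (real \<Rightarrow> 'a) \<Rightarrow> (real \<Rightarrow> 'a) \<Rightarrow> bool" where
  "parallel_along nabla \<gamma> V \<longleftrightarrow>
     continuous_on {0..1} V \<and>
     (\<exists>S. finite S \<and> (\<forall>t\<in>{0..1} - S. has_cov_derivative nabla \<gamma> V t 0))"

definition parallel_transport ::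
  "'a::euclidean_space connection \<Rightarrow> (real \<Rightarrow> 'a) \<Rightarrow> 'a \<Rightarrow> 'a" where
  "parallel_transport nabla \<gamma> v = (THE w. \<exists>V. parallel_along nabla \<gamma> V \<and> V 0 = v \<and> V 1 = w)"

definition smooth_loops :: "'a::real_normed_vector set \<Rightarrow> 'a \<Rightarrow> (real \<Rightarrow> 'a) set" where
  "smooth_loops M x =
     {\<gamma>. piecewise_smooth \<gamma> \<and> path_image \<gamma> \<subseteq> M \<and> pathstart \<gamma> = x \<and> pathfinish \<gamma> = x}"

definition holonomy_group ::
  "'a::euclidean_space set \<Rightarrow> 'a connection \<Rightarrow> 'a \<Rightarrow> ('a \<Rightarrow> 'a) set" where
  "holonomy_group M nabla x = parallel_transport nabla ` smooth_loops M x"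

definition restricted_holonomy_group ::
  "'a::euclidean_space set \<Rightarrow> 'a connection \<Rightarrow> 'a \<Rightarrow> ('a \<Rightarrow> 'a) set" where
  "restricted_holonomy_group M nabla x =
     parallel_transport nabla ` {\<gamma> \<in> smooth_loops M x. homotopic_paths M \<gamma> (\<lambda>_. x)}"

text \<open>Since the frame has as many members as the tangent space has dimensions, it is a basis.\<close>

definition orthonormal_frame ::
  "(real ^ 'n) metric_tensor \<Rightarrow> real ^ 'n \<Rightarrow> ('n::finite \<Rightarrow> real ^ 'n) \<Rightarrow> bool" where
  "orthonormal_frame g x e \<longleftrightarrow> (\<forall>i j. g x (e i) (e j) = (if i = j then 1 else 0))"

text \<open>The matrix of an endomorphism of the tangent space at \<open>x\<close> in an orthonormal frame \<open>e\<close>.\<close>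

definition frame_matrix ::
  "(real ^ 'n) metric_tensor \<Rightarrow> real ^ 'n \<Rightarrow> ('n::finite \<Rightarrow> real ^ 'n) \<Rightarrow>
     (real ^ 'n \<Rightarrow> real ^ 'n) \<Rightarrow> real ^ 'n ^ 'n" where
  "frame_matrix g x e P = (\<chi> i j. g x (e i) (P (e j)))"

definition special_orthogonal :: "(real ^ 'n ^ 'n::finite) set" where
  "special_orthogonal = {A. rotation_matrix A}"

section \<open>The normal distribution manifold\<close>

instance uprod :: (finite) finite
  by standard simp

text \<open>Coordinates are indexed by \<open>'d + 'd uprod\<close>: one for each entry of \<open>\<mu>\<close>, and one for each
  unordered pair \<open>{i, j}\<close> (with \<open>i = j\<close> allowed), that is, for each independent entry of the
  symmetric matrix \<open>\<Sigma>\<close>.\<close>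

type_synonym 'd normal_coords = "real ^ ('d + 'd uprod)"

lemma card_normal_coords:
  "CARD('d::finite + 'd uprod) = CARD('d) * (CARD('d) + 3) div 2"
proof -
  have "CARD('d + 'd uprod) = CARD('d) + CARD('d) * (CARD('d) + 1) div 2"
    by (simp add: card_UNIV_sum card_UNIV_uprod)
  also have "\<dots> = (CARD('d) * 2 + CARD('d) * (CARD('d) + 1)) div 2"
    by simp
  also have "\<dots> = CARD('d) * (CARD('d) + 3) div 2"
    by (simp add: algebra_simps)
  finally show ?thesis .
qed

definition mean_of :: "'d::finite normal_coords \<Rightarrow> real ^ 'd" where
  "mean_of \<theta> = (\<chi> i. \<theta> $ Inl i)"

definition cov_of :: "'d::finite normal_coords \<Rightarrow> real ^ 'd ^ 'd" where
  "cov_of \<theta> = (\<chi> i j. \<theta> $ Inr (Upair i j))"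

definition pos_def :: "real ^ 'd ^ 'd::finite \<Rightarrow> bool" where
  "pos_def A \<longleftrightarrow> transpose A = A \<and> (\<forall>v. v \<noteq> 0 \<longrightarrow> v \<bullet> (A *v v) > 0)"

definition normal_manifold :: "'d::finite normal_coords set" where
  "normal_manifold = {\<theta>. pos_def (cov_of \<theta>)}"

definition normal_pdf :: "'d::finite normal_coords \<Rightarrow> real ^ 'd \<Rightarrow> real" where
  "normal_pdf \<theta> x =
     exp (- (1/2) * ((x - mean_of \<theta>) \<bullet> (matrix_inv (cov_of \<theta>) *v (x - mean_of \<theta>)))) /
     ((2 * pi) powr (real CARD('d) / 2) * det (cov_of \<theta>) powr (1/2))"

definition log_likelihood :: "real ^ 'd \<Rightarrow> 'd::finite normal_coords \<Rightarrow> real" where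
  "log_likelihood x \<theta> = ln (normal_pdf \<theta> x)"

definition fisher_coeff ::
  "'d::finite normal_coords \<Rightarrow> 'd + 'd uprod \<Rightarrow> 'd + 'd uprod \<Rightarrow> real" where
  "fisher_coeff \<theta> i j =
     (LINT x|lborel.
        frechet_derivative (log_likelihood x) (at \<theta>) (axis i 1) *
        frechet_derivative (log_likelihood x) (at \<theta>) (axis j 1) * normal_pdf \<theta> x)"

definition fisher_metric :: "'d::finite normal_coords metric_tensor" where
  "fisher_metric \<theta> u v = (\<Sum>i\<in>UNIV. \<Sum>j\<in>UNIV. fisher_coeff \<theta> i j * u $ i * v $ j)"

end

theory Submission
  imports Defs "HOL-Probability.Distributions"
begin

text \<open>
  The manifold is a convex open set, so all loops are null-homotopic. Parallel transport along a loop
  preserves the metric, and the determinant of a fundamental system of parallel fields never vanishes,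
  so the holonomy group consists of rotations.

  Conversely, the Fisher metric at \<open>(\<mu>, \<Sigma>)\<close> is \<open>a \<bullet> \<Sigma>\<^sup>-\<^sup>1 b + tr (\<Sigma>\<^sup>-\<^sup>1 A \<Sigma>\<^sup>-\<^sup>1 B) / 2\<close>, and along
  \<open>\<Sigma> = r I\<close> parallel transport is explicit: changing \<open>r\<close> rescales \<open>(b, B)\<close> to \<open>(\<surd>r b, r B)\<close>, while moving
  \<open>\<mu>\<close> by \<open>s e\<^sub>i\<close> rotates, in the rescaled frame, the planes \<open>(e\<^sub>j, E\<^sub>i\<^sub>j)\<close> by \<open>s / (2 \<surd>r)\<close> for \<open>j \<noteq> i\<close>
  and by \<open>s / \<surd>(2 r)\<close> for \<open>j = i\<close>. Going up from \<open>r = 1\<close> to \<open>r = 4\<close>, across, down and back therefore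
  yields the whole one-parameter group \<open>R\<^sub>i(t)\<close> of these rotations inside the holonomy group \<open>G\<close>.
  The velocities at the identity of curves in \<open>G\<close> form a Lie algebra stable under conjugation by \<open>G\<close>.
  It contains the generators of the \<open>R\<^sub>i\<close>, and since the two frequencies are incommensurable,
  conjugation with \<open>R\<^sub>i(4 \<pi>)\<close> isolates the single planes \<open>(e\<^sub>j, E\<^sub>i\<^sub>j)\<close>, whose infinitesimal rotations
  generate all skew matrices. An open mapping argument then shows that \<open>G\<close> contains a neighbourhood
  of the identity in the rotation group, hence is all of it.
\<close>

section \<open>Bilinear matrix operations\<close>

text \<open>The holonomy group is given only as a set of transports along loops; nothing says
  beforehand that it is closed or a Lie subgroup. Its tangent vectors are therefore read off curves
  that are merely continuous and differentiable at one point, and the way back to the group is an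
  open mapping theorem content with such maps, where the inverse function theorem would want a C1
  map. The rectangle between r = 1 and r = 4 has nontrivial transport because the angle collected on
  a horizontal side is proportional to 1 / sqrt r, so the two horizontal sides do not cancel. The
  two frequencies differ by the factor sqrt 2 because a Fisher unit vector along a diagonal entry of
  \<Sigma> is longer by sqrt 2 than one along an off-diagonal entry; time 4 \<pi> completes the
  turns of frequency 1/2 but not the one of frequency 1 / sqrt 2. The explicit loops start at the
  standard normal distribution. Other base points are reached along segments; the frames compared
  there may differ in orientation, which is harmless because conjugation by any orthogonal matrix
  preserves the rotations.\<close>

interpretation matrix_mult:
  bounded_bilinear "((**) :: real^'m^'n \<Rightarrow> real^'p^'m \<Rightarrow> real^'p^'n)"
proof -
  have "bilinear ((**) :: real^'m^'n \<Rightarrow> real^'p^'m \<Rightarrow> real^'p^'n)"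
    unfolding bilinear_def
    by (auto intro!: linearI simp: vec_eq_iff matrix_matrix_mult_def sum.distrib sum_distrib_left algebra_simps)
  then show "bounded_bilinear ((**) :: real^'m^'n \<Rightarrow> real^'p^'m \<Rightarrow> real^'p^'n)"
    by (simp add: bilinear_conv_bounded_bilinear)
qed

declare matrix_mult.continuous_on [continuous_intros]

lemma bounded_linear_transpose: "bounded_linear (transpose :: real^'n^'m \<Rightarrow> real^'m^'n)"
  by (auto intro!: linearI simp: vec_eq_iff transpose_def linear_conv_bounded_linear[symmetric])

lemmas continuous_on_transpose [continuous_intros] =
  bounded_linear.continuous_on [OF bounded_linear_transpose]
lemmas transpose_add = linear_add [OF bounded_linear.linear, OF bounded_linear_transpose]
lemmas transpose_diff = linear_diff [OF bounded_linear.linear, OF bounded_linear_transpose]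
lemmas transpose_scaleR = linear_cmul [OF bounded_linear.linear, OF bounded_linear_transpose]

lemma axis_apply: "axis k x $ i = (if i = k then x else 0)"
  by (simp add: axis_def)

definition outer :: "real^'m \<Rightarrow> real^'n \<Rightarrow> real^'n^'m" where
  "outer u v = (\<chi> i j. u $ i * v $ j)"

lemma outer_nth: "outer u v $ i $ j = u $ i * v $ j"
  by (simp add: outer_def)

interpretation outer: bounded_bilinear "outer :: real^'m \<Rightarrow> real^'n \<Rightarrow> real^'n^'m"
proof -
  have "bilinear (outer :: real^'m \<Rightarrow> real^'n \<Rightarrow> real^'n^'m)"
    unfolding bilinear_def
    by (auto intro!: linearI simp: vec_eq_iff outer_nth algebra_simps)
  then show "bounded_bilinear (outer :: real^'m \<Rightarrow> real^'n \<Rightarrow> real^'n^'m)"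
    by (simp add: bilinear_conv_bounded_bilinear)
qed

declare outer.continuous_on [continuous_intros]

lemma matrix_mul_outer: "A ** outer u v = outer (A *v u) v"
  by (auto simp: vec_eq_iff outer_nth matrix_matrix_mult_def matrix_vector_mult_def
      sum_distrib_left algebra_simps)

lemma outer_mul_matrix: "outer u v ** A = outer u (transpose A *v v)"
  by (auto simp: vec_eq_iff outer_nth matrix_matrix_mult_def matrix_vector_mult_def transpose_def
      sum_distrib_left algebra_simps)

lemma outer_mul_vector: "outer u v *v w = (v \<bullet> w) *\<^sub>R u"
  by (auto simp: vec_eq_iff outer_nth matrix_vector_mult_def inner_vec_def
      sum_distrib_right sum_distrib_left algebra_simps)

lemma transpose_outer: "transpose (outer u v) = outer v u"
  by (simp add: vec_eq_iff outer_nth transpose_def)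

interpretation matrix_vector: bounded_bilinear "(*v) :: real^'n^'m \<Rightarrow> real^'n \<Rightarrow> real^'m"
proof -
  have "bilinear ((*v) :: real^'n^'m \<Rightarrow> real^'n \<Rightarrow> real^'m)"
    unfolding bilinear_def
    by (auto intro!: linearI simp: vec_eq_iff matrix_vector_mult_def sum.distrib sum_distrib_left algebra_simps)
  then show "bounded_bilinear ((*v) :: real^'n^'m \<Rightarrow> real^'n \<Rightarrow> real^'m)"
    by (simp add: bilinear_conv_bounded_bilinear)
qed

section \<open>Generation of the rotation group by reflections\<close>

text \<open>Reflection in the hyperplane orthogonal to \<open>u\<close>. The vector is not
  normalised, so that the reflection depends continuously on \<open>u\<close> over the whole
  punctured space.\<close>

definition householder :: "real^'n \<Rightarrow> real^'n^'n" where
  "householder u = mat 1 - (2 / (u \<bullet> u)) *\<^sub>R outer u u"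

lemma householder_apply: "householder u *v w = w - (2 * (u \<bullet> w) / (u \<bullet> u)) *\<^sub>R u"
  by (simp add: householder_def matrix_vector_mult_diff_rdistrib matrix_vector.scaleR_left outer_mul_vector)

lemma transpose_householder: "transpose (householder u) = householder u"
  by (simp add: householder_def transpose_diff transpose_scaleR transpose_outer)

lemma householder_householder:
  assumes "u \<noteq> 0" shows "householder u ** householder u = mat 1"
proof -
  have "(householder u ** householder u) *v w = mat 1 *v w" for w
    using assms unfolding matrix_vector_mul_assoc[symmetric] householder_apply
    by (simp add: inner_diff_right algebra_simps)
  then show ?thesis by (metis matrix_eq)
qed

lemma orthogonal_matrix_householder:
  "u \<noteq> 0 \<Longrightarrow> orthogonal_matrix (householder u)"
  by (simp add: orthogonal_matrix_def transpose_householder householder_householder)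

lemma householder_conj:
  assumes "orthogonal_matrix Q"
  shows "Q ** householder u ** transpose Q = householder (Q *v u)"
proof -
  have "(Q *v u) \<bullet> (Q *v u) = u \<bullet> u"
    using assms by (metis orthogonal_matrix_def dot_matrix_vector_mul
      matrix_vector_mul_lid dot_lmul_matrix matrix_vector_mul_assoc transpose_matrix_vector)
  moreover have "Q ** transpose Q = mat 1"
    using assms by (simp add: orthogonal_matrix_def)
  ultimately show ?thesis
    by (simp add: householder_def matrix_mult.diff_right
        matrix_mult.diff_left matrix_mult.scaleR_left matrix_mult.scaleR_right
        matrix_mul_outer outer_mul_matrix)
qed

text \<open>Conjugation by an orthogonal matrix that carries \<open>u\<close> to a multiple of a
  coordinate axis turns the reflection into a diagonal matrix with a single entry -1.\<close>

lemma det_householder: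
  assumes "u \<noteq> (0 :: real^'n)" shows "det (householder u) = -1"
proof -
  fix k :: 'n
  obtain Q where Q: "orthogonal_matrix Q" "Q *v u = norm u *\<^sub>R axis k 1"
    using orthogonal_transformation_exists[of u "norm u *\<^sub>R axis k (1::real)"]
    by (metis orthogonal_transformation_matrix matrix_works norm_axis_1 norm_scaleR abs_norm_cancel mult.right_neutral orthogonal_transformation_linear matrix_vector_mul(2))
  have "det (householder u) = det Q * det (householder u) * det (transpose Q)"
    using det_orthogonal_matrix[OF Q(1)] by auto
  also have "\<dots> = det (householder (norm u *\<^sub>R axis k (1::real)))"
    using householder_conj[OF Q(1), of u] Q(2) by (metis det_mul)
  also have "householder (norm u *\<^sub>R axis k (1::real)) = (\<chi> i j. if i = j then (if i = k then -1 else 1) else 0)"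
  proof -
    have "norm u *\<^sub>R axis k (1::real) \<bullet> norm u *\<^sub>R axis k 1 = norm u * norm u"
      by (simp add: inner_axis_axis)
    then show ?thesis
      using assms by (simp add: vec_eq_iff householder_def mat_def outer_nth) (auto simp: axis_apply)
  qed
  also have "det \<dots> = (\<Prod>i\<in>UNIV. if i = k then -1 else 1)"
    by (subst det_diagonal) auto
  also have "\<dots> = -1" by (simp add: prod.delta)
  finally show ?thesis .
qed

text \<open>Cartan-Dieudonne, by induction on the codimension of the fixed space. If
  \<open>A\<close> moves \<open>v\<close>, the reflection along \<open>A *v v - v\<close> exchanges
  \<open>A *v v\<close> and \<open>v\<close>, which have equal length, so composing with it makes
  \<open>v\<close> a new fixed vector.\<close>

lemma orthogonal_matrix_product_householder:
  fixes A :: "real^'n^'n"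
  assumes "orthogonal_matrix A"
  shows "\<exists>us. (\<forall>u\<in>set us. u \<noteq> 0) \<and> A = foldr (\<lambda>u B. householder u ** B) us (mat 1)"
proof -
  define F where "F A = {w. A *v w = w}" for A :: "real^'n^'n"
  have sub: "subspace (F A)" for A
    by (auto simp: F_def subspace_def matrix_vector_right_distrib matrix_vector_mult_scaleR)
  show ?thesis using assms
  proof (induction "CARD('n) - dim (F A)" arbitrary: A rule: less_induct)
    case less
    show ?case
    proof (cases "A = mat 1")
      case True then show ?thesis by (intro exI[of _ "[]"]) simp
    next
      case False
      then obtain v where v: "A *v v \<noteq> v"
        by (metis matrix_eq matrix_vector_mul_lid)
      define u where "u = A *v v - v"
      have u0: "u \<noteq> 0" using v by (simp add: u_def)
      have iso: "(A *v x) \<bullet> (A *v y) = x \<bullet> y" for x y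
        using less.prems by (metis orthogonal_matrix_def
          matrix_vector_mul_lid dot_lmul_matrix matrix_vector_mul_assoc transpose_matrix_vector)
      let ?B = "householder u ** A"
      have hv: "?B *v v = v"
      proof -
        have "u \<bullet> u = 2 * (u \<bullet> (A *v v))"
          using iso[of v v] by (simp add: u_def inner_diff_left inner_diff_right inner_commute)
        then have "2 * (u \<bullet> (A *v v)) / (u \<bullet> u) = 1"
          using u0 by (metis divide_self inner_eq_zero_iff)
        then show ?thesis
          unfolding matrix_vector_mul_assoc[symmetric] householder_apply by (simp only: scaleR_one) (simp add: u_def)
      qed
      \<comment> \<open>Old fixed vectors survive: if \<open>A\<close> fixes \<open>w\<close>, then
        \<open>w\<close> has the same inner product with \<open>v\<close> and with
        \<open>A *v v\<close>, so it lies in the mirror of the reflection.\<close>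
      have "w \<in> F ?B" if "w \<in> F A" for w
      proof -
        have w: "A *v w = w" using that by (simp add: F_def)
        have "u \<bullet> w = 0"
          using iso[of v w] w by (simp add: u_def inner_diff_left)
        then show ?thesis
          unfolding F_def mem_Collect_eq matrix_vector_mul_assoc[symmetric] householder_apply by (simp add: w)
      qed
      then have "F A \<subset> F ?B" using hv v unfolding F_def by blast
      then have "dim (F A) < dim (F ?B)"
        by (metis dim_psubset span_eq_iff sub)
      moreover have "dim (F ?B) \<le> CARD('n)"
        using dim_subset_UNIV[of "F ?B"] by simp
      ultimately have "CARD('n) - dim (F ?B) < CARD('n) - dim (F A)" by linarith
      moreover have "orthogonal_matrix ?B"
        by (simp add: less.prems orthogonal_matrix_householder orthogonal_matrix_mul u0)
      ultimately obtain us where us: "\<forall>u\<in>set us. u \<noteq> 0" "?B = foldr (\<lambda>u B. householder u ** B) us (mat 1)"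
        using less.hyps by meson
      have "A = householder u ** ?B"
        by (simp add: matrix_mul_assoc householder_householder u0)
      then show ?thesis
        using us u0 by (intro exI[of _ "u # us"]) auto
    qed
  qed
qed

text \<open>Purely algebraic axioms; the topology of the group enters only through the curves it
  contains.\<close>

locale matrix_group =
  fixes G :: "(real^'n^'n) set"
  assumes rotation: "A \<in> G \<Longrightarrow> rotation_matrix A"
    and one: "mat 1 \<in> G"
    and mult: "A \<in> G \<Longrightarrow> B \<in> G \<Longrightarrow> A ** B \<in> G"
    and inverse: "A \<in> G \<Longrightarrow> transpose A \<in> G"
begin

lemma transpose_mult [simp]: "A \<in> G \<Longrightarrow> transpose A ** A = mat 1"
  and mult_transpose [simp]: "A \<in> G \<Longrightarrow> A ** transpose A = mat 1"
  using rotation by (auto simp: rotation_matrix_def orthogonal_matrix_def)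

text \<open>Call nonzero vectors related if the product of their reflections lies in
  \<open>G\<close>. Close vectors give a product close to the identity, so this equivalence relation
  has open classes, and on the connected punctured space it is total. Every rotation is a product of
  an even number of reflections.\<close>

lemma all_rotations_if_nhd:
  assumes "2 \<le> CARD('n)" "e > 0"
    and nhd: "\<And>A. rotation_matrix A \<Longrightarrow> dist A (mat 1) < e \<Longrightarrow> A \<in> G"
  shows "G = special_orthogonal"
proof -
  have pair: "householder u ** householder v \<in> G" if "u \<noteq> 0" "v \<noteq> 0" for u v :: "real^'n"
  proof (rule connected_equivalence_relation[where S = "UNIV - {0}" and R = "\<lambda>u v. householder u ** householder v \<in> G"])
    show "connected (UNIV - {0 :: real^'n})"
      using assms(1) by (intro connected_open_delete) auto
    show "householder y ** householder x \<in> G" if "householder x ** householder y \<in> G" for x y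
      using inverse[OF that] by (simp add: matrix_transpose_mul transpose_householder)
    show "householder x ** householder z \<in> G"
      if "householder x ** householder y \<in> G" "householder y ** householder z \<in> G" "y \<in> UNIV - {0}" for x y z
    proof -
      have "(householder x ** householder y) ** (householder y ** householder z) = householder x ** (householder y ** householder y) ** householder z"
        by (simp add: matrix_mul_assoc)
      with mult[OF that(1,2)] that(3) show ?thesis
        by (simp add: householder_householder)
    qed
    show "\<exists>T. openin (top_of_set (UNIV - {0})) T \<and> a \<in> T \<and> (\<forall>x\<in>T. householder a ** householder x \<in> G)"
      if "a \<in> UNIV - {0}" for a
    proof -
      let ?S = "UNIV - {0 :: real^'n}"
      have "continuous_on ?S (\<lambda>x. householder a ** householder x)"
        unfolding householder_def by (intro continuous_intros) auto
      then have "openin (top_of_set ?S) (?S \<inter> (\<lambda>x. householder a ** householder x) -` ball (mat 1) e)"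
        by (rule continuous_openin_preimage_gen) simp
      moreover have "householder a ** householder x \<in> G"
        if "x \<in> ?S \<inter> (\<lambda>x. householder a ** householder x) -` ball (mat 1) e" for x
        using that \<open>a \<in> ?S\<close>
        by (intro nhd) (auto simp: rotation_matrix_def orthogonal_matrix_mul orthogonal_matrix_householder
            det_mul det_householder dist_commute)
      ultimately show ?thesis
        using \<open>a \<in> ?S\<close> \<open>e > 0\<close>
        by (intro exI[of _ "?S \<inter> (\<lambda>x. householder a ** householder x) -` ball (mat 1) e"])
          (auto simp: householder_householder)
    qed
  qed (use that in auto)
  let ?P = "\<lambda>us. foldr (\<lambda>u B. householder u ** B) us (mat 1 :: real^'n^'n)"
  have det: "det (?P us) = (-1) ^ length us" if "\<forall>u\<in>set us. u \<noteq> 0" for us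
    using that by (induction us) (auto simp: det_mul det_householder)
  have even: "?P us \<in> G" if "\<forall>u\<in>set us. u \<noteq> 0" "even (length us)" for us
    using that
  proof (induction us rule: induct_list012)
    case (3 u v us)
    then show ?case using mult[OF pair[of u v], of "?P us"] by (simp add: matrix_mul_assoc)
  qed (auto simp: one)
  have "A \<in> G" if A: "rotation_matrix A" for A
  proof -
    obtain us where us: "\<forall>u\<in>set us. u \<noteq> 0" "A = ?P us"
      using orthogonal_matrix_product_householder A unfolding rotation_matrix_def by blast
    have "(-1 :: real) ^ length us = 1"
      using det[OF us(1)] A us(2) by (simp add: rotation_matrix_def)
    then have "even (length us)"
      by (metis neg_one_odd_power one_neq_neg_one)
    then show ?thesis using even us by blast
  qed
  then show ?thesis using rotation by (auto simp: special_orthogonal_def)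
qed

section \<open>Tangent vectors\<close>

text \<open>Differentiability is asked only at 0 and continuity everywhere, exactly what the open
  mapping theorem below demands of maps built from such curves.\<close>

definition tangents :: "(real^'n^'n) set" where
  "tangents = {X. \<exists>c. c 0 = mat 1 \<and> (\<forall>t. c t \<in> G) \<and> continuous_on UNIV c \<and>
     (c has_vector_derivative X) (at (0::real))}"

lemma tangents_conj:
  assumes "A \<in> G" "X \<in> tangents" shows "A ** X ** transpose A \<in> tangents"
proof -
  obtain c where c: "c 0 = mat 1" "\<And>t. c t \<in> G" "continuous_on UNIV c"
     "(c has_vector_derivative X) (at (0::real))"
    using assms(2) by (auto simp: tangents_def)
  have "((\<lambda>t. A ** c t ** transpose A) has_vector_derivative A ** X ** transpose A) (at 0)"
    by (intro bounded_linear.has_vector_derivative[OF _ c(4)]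
        bounded_linear_compose[OF matrix_mult.bounded_linear_left
          matrix_mult.bounded_linear_right])
  then show ?thesis using c(1-3) assms(1)
    unfolding tangents_def by (auto intro!: exI[of _ "\<lambda>t. A ** c t ** transpose A"] continuous_intros mult inverse)
qed

text \<open>Velocities add when curves are multiplied, and scale when the parameter is
  rescaled.\<close>

lemma subspace_tangents: "subspace tangents"
proof (rule subspaceI)
  show "0 \<in> tangents"
    unfolding tangents_def by (auto intro!: exI[of _ "\<lambda>_. mat 1"] one derivative_eq_intros)
next
  fix X Y assume "X \<in> tangents" "Y \<in> tangents"
  then obtain c d where c: "c 0 = mat 1" "\<And>t. c t \<in> G" "continuous_on UNIV c"
     "(c has_vector_derivative X) (at (0::real))"
    and d: "d 0 = mat 1" "\<And>t. d t \<in> G" "continuous_on UNIV d"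
     "(d has_vector_derivative Y) (at (0::real))"
    by (auto simp: tangents_def)
  have "((\<lambda>t. c t ** d t) has_vector_derivative X + Y) (at 0)"
    using matrix_mult.has_vector_derivative[OF c(4) d(4)] c(1) d(1) by (simp add: add.commute)
  then show "X + Y \<in> tangents" using c(1-3) d(1-3)
    unfolding tangents_def by (auto intro!: exI[of _ "\<lambda>t. c t ** d t"] continuous_intros mult)
next
  fix r :: real and X assume "X \<in> tangents"
  then obtain c where c: "c 0 = mat 1" "\<And>t. c t \<in> G" "continuous_on UNIV c"
     "(c has_vector_derivative X) (at (0::real))"
    by (auto simp: tangents_def)
  have "(c \<circ> (\<lambda>t. r * t) has_vector_derivative r *\<^sub>R X) (at 0)"
    by (rule vector_diff_chain_at) (auto intro!: derivative_eq_intros c(4))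
  moreover have "continuous_on UNIV (\<lambda>t. c (r * t))"
    by (rule continuous_on_compose2[OF c(3)]) (auto intro!: continuous_intros)
  ultimately show "r *\<^sub>R X \<in> tangents"
    using c(1-3) unfolding tangents_def by (auto intro!: exI[of _ "\<lambda>t. c (r * t)"] simp: o_def)
qed

text \<open>For skew \<open>X\<close> this is the commutator of \<open>X\<close> and
  \<open>Y\<close>. Conjugating \<open>Y\<close> along a curve with velocity \<open>X\<close> stays
  among the tangents; the bracket is a limit of difference quotients inside a linear subspace, which
  is closed in finite dimension.\<close>

lemma tangents_bracket:
  assumes "X \<in> tangents" "Y \<in> tangents" shows "X ** Y + Y ** transpose X \<in> tangents"
proof -
  obtain c where c: "c 0 = mat 1" "\<And>t. c t \<in> G" "continuous_on UNIV c"
     "(c has_vector_derivative X) (at (0::real))"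
    using assms by (auto simp: tangents_def)
  define f where "f t = c t ** Y ** transpose (c t)" for t
  have "(f has_vector_derivative X ** Y + Y ** transpose X) (at 0)"
  proof -
    have "((\<lambda>t. transpose (c t)) has_vector_derivative transpose X) (at 0)"
      by (rule bounded_linear.has_vector_derivative[OF bounded_linear_transpose c(4)])
    moreover have "((\<lambda>t. c t ** Y) has_vector_derivative X ** Y) (at 0)"
      using matrix_mult.has_vector_derivative[OF c(4) has_vector_derivative_const[of Y]]
      by (simp add: matrix_mult.zero_right)
    ultimately show ?thesis unfolding f_def
      
      using matrix_mult.has_vector_derivative[of "\<lambda>t. c t ** Y" _ 0 UNIV "\<lambda>t. transpose (c t)"] c(1)
      by (simp add: add.commute transpose_mat)
  qed
  then have lim: "((\<lambda>h. (f h - f 0) /\<^sub>R h) \<longlongrightarrow> X ** Y + Y ** transpose X) (at 0)"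
  proof -
    define L where "L = X ** Y + Y ** transpose X"
    have "((\<lambda>h. norm (f (0 + h) - f 0 - h *\<^sub>R L) / norm h) \<longlongrightarrow> 0) (at 0)"
      using \<open>(f has_vector_derivative _) _\<close> unfolding has_vector_derivative_def has_derivative_at L_def by blast
    moreover have "\<forall>\<^sub>F h in at 0. norm (f (0 + h) - f 0 - h *\<^sub>R L) / norm h = norm ((f h - f 0) /\<^sub>R h - L)"
    proof (rule eventually_mono[OF eventually_neq_at_within[of 0]])
      fix h :: real assume "h \<noteq> 0"
      then have "f (0 + h) - f 0 - h *\<^sub>R L = h *\<^sub>R ((f h - f 0) /\<^sub>R h - L)"
        by (simp add: scaleR_diff_right)
      then show "norm (f (0 + h) - f 0 - h *\<^sub>R L) / norm h = norm ((f h - f 0) /\<^sub>R h - L)"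
        using \<open>h \<noteq> 0\<close> by (simp only: norm_scaleR) simp
    qed
    ultimately have "((\<lambda>h. norm ((f h - f 0) /\<^sub>R h - L)) \<longlongrightarrow> 0) (at 0)"
      by (rule Lim_transform_eventually)
    then show ?thesis unfolding L_def[symmetric]
      by (rule LIM_zero_cancel[OF tendsto_norm_zero_cancel])
  qed
  show ?thesis
  proof (rule Lim_in_closed_set[OF closed_subspace[OF subspace_tangents] _ _ lim])
    show "\<forall>\<^sub>F h in at 0. (f h - f 0) /\<^sub>R h \<in> tangents"
      using assms(2) c(2) unfolding f_def
      by (auto intro!: always_eventually subspace_tangents subspace_scale subspace_diff tangents_conj)
  qed auto
qed

text \<open>The product \<open>F\<close> of curves with velocities spanning the skew matrices is completed by the factor
  \<open>1 + S\<close>, with \<open>S\<close> symmetric, to a map between spaces of equal dimension. If its value is orthogonal,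
  then so is \<open>1 + S\<close>, and a small \<open>S\<close> vanishes.\<close>

lemma all_rotations_if_tangents:
  assumes card: "2 \<le> CARD('n)"
    and skew: "\<And>X. transpose X = - X \<Longrightarrow> X \<in> tangents"
  shows "G = special_orthogonal"
proof -
  \<comment> \<open>Indexed by all ordered pairs, diagonal included: with the factor 1/2 the
    combination with coefficients \<open>A $ i $ j\<close> is the skew part of \<open>A\<close>, so
    a full matrix can serve as parameter.\<close>
  define X :: "'n \<times> 'n \<Rightarrow> real^'n^'n"
    where "X = (\<lambda>(i, j). (1/2) *\<^sub>R (outer (axis i 1) (axis j 1) - outer (axis j 1) (axis i 1)))"
  have "X p \<in> tangents" for p
    by (rule skew) (simp add: X_def case_prod_unfold transpose_scaleR transpose_diff transpose_outer scaleR_diff_right)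
  then have "\<forall>p. \<exists>c. c 0 = mat 1 \<and> (\<forall>t. c t \<in> G) \<and> continuous_on UNIV c \<and>
      (c has_vector_derivative X p) (at (0::real))"
    by (auto simp: tangents_def)
  then obtain c where c: "\<And>p. c p 0 = mat 1" "\<And>p t. c p t \<in> G" "\<And>p. continuous_on UNIV (c p)"
      "\<And>p. (c p has_vector_derivative X p) (at (0::real))"
    by metis
  obtain ps :: "('n \<times> 'n) list" where ps: "set ps = UNIV" "distinct ps"
    using finite_distinct_list[of "UNIV :: ('n \<times> 'n) set"] by auto
  define F where "F ps A = foldr (\<lambda>p B. c p (A $ fst p $ snd p) ** B) ps (mat 1)" for ps and A :: "real^'n^'n"
  have F_Cons: "F (p # ps) = (\<lambda>A. c p (A $ fst p $ snd p) ** F ps A)" and F_Nil: "F [] = (\<lambda>A. mat 1)" for p ps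
    by (auto simp: F_def fun_eq_iff)
  have F0: "F ps 0 = mat 1" for ps
    by (induction ps) (auto simp: F_Cons F_Nil c)
  have FG: "F ps A \<in> G" for ps A
    by (induction ps) (auto simp: F_Cons F_Nil c one mult)
  have Fcont: "continuous_on UNIV (F ps)" for ps
  proof (induction ps)
    case (Cons p ps)
    have "continuous_on UNIV (\<lambda>A. c p (A $ fst p $ snd p))"
      by (rule continuous_on_compose2[OF c(3)]) (auto intro!: continuous_intros)
    then show ?case unfolding F_Cons by (intro continuous_intros Cons.IH)
  qed (simp add: F_Nil)
  have Fder: "(F ps has_derivative (\<lambda>A. \<Sum>p\<leftarrow>ps. A $ fst p $ snd p *\<^sub>R X p)) (at 0)" for ps
  proof (induction ps)
    case (Cons p ps)
    have "((\<lambda>A :: real^'n^'n. A $ fst p $ snd p) has_derivative (\<lambda>A. A $ fst p $ snd p)) (at 0)"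
      by (intro bounded_linear_imp_has_derivative bounded_linear_compose[OF bounded_linear_vec_nth bounded_linear_vec_nth])
    then have "((\<lambda>A. c p (A $ fst p $ snd p)) has_derivative (\<lambda>A. A $ fst p $ snd p *\<^sub>R X p)) (at 0)"
      by (rule has_derivative_compose) (use c(4)[of p] in \<open>simp add: has_vector_derivative_def\<close>)
    from matrix_mult.FDERIV[OF this Cons.IH] show ?case
      by (simp add: F_Cons F0 c add.commute)
  qed (simp add: F_Nil)
  define S where "S A = (1/2) *\<^sub>R (A + transpose A)" for A :: "real^'n^'n"
  have linS: "bounded_linear S"
    unfolding S_def by (intro bounded_linear_intros bounded_linear_transpose)
  have symS: "transpose (S A) = S A" for A
    by (simp add: S_def transpose_scaleR transpose_add add.commute)
  \<comment> \<open>The two factors contribute the skew and the symmetric part of \<open>A\<close>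
    to first order, so the derivative at 0 is the identity.\<close>
  define \<Phi> where "\<Phi> A = F ps A ** (mat 1 + S A)" for A
  have \<Phi>der: "(\<Phi> has_derivative id) (at 0)"
  proof -
    have "(\<Sum>p\<leftarrow>ps. A $ fst p $ snd p *\<^sub>R X p) = (1/2) *\<^sub>R (A - transpose A)" for A
    proof -
      have "(\<Sum>p\<leftarrow>ps. A $ fst p $ snd p *\<^sub>R X p) = (\<Sum>p\<in>UNIV. A $ fst p $ snd p *\<^sub>R X p)"
        using ps by (simp add: sum_list_distinct_conv_sum_set)
      also have "\<dots> = (\<Sum>i\<in>UNIV. \<Sum>j\<in>UNIV. A $ i $ j *\<^sub>R X (i, j))"
        by (simp add: sum.cartesian_product case_prod_unfold)
      also have "\<dots> = (1/2) *\<^sub>R (A - transpose A)"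
      proof -
        have *: "(\<Sum>i\<in>UNIV. \<Sum>j\<in>UNIV. A $ i $ j * (axis i 1 $ k * axis j 1 $ l) / 2) = A $ k $ l / 2" for k l
          by (simp add: axis_apply if_distrib[of "\<lambda>x. _ * x"] if_distrib[of "\<lambda>x. x * _"]
              if_distrib[of "\<lambda>x. x / 2"] sum.If_cases sum.delta cong: if_cong)
        have **: "(\<Sum>i\<in>UNIV. \<Sum>j\<in>UNIV. A $ i $ j * (axis j 1 $ k * axis i 1 $ l) / 2) = A $ l $ k / 2" for k l
          using *[of l k] by (simp add: mult.commute[of "axis _ 1 $ k"])
        show ?thesis
          by (simp add: * ** vec_eq_iff X_def outer_nth transpose_def right_diff_distrib sum_subtractf)
      qed
      finally show ?thesis .
    qed
    moreover have "((\<lambda>A. mat 1 + S A) has_derivative S) (at 0)"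
      by (auto intro!: derivative_eq_intros bounded_linear_imp_has_derivative linS)
    ultimately have "(\<Phi> has_derivative (\<lambda>A. S A + (1/2) *\<^sub>R (A - transpose A))) (at 0)"
      unfolding \<Phi>_def using matrix_mult.FDERIV[OF Fder[of ps], of "\<lambda>A. mat 1 + S A" S]
      by (simp add: F0 linear_0[OF bounded_linear.linear[OF linS]])
    also have "(\<lambda>A. S A + (1/2) *\<^sub>R (A - transpose A)) = id"
      by (auto simp: S_def scaleR_diff_right scaleR_add_right fun_eq_iff simp flip: scaleR_add_left)
    finally show ?thesis .
  qed
  have "\<Phi> 0 = mat 1" by (simp add: \<Phi>_def F0 S_def transpose_def vec_eq_iff)
  obtain K where K: "K > 0" "\<And>(A :: real^'n^'n) (B :: real^'n^'n). norm (A ** B) \<le> norm A * norm B * K"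
    using matrix_mult.pos_bounded by blast
  obtain L where L: "L > 0" "\<And>A. norm (S A) \<le> norm A * L"
    using bounded_linear.pos_bounded[OF linS] by blast
  \<comment> \<open>Within this radius \<open>norm (S A) * K < 1\<close>. Then (1 + S)(1 + S) = 1,
    that is 2 S = - S S, can only hold for S = 0.\<close>
  let ?r = "1 / (K * L)"
  have "?r > 0" using K(1) L(1) by simp
  have "continuous_on UNIV \<Phi>"
    unfolding \<Phi>_def by (intro continuous_intros Fcont linear_continuous_on linS)
  then have "\<Phi> 0 \<in> interior (\<Phi> ` ball 0 ?r)"
    by (rule sussmann_open_mapping[OF open_UNIV _ _ \<Phi>der bounded_linear_ident])
       (use \<open>?r > 0\<close> in \<open>simp_all add: id_def o_def\<close>)
  then obtain e where e: "e > 0" "ball (mat 1) e \<subseteq> \<Phi> ` ball 0 ?r"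
    using \<open>\<Phi> 0 = mat 1\<close> by (metis mem_interior)
  show ?thesis
  proof (rule all_rotations_if_nhd[OF card \<open>e > 0\<close>])
    fix R :: "real^'n^'n" assume R: "rotation_matrix R" "dist R (mat 1) < e"
    then obtain A where A: "norm A < ?r" "R = F ps A ** (mat 1 + S A)"
      using e(2) unfolding \<Phi>_def by (force simp: dist_commute)
    have "transpose (F ps A) ** R = mat 1 + S A"
      by (simp add: A(2) matrix_mul_assoc FG)
    moreover have "orthogonal_matrix (transpose (F ps A) ** R)"
      using R(1) rotation[OF inverse[OF FG]] by (simp add: rotation_matrix_def orthogonal_matrix_mul)
    ultimately have "transpose (mat 1 + S A) ** (mat 1 + S A) = mat 1"
      by (simp add: orthogonal_matrix_def)
    then have "(mat 1 + S A) ** (mat 1 + S A) = mat 1"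
      by (simp add: transpose_add symS)
    then have "2 *\<^sub>R S A = - (S A ** S A)"
      by (simp add: matrix_add_ldistrib matrix_mult.add_left scaleR_2 algebra_simps eq_neg_iff_add_eq_0)
    then have "2 * norm (S A) = norm (S A ** S A)"
      by (metis abs_numeral norm_minus_cancel norm_scaleR)
    also have "\<dots> \<le> norm (S A) * (norm (S A) * K)" using K(2)[of "S A" "S A"] by (simp add: mult.assoc)
    finally have "norm (S A) * (2 - norm (S A) * K) \<le> 0" by (simp add: algebra_simps)
    moreover have "norm (S A) * K < 2"
    proof -
      have "norm (S A) * K \<le> norm A * L * K" using L(2)[of A] K(1) by simp
      also have "\<dots> < 2" using A(1) K(1) L(1) by (simp add: field_simps)
      finally show ?thesis .
    qed
    ultimately have "S A = 0"
      by (metis diff_gt_0_iff_gt linorder_not_le norm_le_zero_iff zero_less_mult_iff zero_less_norm_iff)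
    then show "R \<in> G" using A(2) FG by simp
  qed
qed

end

section \<open>Infinitesimal rotations of planes\<close>

definition wedge :: "real^'n \<Rightarrow> real^'n \<Rightarrow> real^'n^'n" where
  "wedge u v = outer u v - outer v u"

lemma wedge_commute: "wedge v u = - wedge u v"
  and wedge_self [simp]: "wedge u u = 0"
  by (simp_all add: wedge_def)

interpretation wedge: bounded_bilinear wedge
proof -
  have "bilinear (wedge :: real^'n \<Rightarrow> _)"
    unfolding bilinear_def wedge_def
    by (auto intro!: linearI simp: vec_eq_iff outer_nth algebra_simps)
  then show "bounded_bilinear (wedge :: real^'n \<Rightarrow> _)" by (simp add: bilinear_conv_bounded_bilinear)
qed

lemma conj_wedge: "A ** wedge u v ** transpose A = wedge (A *v u) (A *v v)"
  by (simp add: wedge_def matrix_mult.diff_right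
      matrix_mult.diff_left matrix_mul_outer outer_mul_matrix)

lemma transpose_wedge: "transpose (wedge u v) = - wedge u v"
  by (simp add: wedge_def transpose_diff transpose_outer)

text \<open>Fixes the orientation: for orthonormal \<open>u\<close>, \<open>v\<close> the wedge
  sends \<open>v\<close> to \<open>u\<close> and \<open>u\<close> to \<open>- v\<close>.\<close>

lemma wedge_mul_vector: "wedge u v *v w = (v \<bullet> w) *\<^sub>R u - (u \<bullet> w) *\<^sub>R v"
  by (simp add: wedge_def matrix_vector_mult_diff_rdistrib outer_mul_vector)

text \<open>Commutation relation of the rotation algebra: two planes sharing the axis
  \<open>v\<close> generate the plane of the other two axes. It is stated in the shape of
  \<open>tangents_bracket\<close>.\<close>

lemma bracket_wedge:
  assumes "u \<bullet> v = 0" "v \<bullet> w = 0" "u \<bullet> w = 0" "v \<bullet> v = 1"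
  shows "wedge u v ** wedge v w + wedge v w ** transpose (wedge u v) = wedge u w"
proof -
  have "(wedge u v ** wedge v w + wedge v w ** transpose (wedge u v)) *v x = wedge u w *v x" for x
    unfolding matrix_vector_mult_add_rdistrib matrix_vector_mul_assoc[symmetric] transpose_wedge wedge_commute[of v u, symmetric] wedge_mul_vector
    using assms by (simp add: inner_diff_right inner_commute algebra_simps)
  then show ?thesis by (metis matrix_eq)
qed

lemma matrix_eq_sum_outer:
  fixes A :: "real^'n^'n"
  shows "A = (\<Sum>i\<in>UNIV. \<Sum>j\<in>UNIV. A $ i $ j *\<^sub>R outer (axis i 1) (axis j 1))"
  by (simp add: vec_eq_iff outer_nth axis_apply if_distrib[of "\<lambda>x. _ * x"] if_distrib[of "\<lambda>x. x * _"]
      sum.If_cases sum.delta cong: if_cong)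

text \<open>Each plane occurs for both orders of its axes with the same contribution, hence the
  1/2.\<close>

lemma skew_eq_sum_wedge:
  fixes X :: "real^'n^'n"
  assumes "transpose X = - X"
  shows "X = (\<Sum>i\<in>UNIV. \<Sum>j\<in>UNIV. (X $ i $ j / 2) *\<^sub>R wedge (axis i 1) (axis j 1))"
proof -
  have "(\<Sum>i\<in>UNIV. \<Sum>j\<in>UNIV. (X $ i $ j / 2) *\<^sub>R wedge (axis i 1) (axis j 1)) =
      (1 / 2) *\<^sub>R (X - transpose X)"
    apply (subst (2 3) matrix_eq_sum_outer[of X])
    apply (simp only: linear_sum[OF bounded_linear.linear[OF bounded_linear_transpose]])
    apply (simp add: wedge_def transpose_scaleR transpose_outer scaleR_diff_right
        sum_subtractf scaleR_sum_right)
    done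
  also have "\<dots> = X" by (simp add: assms flip: scaleR_2)
  finally show ?thesis by simp
qed

section \<open>Rotations induced by translations of the mean\<close>

abbreviation mean_axis :: "'d::finite \<Rightarrow> real^('d + 'd uprod)" where
  "mean_axis j \<equiv> axis (Inl j) 1"

abbreviation cov_axis :: "'d::finite \<Rightarrow> 'd \<Rightarrow> real^('d + 'd uprod)" where
  "cov_axis i j \<equiv> axis (Inr (Upair i j)) 1"

text \<open>Half the length factor \<open>kappa\<close> of the covariance coordinate involved, see
  \<open>freq_eq_kappa\<close>.\<close>

definition freq :: "'d \<Rightarrow> 'd \<Rightarrow> real" where
  "freq i j = (if i = j then 1 / sqrt 2 else 1 / 2)"

text \<open>For fixed \<open>i\<close> the indices \<open>Upair i j\<close> are distinct, so the
  planes are mutually orthogonal and the sum is the exponential of \<open>t\<close> times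
  \<open>shift_generator i\<close>.\<close>

definition shift_rotation :: "'d::finite \<Rightarrow> real \<Rightarrow> real^('d + 'd uprod)^('d + 'd uprod)" where
  "shift_rotation i t = mat 1 + (\<Sum>j\<in>UNIV.
     (cos (freq i j * t) - 1) *\<^sub>R (outer (mean_axis j) (mean_axis j) + outer (cov_axis i j) (cov_axis i j)) +
     sin (freq i j * t) *\<^sub>R wedge (mean_axis j) (cov_axis i j))"

lemma inner_axis_1: "axis i (1::real) \<bullet> axis j 1 = (if i = j then 1 else 0)"
  by (simp add: inner_axis_axis)

lemma Upair_commute: "Upair i j = Upair j i"
  by (simp add: Upair_inject)

lemma Upair_eq_left [simp]: "Upair i j = Upair i k \<longleftrightarrow> j = k"
  by auto

lemma shift_rotation_0: "shift_rotation i 0 = mat 1"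
  by (simp add: shift_rotation_def)

lemma continuous_shift_rotation: "continuous_on UNIV (shift_rotation i)"
  unfolding shift_rotation_def by (intro continuous_intros)

lemma has_vector_derivative_shift_rotation:
  "(shift_rotation i has_vector_derivative
     (\<Sum>j\<in>UNIV. freq i j *\<^sub>R wedge (mean_axis j) (cov_axis i j))) (at 0)"
  unfolding shift_rotation_def
  by (auto intro!: derivative_eq_intros sum.cong)

text \<open>Frequency 1/2 completes a full turn at this time; only the plane of
  \<open>mean_axis i\<close> and \<open>cov_axis i i\<close> is still turned, by 2 sqrt 2
  \<pi>.\<close>

lemma shift_rotation_4pi:
  "shift_rotation i (4 * pi) *v w = w + (cos (2 * sqrt 2 * pi) - 1) *\<^sub>R
       ((mean_axis i \<bullet> w) *\<^sub>R mean_axis i + (cov_axis i i \<bullet> w) *\<^sub>R cov_axis i i) +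
     sin (2 * sqrt 2 * pi) *\<^sub>R ((cov_axis i i \<bullet> w) *\<^sub>R mean_axis i - (mean_axis i \<bullet> w) *\<^sub>R cov_axis i i)" (is ?A)
  and transpose_shift_rotation_4pi:
  "transpose (shift_rotation i (4 * pi)) *v w = w + (cos (2 * sqrt 2 * pi) - 1) *\<^sub>R
       ((mean_axis i \<bullet> w) *\<^sub>R mean_axis i + (cov_axis i i \<bullet> w) *\<^sub>R cov_axis i i) -
     sin (2 * sqrt 2 * pi) *\<^sub>R ((cov_axis i i \<bullet> w) *\<^sub>R mean_axis i - (mean_axis i \<bullet> w) *\<^sub>R cov_axis i i)" (is ?B)
proof -
  have freq: "freq i i * (4 * pi) = 2 * sqrt 2 * pi"
    by (simp add: freq_def real_div_sqrt field_simps)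
  have "cos (freq i j * (4 * pi)) = 1" "sin (freq i j * (4 * pi)) = 0" if "j \<noteq> i" for j
    using that by (auto simp: freq_def)
  then have *: "shift_rotation i (4 * pi) = mat 1 +
     ((cos (2 * sqrt 2 * pi) - 1) *\<^sub>R (outer (mean_axis i) (mean_axis i) + outer (cov_axis i i) (cov_axis i i)) +
     sin (2 * sqrt 2 * pi) *\<^sub>R wedge (mean_axis i) (cov_axis i i))"
    unfolding shift_rotation_def
    by (subst sum.remove[of _ i]) (simp_all add: freq)
  show ?A ?B unfolding *
    by (simp_all add: transpose_add transpose_scaleR transpose_outer transpose_wedge matrix_vector_mult_add_rdistrib
        matrix_vector.scaleR_left outer_mul_vector wedge_mul_vector matrix_vector_mult_diff_rdistrib)
qed

lemma cos_2_sqrt_2_pi: "cos (2 * sqrt 2 * pi) \<noteq> 1"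
proof
  assume "cos (2 * sqrt 2 * pi) = 1"
  then obtain n :: int where "2 * sqrt 2 * pi = of_int n * 2 * pi"
    using cos_one_2pi_int by auto
  then have n: "sqrt 2 = of_int n" by simp
  have "1 < sqrt 2" "sqrt 2 < 2" by (auto simp: real_less_lsqrt)
  then have "1 < n" "n < 2" unfolding n by auto
  then show False by linarith
qed

text \<open>Regard the coordinate axes as vertices and the isolated planes as edges. The graph is
  connected, since \<open>mean_axis i\<close> and \<open>mean_axis j\<close> are both joined to
  \<open>cov_axis i j\<close>, and brackets compose edges; so the infinitesimal rotation of every
  coordinate plane is a tangent.\<close>

lemma all_rotations_if_shift_rotations:
  fixes G :: "(real^('d::finite + 'd uprod)^('d + 'd uprod)) set"
  assumes "matrix_group G" and rot: "\<And>i t. shift_rotation i t \<in> G"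
  shows "G = special_orthogonal"
proof -
  interpret matrix_group G by fact
  note W = subspace_tangents
  let ?X = "\<lambda>i :: 'd. \<Sum>j\<in>UNIV. freq i j *\<^sub>R wedge (mean_axis j) (cov_axis i j)"
  have X: "?X i \<in> tangents" for i
    unfolding tangents_def
    using shift_rotation_0 rot continuous_shift_rotation has_vector_derivative_shift_rotation by blast
  \<comment> \<open>The frequencies are incommensurable, so that \<open>?g i\<close> rotates a single plane only.\<close>
  let ?g = "\<lambda>i :: 'd. shift_rotation i (4 * pi)"
  let ?c = "cos (2 * sqrt 2 * pi)"
  have off_diag: "wedge (mean_axis i) (cov_axis k i) \<in> tangents" if "i \<noteq> k" for i k
  proof -
    \<comment> \<open>A second difference: adding the conjugates by the rotation and by its inverse
      cancels the sine terms.\<close>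
    have "?g i ** ?X k ** transpose (?g i) + transpose (?g i) ** ?X k ** transpose (transpose (?g i)) - 2 *\<^sub>R ?X k
        = (\<Sum>j\<in>UNIV. freq k j *\<^sub>R
            (wedge (?g i *v mean_axis j) (?g i *v cov_axis k j) +
             wedge (transpose (?g i) *v mean_axis j) (transpose (?g i) *v cov_axis k j) -
             2 *\<^sub>R wedge (mean_axis j) (cov_axis k j)))"
      unfolding matrix_mult.sum_right
        matrix_mult.sum_left matrix_mult.scaleR_right matrix_mult.scaleR_left conj_wedge
      by (simp add: sum.distrib sum_subtractf scaleR_diff_right scaleR_add_right scaleR_sum_right algebra_simps)
    \<comment> \<open>As \<open>k\<close> differs from \<open>i\<close>, no
      \<open>cov_axis k j\<close> equals \<open>cov_axis i i\<close>. So \<open>?g i\<close> moves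
      only the factor \<open>mean_axis i\<close> of the summand \<open>j = i\<close>, and its second
      difference is \<open>2 * (?c - 1)\<close> times itself.\<close>
    also have "\<dots> = (\<Sum>j\<in>UNIV. if j = i then (freq k i * (2 * (?c - 1))) *\<^sub>R wedge (mean_axis i) (cov_axis k i) else 0)"
    proof (rule sum.cong[OF refl])
      fix j
      show "freq k j *\<^sub>R
            (wedge (?g i *v mean_axis j) (?g i *v cov_axis k j) +
             wedge (transpose (?g i) *v mean_axis j) (transpose (?g i) *v cov_axis k j) -
             2 *\<^sub>R wedge (mean_axis j) (cov_axis k j)) =
            (if j = i then (freq k i * (2 * (?c - 1))) *\<^sub>R wedge (mean_axis i) (cov_axis k i) else 0)"
        using that unfolding shift_rotation_4pi transpose_shift_rotation_4pi
        by (simp add: inner_axis_1 wedge.add_left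
            wedge.diff_left wedge.scaleR_left
            wedge.minus_left)
          (simp add: vec_eq_iff algebra_simps)
    qed
    also have "\<dots> = (freq k i * (2 * (?c - 1))) *\<^sub>R wedge (mean_axis i) (cov_axis k i)"
      by simp
    finally have eq: "wedge (mean_axis i) (cov_axis k i) = inverse (freq k i * (2 * (?c - 1))) *\<^sub>R
        (?g i ** ?X k ** transpose (?g i) + transpose (?g i) ** ?X k ** transpose (transpose (?g i)) - 2 *\<^sub>R ?X k)"
      using cos_2_sqrt_2_pi by (simp add: freq_def)
    show ?thesis unfolding eq
      by (intro subspace_scale[OF W] subspace_diff[OF W] subspace_add[OF W] tangents_conj inverse rot X)
  qed
  have diag: "wedge (mean_axis i) (cov_axis i i) \<in> tangents" for i
  proof -
    have "?X i = freq i i *\<^sub>R wedge (mean_axis i) (cov_axis i i) +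
        (\<Sum>j\<in>UNIV - {i}. freq i j *\<^sub>R wedge (mean_axis j) (cov_axis i j))"
      by (rule sum.remove) auto
    then have "wedge (mean_axis i) (cov_axis i i) = inverse (freq i i) *\<^sub>R
        (?X i - (\<Sum>j\<in>UNIV - {i}. freq i j *\<^sub>R wedge (mean_axis j) (cov_axis i j)))"
      by (simp add: freq_def)
    also have "\<dots> \<in> tangents"
      by (intro subspace_scale[OF W] subspace_diff[OF W] subspace_sum[OF W] X off_diag) auto
    finally show ?thesis .
  qed
  have edge: "wedge (mean_axis i) (cov_axis i j) \<in> tangents" for i j
    using diag off_diag[of i j] by (cases "i = j") (auto simp: Upair_commute[of i j])
  define R where "R a b \<longleftrightarrow> wedge (axis a 1) (axis b 1) \<in> tangents" for a b :: "'d + 'd uprod"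
  have R_refl: "R a a" for a by (simp add: R_def subspace_0[OF W])
  have R_sym: "R b a" if "R a b" for a b
    using subspace_neg[OF W] that unfolding R_def wedge_commute[of "axis b 1"] by blast
  have R_trans: "R a c" if "R a b" "R b c" for a b c
  proof (cases "a = b \<or> b = c \<or> a = c")
    case False
    then have "wedge (axis a 1) (axis b 1) ** wedge (axis b 1) (axis c 1) +
        wedge (axis b 1) (axis c 1) ** transpose (wedge (axis a 1) (axis b 1)) = wedge (axis a 1) (axis c (1::real))"
      by (intro bracket_wedge) (auto simp: inner_axis_1)
    then show ?thesis using tangents_bracket that unfolding R_def by metis
  qed (use that R_refl in auto)
  have R_edge: "R (Inl i) (Inr (Upair i j))" for i j
    using edge by (simp add: R_def)
  have R_mean: "R (Inl i) (Inl j)" for i j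
    using R_trans[OF R_edge[of i j]] R_sym[OF R_edge[of j i]] by (simp add: Upair_commute[of i j])
  have R_all: "R (Inl k) a" for k a
  proof (cases a)
    case (Inr p)
    then obtain i j where "a = Inr (Upair i j)" by (metis uprod_exhaust)
    then show ?thesis using R_trans[OF R_mean R_edge] by blast
  qed (use R_mean in blast)
  have "R a b" for a b
    using R_trans[OF R_sym[OF R_all] R_all] by blast
  then have all: "wedge (axis a 1) (axis b 1) \<in> tangents" for a b :: "'d + 'd uprod"
    by (simp add: R_def)
  show ?thesis
  proof (rule all_rotations_if_tangents)
    \<comment> \<open>For a one-dimensional sample space the manifold has dimension exactly 2, just
      enough for the punctured space to be connected.\<close>
    have "(1::nat) \<le> CARD('d)" by (simp add: Suc_leI)
    then have "2 * 2 \<le> CARD('d) * (CARD('d) + 3)"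
      using mult_le_mono[of 1 "CARD('d)" 4 "CARD('d) + 3"] by simp
    then show "2 \<le> CARD('d + 'd uprod)"
      unfolding card_normal_coords by linarith
    show "Y \<in> tangents" if "transpose Y = - Y" for Y
      by (subst skew_eq_sum_wedge[OF that]) (intro subspace_sum[OF W] subspace_scale[OF W] all)
  qed
qed

section \<open>Gaussian integrals\<close>

lemma prod_Basis_cart: "(\<Prod>b\<in>Basis. f b) = (\<Prod>i\<in>UNIV. f (axis i (1::real)))"
  and sum_Basis_cart: "(\<Sum>b\<in>Basis. g b) = (\<Sum>i\<in>UNIV. g (axis i (1::real)))"
proof -
  have *: "Basis = range (\<lambda>i. axis i (1::real))" "inj (\<lambda>i. axis i (1::real))"
    by (auto simp: Basis_vec_def inj_def axis_eq_axis)
  show "(\<Prod>b\<in>Basis. f b) = (\<Prod>i\<in>UNIV. f (axis i (1::real)))"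
   and "(\<Sum>b\<in>Basis. g b) = (\<Sum>i\<in>UNIV. g (axis i (1::real)))"
    unfolding *(1) by (simp_all add: prod.reindex[OF *(2)] sum.reindex[OF *(2)])
qed

lemma measurable_vec_lambda [measurable (raw)]:
  fixes f :: "'n::finite \<Rightarrow> 'a \<Rightarrow> real"
  assumes [measurable]: "\<And>i. f i \<in> borel_measurable M"
  shows "(\<lambda>x. \<chi> i. f i x) \<in> borel_measurable M"
  by (rule borel_measurable_euclidean_space[THEN iffD2])
     (auto simp: Basis_vec_def cart_eq_inner_axis[symmetric])

text \<open>Both measures agree on boxes. The product form gives access to integration one
  coordinate at a time.\<close>

lemma lborel_cart_eq: "(lborel :: (real^'n) measure) = distr (\<Pi>\<^sub>M i\<in>UNIV. lborel) borel (\<lambda>f. \<chi> i. f i)"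
proof (rule lborel_eqI)
  interpret product_sigma_finite "\<lambda>_::'n. lborel :: real measure" ..
  fix l u :: "real^'n" assume le: "\<And>b. b \<in> Basis \<Longrightarrow> l \<bullet> b \<le> u \<bullet> b"
  have le': "l $ i \<le> u $ i" for i
    using le[of "axis i 1"] by (auto simp: Basis_vec_def cart_eq_inner_axis)
  have "emeasure (distr (\<Pi>\<^sub>M i\<in>UNIV. lborel) borel (\<lambda>f. \<chi> i. f i)) (box l u) =
      emeasure (\<Pi>\<^sub>M i\<in>(UNIV::'n set). lborel) (\<Pi>\<^sub>E i\<in>UNIV. {l $ i <..< u $ i})"
    by (subst emeasure_distr) (auto intro!: arg_cong2[where f=emeasure] simp: space_PiM PiE_def Pi_def mem_box_cart)
  also have "\<dots> = (\<Prod>i\<in>UNIV. ennreal (u $ i - l $ i))"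
    using le' by (subst emeasure_PiM) auto
  also have "\<dots> = ennreal (\<Prod>b\<in>Basis. (u - l) \<bullet> b)"
    using le' by (subst prod_ennreal) (auto simp: prod_Basis_cart cart_eq_inner_axis[symmetric])
  finally show "emeasure (distr (\<Pi>\<^sub>M i\<in>UNIV. lborel) borel (\<lambda>f. \<chi> i. f i)) (box l u) =
      ennreal (\<Prod>b\<in>Basis. (u - l) \<bullet> b)" .
qed simp

text \<open>The change of variables theorems of \<open>HOL-Analysis\<close> require a well-ordered index type.\<close>

lemma nn_integral_lborel_linear:
  fixes f :: "real^'n \<Rightarrow> real^'n"
  assumes "linear f" "det (matrix f) \<noteq> 0" "F \<in> borel_measurable borel"
  shows "(\<integral>\<^sup>+x. F x \<partial>lborel) = ennreal \<bar>det (matrix f)\<bar> * (\<integral>\<^sup>+x. F (f x) \<partial>lborel)"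
proof -
  \<comment> \<open>Nonsingularity is part of the induction predicate, because the elementary maps
    include singular ones; for them the claim is vacuous.\<close>
  define P where "P f \<longleftrightarrow> (det (matrix f) \<noteq> 0 \<longrightarrow> (\<forall>F\<in>borel_measurable borel.
      (\<integral>\<^sup>+x. F x \<partial>lborel) = ennreal \<bar>det (matrix f)\<bar> * (\<integral>\<^sup>+x. F (f x) \<partial>lborel)))"
    for f :: "real^'n \<Rightarrow> real^'n"
  have "P f"
  proof (rule induct_linear_elementary[OF assms(1), where P = P], goal_cases)
    case (1 f g)
  have [measurable]: "f \<in> borel_measurable borel" "g \<in> borel_measurable borel"
    using 1(1,2) by (auto intro!: borel_measurable_continuous_onI linear_continuous_on linear_conv_bounded_linear[THEN iffD1])
  have d: "det (matrix (f \<circ> g)) = det (matrix f) * det (matrix g)"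
    using 1(1,2) by (simp add: matrix_compose det_mul)
  show ?case
    unfolding P_def d
  proof (intro impI ballI)
    assume "det (matrix f) * det (matrix g) \<noteq> 0"
    then have nz: "det (matrix f) \<noteq> 0" "det (matrix g) \<noteq> 0" by auto
    fix F :: "real^'n \<Rightarrow> ennreal" assume [measurable]: "F \<in> borel_measurable borel"
    have "(\<integral>\<^sup>+x. F x \<partial>lborel) = ennreal \<bar>det (matrix f)\<bar> * (\<integral>\<^sup>+x. F (f x) \<partial>lborel)"
      by (rule 1(3)[unfolded P_def, rule_format, OF nz(1)]) measurable
    also have "(\<integral>\<^sup>+x. F (f x) \<partial>lborel) = ennreal \<bar>det (matrix g)\<bar> * (\<integral>\<^sup>+x. F (f (g x)) \<partial>lborel)"
      by (rule 1(4)[unfolded P_def, rule_format, OF nz(2)]) measurable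
    finally show "(\<integral>\<^sup>+x. F x \<partial>lborel) =
        ennreal \<bar>det (matrix f) * det (matrix g)\<bar> * (\<integral>\<^sup>+x. F ((f \<circ> g) x) \<partial>lborel)"
      by (simp add: abs_mult ennreal_mult mult.assoc)
  qed
next
  case (2 f i)
  then have "row i (matrix f) = 0"
    by (simp add: vec_eq_iff row_def matrix_def)
  then show ?case using 2 det_zero_row unfolding P_def by blast
next
  case (3 c)
  have mat: "matrix (\<lambda>x::real^'n. \<chi> i. c i * x $ i) = (\<chi> i j. if i = j then c i else 0)"
    by (auto simp: matrix_def vec_eq_iff axis_def)
  then have d: "det (matrix (\<lambda>x::real^'n. \<chi> i. c i * x $ i)) = (\<Prod>i\<in>UNIV. c i)"
    by (simp add: det_diagonal)
  have T: "(\<Sum>j\<in>Basis. (c (axis_index j) * (x \<bullet> j)) *\<^sub>R j) = (\<chi> i. c i * x $ i)" for x :: "real^'n"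
    by (simp add: sum_Basis_cart cart_eq_inner_axis[symmetric] vec_eq_iff axis_apply
        if_distrib[of "\<lambda>x. _ * x"] sum.delta cong: if_cong)
  show ?case
    unfolding P_def d
  proof (intro impI ballI)
    assume "prod c UNIV \<noteq> 0"
    then have c: "c i \<noteq> 0" for i by auto
    fix F :: "real^'n \<Rightarrow> ennreal" assume [measurable]: "F \<in> borel_measurable borel"
    show "(\<integral>\<^sup>+x. F x \<partial>lborel) = ennreal \<bar>prod c UNIV\<bar> * (\<integral>\<^sup>+x. F (\<chi> i. c i * x $ i) \<partial>lborel)"
      by (subst lborel_affine_euclidean[of "\<lambda>j. c (axis_index j)" 0])
        (use c in \<open>auto simp: T nn_integral_density nn_integral_distr nn_integral_cmult prod_Basis_cart abs_prod\<close>)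
  qed
next
  case (4 m n)
  let ?p = "Transposition.transpose m n"
  let ?f = "\<lambda>x::real^'n. \<chi> i. x $ ?p i"
  have bij: "bij ?p" by simp
  have "orthogonal_transformation ?f"
    unfolding orthogonal_transformation
  proof (intro conjI allI)
    show "linear ?f" by (auto intro!: linearI simp: vec_eq_iff)
    show "norm (?f v) = norm v" for v
      by (simp add: norm_vec_def L2_set_def sum.reindex_bij_betw[OF bij, of "\<lambda>i. (v $ i)\<^sup>2"])
  qed
  then have d: "\<bar>det (matrix ?f)\<bar> = 1"
    using orthogonal_transformation_det by blast
  have [measurable]: "?f \<in> borel_measurable borel" by measurable
  \<comment> \<open>A transposition of coordinates permutes boxes and keeps their volume.\<close>
  have "lborel = distr lborel borel ?f"
  proof (rule lborel_eqI)
    fix l u :: "real^'n" assume le: "\<And>b. b \<in> Basis \<Longrightarrow> l \<bullet> b \<le> u \<bullet> b"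
    have le': "l $ i \<le> u $ i" for i
      using le[of "axis i 1"] by (auto simp: Basis_vec_def cart_eq_inner_axis)
    have le2: "?f l \<bullet> b \<le> ?f u \<bullet> b" if "b \<in> Basis" for b
      using that le' by (auto simp: Basis_vec_def cart_eq_inner_axis[symmetric])
    have "x \<in> box (?f l) (?f u) \<longleftrightarrow> ?f x \<in> box l u" for x
      by (simp add: mem_box_cart) (metis transpose_involutory)
    then have "?f -` box l u = box (?f l) (?f u)" by auto
    then have "emeasure (distr lborel borel ?f) (box l u) = emeasure lborel (box (?f l) (?f u))"
      by (simp add: emeasure_distr)
    also have "\<dots> = (\<Prod>i\<in>UNIV. u $ ?p i - l $ ?p i)"
      by (subst emeasure_lborel_box[OF le2]) (simp_all add: prod_Basis_cart cart_eq_inner_axis[symmetric])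
    also have "\<dots> = (\<Prod>b\<in>Basis. (u - l) \<bullet> b)"
      by (simp add: prod_Basis_cart cart_eq_inner_axis[symmetric] prod.reindex_bij_betw[OF bij, of "\<lambda>i. u $ i - l $ i"])
    finally show "emeasure (distr lborel borel ?f) (box l u) = (\<Prod>b\<in>Basis. (u - l) \<bullet> b)" .
  qed simp
  note swap = this
  have "(\<integral>\<^sup>+x. F x \<partial>lborel) = (\<integral>\<^sup>+x. F (?f x) \<partial>lborel)"
    if [measurable]: "F \<in> borel_measurable borel" for F :: "real^'n \<Rightarrow> ennreal"
    by (subst swap, subst nn_integral_distr) auto
  then show ?case unfolding P_def d ennreal_1 mult_1 by blast
next
  case (5 m n)
  let ?f = "\<lambda>x::real^'n. \<chi> i. if i = m then x $ m + x $ n else x $ i"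
  have "matrix ?f = (\<chi> k. if k = m then row m (mat 1) + 1 *s row n (mat 1) else row k (mat 1))"
    using 5 by (auto simp: vec_eq_iff matrix_def row_def mat_def axis_def)
  then have d: "det (matrix ?f) = 1"
    using det_row_operation[OF 5(1), of "mat 1 :: real^'n^'n" 1] by simp
  interpret product_sigma_finite "\<lambda>_::'n. lborel :: real measure" ..
  let ?P = "\<Pi>\<^sub>M i\<in>UNIV - {m}. lborel :: real measure"
  \<comment> \<open>Integrate over coordinate \<open>m\<close> innermost: with the other coordinates
    fixed, the shear is a translation of this one by \<open>x n\<close>.\<close>
  have *: "(\<integral>\<^sup>+x. H x \<partial>lborel) = (\<integral>\<^sup>+x. (\<integral>\<^sup>+y. H (\<chi> i. if i = m then y else x i) \<partial>lborel) \<partial>?P)"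
    if [measurable]: "H \<in> borel_measurable borel" for H :: "real^'n \<Rightarrow> ennreal"
  proof -
    have "(\<integral>\<^sup>+x. H x \<partial>lborel) = (\<integral>\<^sup>+x. H (\<chi> i. x i) \<partial>(\<Pi>\<^sub>M i\<in>insert m (UNIV - {m}). lborel))"
      by (subst lborel_cart_eq) (simp add: nn_integral_distr insert_absorb)
    also have "\<dots> = (\<integral>\<^sup>+x. (\<integral>\<^sup>+y. H (\<chi> i. (x(m := y)) i) \<partial>lborel) \<partial>?P)"
      by (rule product_nn_integral_insert) (auto simp: insert_absorb)
    finally show ?thesis by (simp add: fun_upd_def)
  qed
  have "(\<integral>\<^sup>+y. F (\<chi> i. if i = m then y else x i) \<partial>lborel) =
      (\<integral>\<^sup>+y. F (?f (\<chi> i. if i = m then y else x i)) \<partial>lborel)"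
    if [measurable]: "F \<in> borel_measurable borel" for x and F :: "real^'n \<Rightarrow> ennreal"
  proof -
    have "?f (\<chi> i. if i = m then y else x i) = (\<chi> i. if i = m then x n + 1 * y else x i)" for y
      using 5 by (auto simp: vec_eq_iff)
    then show ?thesis
      using nn_integral_real_affine[of "\<lambda>y. F (\<chi> i. if i = m then y else x i)" 1 "x n"] by simp
  qed
  note shear = this
  have [measurable]: "?f \<in> borel_measurable borel" by measurable
  have "(\<integral>\<^sup>+x. F x \<partial>lborel) = (\<integral>\<^sup>+x. F (?f x) \<partial>lborel)"
    if [measurable]: "F \<in> borel_measurable borel" for F :: "real^'n \<Rightarrow> ennreal"
    by (subst (1 2) *) (simp_all add: shear[OF that])
  then show ?case unfolding P_def d abs_one ennreal_1 mult_1 by blast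
  qed
  then show ?thesis using assms(2,3) unfolding P_def by blast
qed

text \<open>As an identity of measures, the formula passes to real integrands without any separate
  discussion of integrability.\<close>

lemma lborel_eq_distr_affine:
  fixes L :: "real^'n^'n"
  assumes "det L \<noteq> 0"
  shows "lborel = density (distr lborel borel (\<lambda>x. \<mu> + L *v x)) (\<lambda>_. ennreal \<bar>det L\<bar>)"
proof (rule measure_eqI)
  have [measurable]: "(\<lambda>x. L *v x) \<in> borel_measurable borel"
    by (intro borel_measurable_continuous_onI matrix_vector_mult_linear_continuous_on)
  fix A :: "(real^'n) set" assume "A \<in> sets lborel"
  then have [measurable]: "A \<in> sets borel" by simp
  have "emeasure lborel A = (\<integral>\<^sup>+x. indicator A (\<mu> + x) \<partial>lborel)"
    by (subst lborel_distr_plus[of \<mu>, symmetric]) (simp add: nn_integral_distr nn_integral_indicator[symmetric] del: nn_integral_indicator)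
  also have "\<dots> = ennreal \<bar>det L\<bar> * (\<integral>\<^sup>+x. indicator A (\<mu> + L *v x) \<partial>lborel)"
    using nn_integral_lborel_linear[of "\<lambda>x. L *v x" "\<lambda>x. indicator A (\<mu> + x)"] assms by simp
  also have "(\<integral>\<^sup>+x. indicator A (\<mu> + L *v x) \<partial>lborel) = emeasure (distr lborel borel (\<lambda>x. \<mu> + L *v x)) A"
    by (simp add: nn_integral_distr nn_integral_indicator[symmetric] del: nn_integral_indicator)
  also have "ennreal \<bar>det L\<bar> * \<dots> = emeasure (density (distr lborel borel (\<lambda>x. \<mu> + L *v x)) (\<lambda>_. ennreal \<bar>det L\<bar>)) A"
    by (simp add: emeasure_density nn_integral_cmult)
  finally show "emeasure lborel A = emeasure (density (distr lborel borel (\<lambda>x. \<mu> + L *v x)) (\<lambda>_. ennreal \<bar>det L\<bar>)) A" .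
qed simp

lemma integral_lborel_affine:
  fixes L :: "real^'n^'n" and h :: "real^'n \<Rightarrow> real"
  assumes "det L \<noteq> 0" and [measurable]: "h \<in> borel_measurable borel"
  shows "(LINT x|lborel. h x) = \<bar>det L\<bar> * (LINT x|lborel. h (\<mu> + L *v x))"
proof -
  have [measurable]: "(\<lambda>x. L *v x) \<in> borel_measurable borel"
    by (intro borel_measurable_continuous_onI matrix_vector_mult_linear_continuous_on)
  show ?thesis
    by (subst lborel_eq_distr_affine[OF assms(1), of \<mu>]) (simp add: integral_density integral_distr)
qed

section \<open>Moments of the standard normal distribution\<close>

definition gauss_density :: "real^'n \<Rightarrow> real" where
  "gauss_density y = (\<Prod>k\<in>UNIV. std_normal_density (y $ k))"

definition std_moment :: "nat \<Rightarrow> real" where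
  "std_moment k = (LINT x|lborel. std_normal_density x * x ^ k)"

lemma std_moment_0: "std_moment 0 = 1"
  using integral_std_normal_moment_even[of 0] by (simp add: std_moment_def)

text \<open>The recursion known from integration by parts. For \<open>k = 0\<close> the factor 0
  makes the truncated \<open>k - 1\<close> irrelevant.\<close>

lemma std_moment_Suc: "std_moment (Suc k) = k * std_moment (k - 1)"
proof (cases "even k")
  case True
  then obtain j where j: "k = 2 * j" by blast
  have "std_moment (Suc k) = 0"
    using integral_std_normal_moment_odd[of j] by (simp add: j std_moment_def)
  moreover have "std_moment (k - 1) = 0" if "k \<noteq> 0"
    using that integral_std_normal_moment_odd[of "j - 1"] by (cases j) (auto simp: j std_moment_def)
  ultimately show ?thesis by auto
next
  case False
  then obtain j where j: "k = Suc (2 * j)" by (metis odd_Suc_div_two odd_two_times_div_two_succ Suc_eq_plus1)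
  have "fact (2 * Suc j) = 2 * (1 + real j) * (real (2 * j + 1) * fact (2 * j))"
    by (simp add: algebra_simps)
  then have "fact (2 * Suc j) / (2 ^ Suc j * fact (Suc j)) = real (2 * j + 1) * (fact (2 * j) / (2 ^ j * fact j))"
    by (simp add: divide_simps del: fact_Suc) (simp add: algebra_simps)
  then show ?thesis
    using integral_std_normal_moment_even[of "Suc j"] integral_std_normal_moment_even[of j]
    unfolding std_moment_def by (simp add: j del: fact_Suc power_Suc)
qed

lemma measurable_gauss_density [measurable]: "gauss_density \<in> borel_measurable borel"
proof -
  have "continuous_on UNIV (gauss_density :: real^'n \<Rightarrow> real)"
    unfolding gauss_density_def normal_density_def by (intro continuous_intros) auto
  then show ?thesis by (rule borel_measurable_continuous_onI)
qed

lemma has_bochner_integral_gauss_monomial: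
  "has_bochner_integral lborel (\<lambda>y::real^'n. gauss_density y * (\<Prod>k\<in>UNIV. y $ k ^ m k))
     (\<Prod>k\<in>UNIV. std_moment (m k))"
proof -
  interpret product_sigma_finite "\<lambda>_::'n. lborel :: real measure" ..
  have eq: "gauss_density y * (\<Prod>k\<in>UNIV. y $ k ^ m k) = (\<Prod>k\<in>UNIV. std_normal_density (y $ k) * y $ k ^ m k)"
    for y :: "real^'n"
    by (simp add: gauss_density_def prod.distrib)
  have [measurable]: "(\<lambda>y::real^'n. \<Prod>k\<in>UNIV. std_normal_density (y $ k) * y $ k ^ m k) \<in> borel_measurable borel"
    unfolding eq[symmetric] by (intro borel_measurable_times borel_measurable_continuous_onI[of "\<lambda>y. \<Prod>k\<in>UNIV. y $ k ^ m k"] measurable_gauss_density continuous_intros)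
  show ?thesis
    unfolding has_bochner_integral_iff eq std_moment_def
    by (subst (1 2) lborel_cart_eq)
       (simp add: integrable_distr_eq integral_distr integrable_std_normal_moment
          product_integrable_prod[of UNIV "\<lambda>k x. std_normal_density x * x ^ m k"]
          product_integral_prod[of UNIV "\<lambda>k x. std_normal_density x * x ^ m k"])
qed

text \<open>A relation rather than a value, so that integrability travels along with the expectation
  through sums and multiples.\<close>

definition gauss_mean :: "(real^'n \<Rightarrow> real) \<Rightarrow> real \<Rightarrow> bool" where
  "gauss_mean f v \<longleftrightarrow> has_bochner_integral lborel (\<lambda>y. gauss_density y * f y) v"

lemma gauss_mean_add: "gauss_mean f v \<Longrightarrow> gauss_mean g w \<Longrightarrow> gauss_mean (\<lambda>y. f y + g y) (v + w)"
  and gauss_mean_cmult: "gauss_mean f v \<Longrightarrow> gauss_mean (\<lambda>y. c * f y) (c * v)"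
  and gauss_mean_sum: "(\<And>i. i \<in> I \<Longrightarrow> gauss_mean (h i) (u i)) \<Longrightarrow>
    gauss_mean (\<lambda>y. \<Sum>i\<in>I. h i y) (\<Sum>i\<in>I. u i)"
  unfolding gauss_mean_def
  by (auto simp: distrib_left sum_distrib_left mult.left_commute[of _ c]
      intro: has_bochner_integral_add has_bochner_integral_mult_right has_bochner_integral_sum)

lemma gauss_mean_monomial:
  fixes "is" :: "'n::finite list"
  shows "gauss_mean (\<lambda>y. prod_list (map (\<lambda>i. y $ i) is)) (\<Prod>k\<in>UNIV. std_moment (count_list is k))"
proof -
  have "prod_list (map (\<lambda>i. y $ i) is) = (\<Prod>k\<in>UNIV. y $ k ^ count_list is k)" for y :: "real^'n"
  proof (induction "is")
    case (Cons i "is")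
    have "(\<Prod>k\<in>UNIV. y $ k ^ count_list (i # is) k) = (\<Prod>k\<in>UNIV. (if k = i then y $ k else 1) * y $ k ^ count_list is k)"
      by (intro prod.cong) auto
    also have "\<dots> = y $ i * (\<Prod>k\<in>UNIV. y $ k ^ count_list is k)"
      by (simp add: prod.distrib)
    finally show ?case by (simp add: Cons.IH)
  qed simp
  then show ?thesis unfolding gauss_mean_def
    using has_bochner_integral_gauss_monomial[of "count_list is"] by simp
qed

text \<open>Recursive form of the Wick (Isserlis) formula: the first letter is paired with one of
  its other occurrences, and the pair is removed. Listing a monomial letter by letter is what allows
  this recursion.\<close>

lemma std_moment_prod_Cons:
  "(\<Prod>k\<in>UNIV. std_moment (count_list (i # is) k)) =
     count_list is i * (\<Prod>k\<in>UNIV. std_moment (count_list (remove1 i is) k))" for i :: "'n::finite"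
proof -
  have cnt: "count_list (remove1 i is) k = (if k = i then count_list is k - 1 else count_list is k)" for k
    by (induction "is") auto
  show ?thesis
    by (subst (1 2) prod.remove[of UNIV i]) (auto simp: std_moment_Suc cnt intro!: prod.cong)
qed

lemma gauss_mean_1: "gauss_mean (\<lambda>y. 1) 1"
  using gauss_mean_monomial[of "[]"] by (simp add: std_moment_0)

lemma std_moment_prod_1: "(\<Prod>m\<in>UNIV. std_moment (count_list [i] m)) = 0" for i :: "'n::finite"
  unfolding std_moment_prod_Cons by simp

lemma std_moment_prod_2: "(\<Prod>m\<in>UNIV. std_moment (count_list [i, j] m)) = (if i = j then 1 else 0)"
  for i j :: "'n::finite"
  unfolding std_moment_prod_Cons[of i] by (auto simp: std_moment_0)

lemma gauss_mean_linear: "gauss_mean (\<lambda>y. y $ i) 0"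
  using gauss_mean_monomial[of "[i]"] unfolding std_moment_prod_1 by simp

lemma gauss_mean_quadratic: "gauss_mean (\<lambda>y. y $ i * y $ j) (if i = j then 1 else 0)"
  using gauss_mean_monomial[of "[i, j]"] unfolding std_moment_prod_2 by simp

lemma gauss_mean_cubic: "gauss_mean (\<lambda>y. y $ i * (y $ j * y $ k)) 0"
proof -
  have "(\<Prod>l\<in>UNIV. std_moment (count_list [i, j, k] l)) = 0"
    unfolding std_moment_prod_Cons[of i]
    by (auto simp: std_moment_prod_1 simp del: count_list.simps(2) prod_zero_iff)
  then show ?thesis using gauss_mean_monomial[of "[i, j, k]"]
    by (simp del: count_list.simps prod_zero_iff)
qed

text \<open>The three summands are the three pairings of four letters.\<close>

lemma gauss_mean_quartic: "gauss_mean (\<lambda>y. (y $ i * y $ j) * (y $ k * y $ l))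
   ((if i = j then 1 else 0) * (if k = l then 1 else 0) + (if i = k then 1 else 0) * (if j = l then 1 else 0) +
    (if i = l then 1 else 0) * (if j = k then 1 else 0))"
proof -
  have "(\<Prod>m\<in>UNIV. std_moment (count_list [i, j, k, l] m)) =
   ((if i = j then 1 else 0) * (if k = l then 1 else 0) + (if i = k then 1 else 0) * (if j = l then 1 else 0) +
    (if i = l then 1 else 0) * (if j = k then 1 else 0))"
    unfolding std_moment_prod_Cons[of i]
    by (auto simp: std_moment_prod_2 simp del: count_list.simps(2) prod_zero_iff) auto
  then show ?thesis using gauss_mean_monomial[of "[i, j, k, l]"] by (simp add: mult.assoc del: count_list.simps)
qed

lemma inner_matrix_vector: "y \<bullet> (A *v y) = (\<Sum>i\<in>UNIV. \<Sum>j\<in>UNIV. A $ i $ j * (y $ i * y $ j))"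
  for A :: "real^'n^'n"
  by (simp add: inner_vec_def matrix_vector_mult_def sum_distrib_left mult_ac)

lemma inner_matrix: "A \<bullet> B = (\<Sum>i\<in>UNIV. \<Sum>j\<in>UNIV. A $ i $ j * B $ i $ j)" for A B :: "real^'n^'m"
  by (simp add: inner_vec_def)

text \<open>Covariance of two scores in whitened coordinates. Odd moments vanish, so linear and
  quadratic parts decouple. In the quartic part one pairing gives \<open>trace A * trace B\<close>,
  which the centring removes; the other two coincide by the symmetry of \<open>B\<close>.\<close>

lemma gauss_mean_score:
  fixes A B :: "real^'n^'n"
  assumes "transpose B = B"
  shows "gauss_mean (\<lambda>y. (a \<bullet> y + 1/2 * (y \<bullet> (A *v y) - trace A)) * (b \<bullet> y + 1/2 * (y \<bullet> (B *v y) - trace B)))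
     (a \<bullet> b + 1/2 * (A \<bullet> B))"
proof -
  have B: "B $ j $ i = B $ i $ j" for i j
    using assms by (simp add: vec_eq_iff transpose_def)
  have a: "gauss_mean (\<lambda>y. a \<bullet> y) 0" for a :: "real^'n"
  proof -
    have "gauss_mean (\<lambda>y. \<Sum>i\<in>UNIV. a $ i * y $ i) (\<Sum>i\<in>UNIV. a $ i * 0)"
      by (intro gauss_mean_sum gauss_mean_cmult gauss_mean_linear)
    then show ?thesis by (simp add: inner_vec_def)
  qed
  have ab: "gauss_mean (\<lambda>y. (a \<bullet> y) * (b \<bullet> y)) (a \<bullet> b)"
  proof -
    have "gauss_mean (\<lambda>y. \<Sum>i\<in>UNIV. \<Sum>j\<in>UNIV. (a $ i * b $ j) * (y $ i * y $ j)) (\<Sum>i\<in>UNIV. \<Sum>j\<in>UNIV. (a $ i * b $ j) * (if i = j then 1 else 0))"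
      by (intro gauss_mean_sum gauss_mean_cmult gauss_mean_quadratic)
    then show ?thesis by (simp add: inner_vec_def sum_product mult_ac if_distrib cong: if_cong)
  qed
  have q: "gauss_mean (\<lambda>y. y \<bullet> (A *v y)) (trace A)" for A :: "real^'n^'n"
  proof -
    have "gauss_mean (\<lambda>y. \<Sum>i\<in>UNIV. \<Sum>j\<in>UNIV. A $ i $ j * (y $ i * y $ j)) (\<Sum>i\<in>UNIV. \<Sum>j\<in>UNIV. A $ i $ j * (if i = j then 1 else 0))"
      by (intro gauss_mean_sum gauss_mean_cmult gauss_mean_quadratic)
    then show ?thesis by (simp add: inner_matrix_vector trace_def if_distrib cong: if_cong)
  qed
  have aq: "gauss_mean (\<lambda>y. (a \<bullet> y) * (y \<bullet> (A *v y))) 0" for a and A :: "real^'n^'n"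
  proof -
    have "gauss_mean (\<lambda>y. \<Sum>k\<in>UNIV. \<Sum>i\<in>UNIV. \<Sum>j\<in>UNIV. (a $ k * A $ i $ j) * (y $ k * (y $ i * y $ j)))
       (\<Sum>k\<in>UNIV. \<Sum>i\<in>UNIV. \<Sum>j\<in>UNIV. (a $ k * A $ i $ j) * 0)"
      by (intro gauss_mean_sum gauss_mean_cmult gauss_mean_cubic)
    also have "(\<lambda>y. \<Sum>k\<in>UNIV. \<Sum>i\<in>UNIV. \<Sum>j\<in>UNIV. (a $ k * A $ i $ j) * (y $ k * (y $ i * y $ j))) =
        (\<lambda>y. (a \<bullet> y) * (y \<bullet> (A *v y)))"
      by (simp only: inner_matrix_vector inner_vec_def[of a] sum_distrib_right) (simp add: sum_distrib_left mult_ac)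
    finally show ?thesis by simp
  qed
  have qq: "gauss_mean (\<lambda>y. (y \<bullet> (A *v y)) * (y \<bullet> (B *v y))) (trace A * trace B + 2 * (A \<bullet> B))"
  proof -
    have "gauss_mean (\<lambda>y. \<Sum>i\<in>UNIV. \<Sum>j\<in>UNIV. \<Sum>k\<in>UNIV. \<Sum>l\<in>UNIV. (A $ i $ j * B $ k $ l) * ((y $ i * y $ j) * (y $ k * y $ l)))
       (\<Sum>i\<in>UNIV. \<Sum>j\<in>UNIV. \<Sum>k\<in>UNIV. \<Sum>l\<in>UNIV. (A $ i $ j * B $ k $ l) *
         ((if i = j then 1 else 0) * (if k = l then 1 else 0) + (if i = k then 1 else 0) * (if j = l then 1 else 0) +
    (if i = l then 1 else 0) * (if j = k then 1 else 0)))"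
      by (intro gauss_mean_sum gauss_mean_cmult gauss_mean_quartic)
    also have "(\<lambda>y. \<Sum>i\<in>UNIV. \<Sum>j\<in>UNIV. \<Sum>k\<in>UNIV. \<Sum>l\<in>UNIV. (A $ i $ j * B $ k $ l) * ((y $ i * y $ j) * (y $ k * y $ l)))
      = (\<lambda>y. (y \<bullet> (A *v y)) * (y \<bullet> (B *v y)))"
      by (simp only: inner_matrix_vector sum_distrib_right) (simp add: sum_distrib_left mult_ac)
    also have "(\<Sum>i\<in>UNIV. \<Sum>j\<in>UNIV. \<Sum>k\<in>UNIV. \<Sum>l\<in>UNIV. (A $ i $ j * B $ k $ l) *
         ((if i = j then 1 else 0) * (if k = l then 1 else 0) + (if i = k then 1 else 0) * (if j = l then 1 else 0) +
    (if i = l then 1 else 0) * (if j = k then 1 else 0))) =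
      (\<Sum>i\<in>UNIV. \<Sum>k\<in>UNIV. A $ i $ i * B $ k $ k) + (A \<bullet> B) + (\<Sum>i\<in>UNIV. \<Sum>j\<in>UNIV. A $ i $ j * B $ j $ i)"
    proof -
      have sum_if: "(\<Sum>i\<in>I. if c then f i else 0) = (if c then sum f I else 0)" for c I and f :: "'n \<Rightarrow> real"
        by simp
      show ?thesis
        by (simp add: inner_matrix distrib_left sum.distrib if_distrib[of "\<lambda>x. _ * x"] if_distrib[of "\<lambda>x. x * _"]
          sum_if sum.delta sum.delta' cong: if_cong)
    qed
    also have "\<dots> = trace A * trace B + 2 * (A \<bullet> B)"
      by (simp add: inner_matrix trace_def sum_product B)
    finally show ?thesis .
  qed
  have "gauss_mean (\<lambda>y. (a \<bullet> y) * (b \<bullet> y) + (1/2 * ((a \<bullet> y) * (y \<bullet> (B *v y))) + (1/2 * ((b \<bullet> y) * (y \<bullet> (A *v y))) +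
      ((- trace B / 2) * (a \<bullet> y) + ((- trace A / 2) * (b \<bullet> y) + (1/4 * ((y \<bullet> (A *v y)) * (y \<bullet> (B *v y))) +
      ((- trace B / 4) * (y \<bullet> (A *v y)) + ((- trace A / 4) * (y \<bullet> (B *v y)) + (trace A * trace B / 4) * 1))))))))
    (a \<bullet> b + (1/2 * 0 + (1/2 * 0 + ((- trace B / 2) * 0 + ((- trace A / 2) * 0 + (1/4 * (trace A * trace B + 2 * (A \<bullet> B)) +
      ((- trace B / 4) * trace A + ((- trace A / 4) * trace B + (trace A * trace B / 4) * 1))))))))"
    by (intro gauss_mean_add gauss_mean_cmult a ab aq q qq gauss_mean_1)
  moreover have "(a \<bullet> b + (1/2 * 0 + (1/2 * 0 + ((- trace B / 2) * 0 + ((- trace A / 2) * 0 + (1/4 * (trace A * trace B + 2 * (A \<bullet> B)) +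
      ((- trace B / 4) * trace A + ((- trace A / 4) * trace B + (trace A * trace B / 4) * 1)))))))) = a \<bullet> b + 1/2 * (A \<bullet> B)"
    by (simp add: field_simps)
  ultimately show ?thesis
    by (simp add: algebra_simps)
qed

section \<open>Matrix calculus\<close>

lemma matrix_inv_left: "invertible A \<Longrightarrow> matrix_inv A ** A = mat 1"
  and matrix_inv_right: "invertible A \<Longrightarrow> A ** matrix_inv A = mat 1"
  for A :: "real^'n^'n"
  unfolding invertible_def matrix_inv_def by (metis (mono_tags, lifting) someI_ex)+

lemma matrix_inv_eqI:
  fixes A B :: "real^'n^'n"
  assumes "A ** B = mat 1" shows "matrix_inv A = B"
proof -
  have "invertible A" using assms invertible_right_inverse by blast
  then have "matrix_inv A ** A = mat 1" by (simp add: matrix_inv_left)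
  then show ?thesis using assms by (metis matrix_mul_assoc matrix_mul_lid matrix_mul_rid)
qed

lemma continuous_on_det [continuous_intros]:
  "continuous_on S f \<Longrightarrow> continuous_on S (\<lambda>x. det (f x :: real^'n^'n))"
  unfolding det_def by (intro continuous_intros)

text \<open>With H = B - A, the resolvent identity reads: inverse of B minus inverse of A equals
  minus (inverse of B) H (inverse of A). Used twice, it makes the error quadratic in H.\<close>

lemma has_derivative_matrix_inv:
  fixes A :: "real^'n^'n"
  assumes "invertible A"
  shows "(matrix_inv has_derivative (\<lambda>H. - (matrix_inv A ** H ** matrix_inv A))) (at A)"
proof -
  obtain K where K: "K > 0" "\<And>(A :: real^'n^'n) (B :: real^'n^'n). norm (A ** B) \<le> norm A * norm B * K"
    using matrix_mult.pos_bounded by blast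
  define a where "a = norm (matrix_inv A)"
  have "a > 0"
  proof -
    have "matrix_inv A \<noteq> 0"
    proof
      assume "matrix_inv A = 0"
      then have "(mat 1 :: real^'n^'n) = 0"
        using matrix_inv_left[OF assms] by (simp add: matrix_mult.zero_left)
      then show False by (metis det_I det_0 mat_0 zero_neq_one)
    qed
    then show ?thesis by (simp add: a_def)
  qed
  have K3: "norm (X ** Y ** Z) \<le> K\<^sup>2 * norm X * norm Y * norm Z" for X Y Z :: "real^'n^'n"
  proof -
    have "norm (X ** Y ** Z) \<le> norm (X ** Y) * norm Z * K" by (rule K)
    also have "\<dots> \<le> (norm X * norm Y * K) * norm Z * K"
      using K by (intro mult_right_mono) auto
    finally show ?thesis by (simp add: power2_eq_square mult_ac)
  qed
  have "open {B :: real^'n^'n. det B \<noteq> 0}"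
    by (intro open_Collect_neq continuous_intros)
  then obtain e1 where e1: "e1 > 0" "\<And>B. dist B A < e1 \<Longrightarrow> det B \<noteq> 0"
    using assms by (auto simp: open_dist invertible_det_nz)
  \<comment> \<open>The second bound makes the resolvent identity read b \<le> a + b / 2, so
    inverses near \<open>A\<close> have norm at most \<open>2 * a\<close>.\<close>
  define e where "e = min e1 (1 / (2 * K\<^sup>2 * a))"
  have "e > 0" using e1 K \<open>a > 0\<close> by (simp add: e_def)
  have lin: "bounded_linear (\<lambda>H. - (matrix_inv A ** H ** matrix_inv A))"
    by (intro bounded_linear_minus bounded_linear_compose[OF matrix_mult.bounded_linear_left
          matrix_mult.bounded_linear_right])
  show ?thesis
  proof (rule has_derivativeI_sandwich[OF \<open>e > 0\<close> lin])
    fix B assume "B \<noteq> A" "dist B A < e"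
    define H where "H = B - A"
    have H: "norm H > 0" "norm H < e" using \<open>B \<noteq> A\<close> \<open>dist B A < e\<close> by (auto simp: H_def dist_norm)
    have "invertible B" using e1 \<open>dist B A < e\<close> by (simp add: e_def invertible_det_nz)
    define b where "b = norm (matrix_inv B)"
    have diff: "matrix_inv B - matrix_inv A = - (matrix_inv B ** H ** matrix_inv A)"
      using matrix_inv_left[OF \<open>invertible B\<close>] matrix_inv_right[OF assms]
      by (simp add: H_def matrix_mult.diff_right
          matrix_mult.diff_left matrix_mul_assoc[symmetric])
    have "b \<le> a + norm (matrix_inv B - matrix_inv A)"
      unfolding a_def b_def by (metis add_diff_cancel_left' diff_add_cancel norm_triangle_ineq)
    also have "\<dots> \<le> a + K\<^sup>2 * b * norm H * a"
      unfolding diff norm_minus_cancel using K3[of "matrix_inv B" H "matrix_inv A"] by (simp add: a_def b_def)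
    also have "K\<^sup>2 * b * norm H * a \<le> K\<^sup>2 * b * (1 / (2 * K\<^sup>2 * a)) * a"
      using H(2) \<open>a > 0\<close> by (intro mult_right_mono mult_left_mono) (auto simp: e_def b_def)
    also have "\<dots> = b / 2" using \<open>a > 0\<close> K by (simp add: field_simps)
    finally have b: "b \<le> 2 * a" by simp
    have "matrix_inv B - matrix_inv A - - (matrix_inv A ** H ** matrix_inv A) =
        - ((matrix_inv B - matrix_inv A) ** H ** matrix_inv A)"
      unfolding matrix_mult.diff_left by (subst (1) diff) simp
    then have "norm (matrix_inv B - matrix_inv A - - (matrix_inv A ** (B - A) ** matrix_inv A)) =
       norm ((matrix_inv B - matrix_inv A) ** H ** matrix_inv A)"
      by (simp add: H_def)
    also have "\<dots> \<le> K\<^sup>2 * norm (matrix_inv B - matrix_inv A) * norm H * a"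
      unfolding a_def by (rule K3)
    also have "\<dots> \<le> K\<^sup>2 * (K\<^sup>2 * (2 * a) * norm H * a) * norm H * a"
    proof -
      have "norm (matrix_inv B - matrix_inv A) \<le> K\<^sup>2 * b * norm H * a"
        unfolding diff norm_minus_cancel using K3[of "matrix_inv B" H "matrix_inv A"] by (simp add: a_def b_def)
      also have "\<dots> \<le> K\<^sup>2 * (2 * a) * norm H * a"
        using b \<open>a > 0\<close> by (intro mult_right_mono mult_left_mono) auto
      finally show ?thesis
        using \<open>a > 0\<close> by (intro mult_right_mono mult_left_mono) auto
    qed
    finally show "norm (matrix_inv B - matrix_inv A - - (matrix_inv A ** (B - A) ** matrix_inv A)) / norm (B - A)
       \<le> 2 * K ^ 4 * a ^ 3 * norm (B - A)"
      using H(1) unfolding H_def[symmetric] by (simp add: divide_le_eq power2_eq_square power3_eq_cube power4_eq_xxxx mult_ac)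
  next
    show "((\<lambda>B. 2 * K ^ 4 * a ^ 3 * norm (B - A)) \<longlongrightarrow> 0) (at A)"
      by (intro tendsto_eq_intros) auto
  qed
qed

text \<open>In the Leibniz sum a permutation other than the identity moves at least two indices, so
  at the identity matrix its product vanishes to second order.\<close>

lemma has_derivative_det_one: "(det has_derivative trace) (at (mat 1 :: real^'n^'n))"
proof -
  have comp: "((\<lambda>X :: real^'n^'n. X $ i $ j) has_derivative (\<lambda>H. H $ i $ j)) (at (mat 1))" for i j
    by (intro bounded_linear_imp_has_derivative bounded_linear_compose[OF bounded_linear_vec_nth bounded_linear_vec_nth])
  have "((\<lambda>X :: real^'n^'n. \<Sum>p\<in>{p. p permutes UNIV}. of_int (sign p) * (\<Prod>i\<in>UNIV. X $ i $ p i)) has_derivative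
     (\<lambda>H. \<Sum>p\<in>{p. p permutes UNIV}. of_int (sign p) * (\<Sum>i\<in>UNIV. H $ i $ p i * (\<Prod>j\<in>UNIV - {i}. mat 1 $ j $ p j)))) (at (mat 1))"
    by (intro has_derivative_sum has_derivative_mult_right has_derivative_prod comp)
  also have "(\<lambda>H. \<Sum>p\<in>{p. p permutes UNIV}. of_int (sign p) * (\<Sum>i\<in>UNIV. H $ i $ p i * (\<Prod>j\<in>UNIV - {i}. mat 1 $ j $ p j))) =
     (trace :: real^'n^'n \<Rightarrow> real)"
  proof
    fix H :: "real^'n^'n"
    have "(\<Sum>i\<in>UNIV. H $ i $ p i * (\<Prod>j\<in>UNIV - {i}. mat 1 $ j $ p j)) = 0" if p: "p permutes UNIV" "p \<noteq> id" for p
    proof (rule sum.neutral, rule ballI)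
      fix i
      obtain k where k: "p k \<noteq> k" using p(2) by (auto simp: fun_eq_iff)
      have "\<exists>j. j \<noteq> i \<and> p j \<noteq> j"
      proof (cases "k = i")
        case True
        have "p (p k) \<noteq> p k" using k permutes_inj[OF p(1)] by (auto simp: inj_def)
        then show ?thesis using k True by metis
      qed (use k in auto)
      then obtain j where "j \<in> UNIV - {i}" "mat 1 $ j $ p j = (0::real)"
        by (auto simp: mat_def)
      then have "(\<Prod>j\<in>UNIV - {i}. mat 1 $ j $ p j) = (0::real)"
        by (intro prod_zero) auto
      then show "H $ i $ p i * (\<Prod>j\<in>UNIV - {i}. mat 1 $ j $ p j) = 0" by simp
    qed
    then have "(\<Sum>p\<in>{p. p permutes UNIV}. of_int (sign p) * (\<Sum>i\<in>UNIV. H $ i $ p i * (\<Prod>j\<in>UNIV - {i}. mat 1 $ j $ p j))) =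
      (\<Sum>p\<in>{id}. of_int (sign p) * (\<Sum>i\<in>UNIV. H $ i $ p i * (\<Prod>j\<in>UNIV - {i}. mat 1 $ j $ p j)))"
      by (intro sum.mono_neutral_right) (auto simp: permutes_id)
    also have "\<dots> = trace H" by (simp add: trace_def mat_def)
    finally show "(\<Sum>p\<in>{p. p permutes UNIV}. of_int (sign p) * (\<Sum>i\<in>UNIV. H $ i $ p i * (\<Prod>j\<in>UNIV - {i}. mat 1 $ j $ p j))) = trace H" .
  qed
  finally show ?thesis by (simp add: det_def[abs_def])
qed

text \<open>Jacobi's formula, reduced to the identity matrix by factoring out
  \<open>A\<close>.\<close>

lemma has_derivative_det:
  fixes A :: "real^'n^'n"
  assumes "invertible A"
  shows "(det has_derivative (\<lambda>H. det A * trace (matrix_inv A ** H))) (at A)"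
proof -
  have "det = (\<lambda>X. det A * det (matrix_inv A ** X))"
    using matrix_inv_right[OF assms] by (simp add: fun_eq_iff det_mul[symmetric] matrix_mul_assoc)
  moreover have "((\<lambda>X. det A * det (matrix_inv A ** X)) has_derivative (\<lambda>H. det A * trace (matrix_inv A ** H))) (at A)"
  proof (intro has_derivative_mult_right has_derivative_compose[of "(**) (matrix_inv A)" "(**) (matrix_inv A)" A UNIV det trace])
    show "((**) (matrix_inv A) has_derivative (**) (matrix_inv A)) (at A)"
      by (intro bounded_linear_imp_has_derivative matrix_mult.bounded_linear_right)
    show "(det has_derivative trace) (at (matrix_inv A ** A))"
      using has_derivative_det_one matrix_inv_left[OF assms] by simp
  qed
  ultimately show ?thesis by metis
qed

section \<open>Positive definite matrices\<close>

text \<open>Gram-Schmidt for the form \<open>S\<close>; the columns of \<open>M\<close> are an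
  orthonormal basis for it. For a covariance matrix \<open>S\<close> this is the whitening
  transformation.\<close>

lemma pos_def_orthonormal_basis:
  fixes S :: "real^'n^'n"
  assumes "pos_def S"
  obtains M :: "real^'n^'n" where "transpose M ** S ** M = mat 1"
proof -
  have sym: "u \<bullet> (S *v v) = v \<bullet> (S *v u)" for u v
    using assms by (metis pos_def_def dot_lmul_matrix inner_commute transpose_matrix_vector)
  have "\<exists>v. \<forall>i\<in>I. \<forall>j\<in>I. v i \<bullet> (S *v v j) = (if i = j then 1 else 0)" for I :: "'n set"
    using finite[of I]
  proof (induction I rule: finite_induct)
    case (insert k I)
    then obtain v where v: "\<And>i j. i \<in> I \<Longrightarrow> j \<in> I \<Longrightarrow> v i \<bullet> (S *v v j) = (if i = j then 1 else 0)"
      by blast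
    have "card I < CARD('n)"
      using insert by (metis psubset_card_mono finite UNIV_I psubsetI subset_UNIV)
    then have "dim ((\<lambda>i. S *v v i) ` I) < DIM(real^'n)"
      using dim_le_card'[of "(\<lambda>i. S *v v i) ` I"] card_image_le[of I "\<lambda>i. S *v v i"] by simp
    \<comment> \<open>Euclidean orthogonality to \<open>S *v v i\<close> is orthogonality to
      \<open>v i\<close> for the form \<open>S\<close>. Fewer than n conditions leave a nonzero
      solution.\<close>
    then obtain w where w: "w \<noteq> 0" "\<And>y. y \<in> span ((\<lambda>i. S *v v i) ` I) \<Longrightarrow> orthogonal w y"
      using orthogonal_to_subspace_exists by blast
    have pos: "w \<bullet> (S *v w) > 0" using assms w(1) by (simp add: pos_def_def)
    define w' where "w' = (1 / sqrt (w \<bullet> (S *v w))) *\<^sub>R w"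
    have w'1: "w' \<bullet> (S *v w') = 1"
      using pos by (simp add: w'_def matrix_vector_mult_scaleR real_sqrt_mult[symmetric])
    have w'0: "w' \<bullet> (S *v v i) = 0" if "i \<in> I" for i
      using w(2)[of "S *v v i"] that by (auto simp: w'_def orthogonal_def span_base)
    show ?case
    proof (intro exI[of _ "v(k := w')"] ballI)
      fix i j assume "i \<in> insert k I" "j \<in> insert k I"
      then show "(v(k := w')) i \<bullet> (S *v (v(k := w')) j) = (if i = j then 1 else 0)"
        using insert(2) v w'1 w'0 sym[of "v i" w'] by (cases "i = k"; cases "j = k") auto
    qed
  qed (use assms in auto)
  from this[of UNIV] obtain v where v: "\<And>i j :: 'n. v i \<bullet> (S *v v j) = (if i = j then 1 else 0)"
    by auto
  define M where "M = (\<chi> i j. v j $ i)"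
  have "(transpose M ** S ** M) $ i $ j = v i \<bullet> (S *v v j)" for i j
    unfolding matrix_mul_assoc[symmetric]
    by (simp add: M_def matrix_matrix_mult_def matrix_vector_mult_def inner_vec_def transpose_def)
  then have "transpose M ** S ** M = mat 1"
    by (simp add: vec_eq_iff v mat_def)
  then show thesis by (rule that)
qed

lemma pos_def_factor:
  fixes S M :: "real^'n^'n"
  assumes "transpose M ** S ** M = mat 1"
  shows "matrix_inv S = M ** transpose M" "invertible M" "det S = 1 / (det M)\<^sup>2" "det M \<noteq> 0"
proof -
  have *: "det M * det S * det M = 1"
    using assms by (metis det_I det_mul det_transpose)
  then show nz: "det M \<noteq> 0" by auto
  with * show "det S = 1 / (det M)\<^sup>2"
    by (simp add: power2_eq_square divide_simps mult_ac)
  show "invertible M" using nz by (simp add: invertible_det_nz)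
  have "M ** (transpose M ** S) = mat 1"
    using assms matrix_left_right_inverse by blast
  then have "S ** (M ** transpose M) = mat 1"
    by (metis matrix_left_right_inverse matrix_mul_assoc)
  then show "matrix_inv S = M ** transpose M" by (rule matrix_inv_eqI)
qed

lemma pos_def_det_pos: "pos_def S \<Longrightarrow> det S > 0"
  using pos_def_orthonormal_basis pos_def_factor(3,4) by (metis zero_less_divide_1_iff zero_less_power2)

lemma pos_def_invertible: "pos_def S \<Longrightarrow> invertible S"
  using pos_def_det_pos by (force simp: invertible_det_nz)

lemma pos_def_inv_symmetric:
  assumes "pos_def S" shows "transpose (matrix_inv S) = matrix_inv S"
  by (metis assms matrix_transpose_mul pos_def_factor(1) pos_def_orthonormal_basis transpose_transpose)

lemma inner_matrix_eq_trace: "A \<bullet> B = trace (transpose A ** B)" for A B :: "real^'n^'m"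
proof -
  have "A \<bullet> B = (\<Sum>i\<in>UNIV. \<Sum>j\<in>UNIV. A $ i $ j * B $ i $ j)" by (rule inner_matrix)
  also have "\<dots> = (\<Sum>j\<in>UNIV. \<Sum>i\<in>UNIV. A $ i $ j * B $ i $ j)" by (rule sum.swap)
  finally show ?thesis by (simp add: trace_def matrix_matrix_mult_def transpose_def)
qed

text \<open>By compactness the form has a positive minimum \<open>c\<close> on the unit sphere, and
  a perturbation of norm below \<open>c / K\<close> changes it there by less than
  \<open>c\<close>.\<close>

lemma open_pos_def_nhd:
  fixes S :: "real^'n^'n"
  assumes "pos_def S"
  shows "\<exists>e>0. \<forall>T. transpose T = T \<and> dist T S < e \<longrightarrow> pos_def T"
proof -
  have cont: "continuous_on (sphere 0 1) (\<lambda>v :: real^'n. v \<bullet> (S *v v))"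
    by (intro continuous_intros matrix_vector_mult_linear_continuous_on)
  obtain k :: 'n where True by blast
  have "sphere (0 :: real^'n) 1 \<noteq> {}"
    by (metis mem_sphere_0 norm_axis_1 empty_iff)
  then obtain m where m: "norm m = 1" "\<And>v. norm v = 1 \<Longrightarrow> m \<bullet> (S *v m) \<le> v \<bullet> (S *v v)"
    using continuous_attains_inf[OF compact_sphere _ cont] by auto
  define c where "c = m \<bullet> (S *v m)"
  have "c > 0" using assms m(1) unfolding c_def pos_def_def by (metis norm_zero zero_neq_one)
  obtain K where K: "K > 0" "\<And>(A :: real^'n^'n) v. norm (A *v v) \<le> norm A * norm v * K"
    using matrix_vector.pos_bounded by blast
  show ?thesis
  proof (intro exI[of _ "c / K"] conjI allI impI)
    show "c / K > 0" using \<open>c > 0\<close> K by simp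
    fix T :: "real^'n^'n" assume T: "transpose T = T \<and> dist T S < c / K"
    have "w \<bullet> (T *v w) > 0" if "norm w = 1" for w
    proof -
      have "\<bar>w \<bullet> ((T - S) *v w)\<bar> \<le> norm w * norm ((T - S) *v w)" by (rule Cauchy_Schwarz_ineq2)
      also have "\<dots> \<le> norm (T - S) * K" using K(2)[of "T - S" w] that by simp
      also have "\<dots> < c" using T K(1) by (simp add: dist_norm field_simps)
      finally have "\<bar>w \<bullet> (T *v w) - w \<bullet> (S *v w)\<bar> < c"
        by (simp add: matrix_vector_mult_diff_rdistrib inner_diff_right)
      then show ?thesis using m(2)[OF that] by (simp add: c_def)
    qed
    from this[of "v /\<^sub>R norm v" for v] have unit: "(v /\<^sub>R norm v) \<bullet> (T *v (v /\<^sub>R norm v)) > 0" if "v \<noteq> 0" for v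
      using that by (simp del: inner_scaleR_left)
    have "v \<bullet> (T *v v) > 0" if "v \<noteq> 0" for v
      using unit[OF that] that by (simp add: matrix_vector_mult_scaleR zero_less_mult_iff)
    then show "pos_def T" using T by (simp add: pos_def_def)
  qed
qed

section \<open>Mean and covariance as coordinates\<close>

lemma bounded_linear_mean_of: "bounded_linear mean_of"
  by (auto intro!: linearI simp: linear_conv_bounded_linear[symmetric] mean_of_def vec_eq_iff)

lemma bounded_linear_cov_of: "bounded_linear cov_of"
  by (auto intro!: linearI simp: linear_conv_bounded_linear[symmetric] cov_of_def vec_eq_iff)

lemmas mean_of_zero = linear_0 [OF bounded_linear.linear, OF bounded_linear_mean_of]
lemmas mean_of_add = linear_add [OF bounded_linear.linear, OF bounded_linear_mean_of]
lemmas mean_of_diff = linear_diff [OF bounded_linear.linear, OF bounded_linear_mean_of]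
lemmas mean_of_scaleR = linear_cmul [OF bounded_linear.linear, OF bounded_linear_mean_of]
lemmas mean_of_linear = mean_of_zero mean_of_add mean_of_diff mean_of_scaleR

lemmas cov_of_zero = linear_0 [OF bounded_linear.linear, OF bounded_linear_cov_of]
lemmas cov_of_add = linear_add [OF bounded_linear.linear, OF bounded_linear_cov_of]
lemmas cov_of_diff = linear_diff [OF bounded_linear.linear, OF bounded_linear_cov_of]
lemmas cov_of_scaleR = linear_cmul [OF bounded_linear.linear, OF bounded_linear_cov_of]
lemmas cov_of_linear = cov_of_zero cov_of_add cov_of_diff cov_of_scaleR

lemma transpose_cov_of [simp]: "transpose (cov_of \<theta>) = cov_of \<theta>"
  by (simp add: cov_of_def transpose_def vec_eq_iff Upair_commute)

lemma coords_eqI: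
  assumes "mean_of u = mean_of v" "cov_of u = cov_of v" shows "u = v"
proof -
  have "u $ s = v $ s" for s
  proof (cases s)
    case (Inl i) then show ?thesis using assms(1) by (simp add: mean_of_def vec_eq_iff)
  next
    case (Inr p)
    then obtain i j where "p = Upair i j" by (metis uprod_exhaust)
    then show ?thesis using Inr assms(2) by (simp add: cov_of_def vec_eq_iff)
  qed
  then show ?thesis by (simp add: vec_eq_iff)
qed

text \<open>For non-symmetric \<open>A\<close> the value depends on the choice made by \<open>SOME\<close>.\<close>

definition coords :: "real^'d \<Rightarrow> real^'d^'d \<Rightarrow> 'd::finite normal_coords" where
  "coords a A = (\<chi> s. case s of Inl i \<Rightarrow> a $ i | Inr p \<Rightarrow> (SOME r. \<exists>i j. p = Upair i j \<and> r = A $ i $ j))"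

lemma mean_of_coords [simp]: "mean_of (coords a A) = a"
  by (simp add: mean_of_def coords_def vec_eq_iff)

lemma cov_of_coords:
  assumes "transpose A = A" shows "cov_of (coords a A) = A"
proof -
  have A: "A $ j $ i = A $ i $ j" for i j
    using assms by (simp add: vec_eq_iff transpose_def)
  have "(SOME r. \<exists>i' j'. Upair i j = Upair i' j' \<and> r = A $ i' $ j') = A $ i $ j" for i j
    by (rule some_equality) (use A in auto)
  then show ?thesis by (simp add: cov_of_def coords_def vec_eq_iff)
qed

lemma open_normal_manifold: "open normal_manifold"
proof (unfold open_dist, intro ballI)
  fix \<theta> :: "'d::finite normal_coords" assume "\<theta> \<in> normal_manifold"
  then obtain e where e: "e > 0" "\<And>T. transpose T = T \<Longrightarrow> dist T (cov_of \<theta>) < e \<Longrightarrow> pos_def T"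
    using open_pos_def_nhd unfolding normal_manifold_def by blast
  obtain K where K: "K > 0" "\<And>\<theta> :: 'd normal_coords. norm (cov_of \<theta>) \<le> norm \<theta> * K"
    using bounded_linear.pos_bounded[OF bounded_linear_cov_of] by blast
  show "\<exists>e>0. \<forall>y. dist y \<theta> < e \<longrightarrow> y \<in> normal_manifold"
  proof (intro exI[of _ "e / K"] conjI allI impI)
    show "e / K > 0" using e K by simp
    fix y assume y: "dist y \<theta> < e / K"
    have "dist (cov_of y) (cov_of \<theta>) \<le> dist y \<theta> * K"
      using K(2)[of "y - \<theta>"] by (simp add: dist_norm cov_of_diff)
    also have "\<dots> < e" using y K(1) by (simp add: field_simps)
    finally show "y \<in> normal_manifold" using e(2) by (simp add: normal_manifold_def)
  qed
qed

lemma convex_normal_manifold: "convex normal_manifold"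
proof (rule convexI)
  fix \<theta> \<eta> :: "'d::finite normal_coords" and s t :: real
  assume *: "\<theta> \<in> normal_manifold" "\<eta> \<in> normal_manifold" "0 \<le> s" "0 \<le> t" "s + t = 1"
  have "v \<bullet> (cov_of (s *\<^sub>R \<theta> + t *\<^sub>R \<eta>) *v v) > 0" if "v \<noteq> 0" for v
  proof -
    have "v \<bullet> (cov_of (s *\<^sub>R \<theta> + t *\<^sub>R \<eta>) *v v) = s * (v \<bullet> (cov_of \<theta> *v v)) + t * (v \<bullet> (cov_of \<eta> *v v))"
      by (simp add: cov_of_add
          cov_of_scaleR
          matrix_vector_mult_add_rdistrib matrix_vector.scaleR_left inner_add_right)
    moreover have "v \<bullet> (cov_of \<theta> *v v) > 0" "v \<bullet> (cov_of \<eta> *v v) > 0"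
      using * that by (auto simp: normal_manifold_def pos_def_def)
    moreover have "s > 0 \<or> t > 0" using * by linarith
    ultimately show ?thesis
      using *(3,4) by (metis add_nonneg_pos add_pos_nonneg less_imp_le mult_nonneg_nonneg mult_pos_pos)
  qed
  then show "s *\<^sub>R \<theta> + t *\<^sub>R \<eta> \<in> normal_manifold"
    by (simp add: normal_manifold_def pos_def_def)
qed

section \<open>The Fisher metric\<close>

definition precision :: "'d::finite normal_coords \<Rightarrow> real^'d^'d" where
  "precision \<theta> = matrix_inv (cov_of \<theta>)"

text \<open>Derivative of the log-likelihood in direction \<open>u\<close> at residual
  \<open>z\<close>, the sample minus the mean; the trace stems from the logarithm of the
  determinant.\<close>

definition score :: "'d::finite normal_coords \<Rightarrow> real^'d \<Rightarrow> 'd normal_coords \<Rightarrow> real" where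
  "score \<theta> z u = mean_of u \<bullet> (precision \<theta> *v z)
     + 1/2 * (z \<bullet> ((precision \<theta> ** cov_of u ** precision \<theta>) *v z) - trace (precision \<theta> ** cov_of u))"

definition normal_metric :: "'d::finite normal_coords metric_tensor" where
  "normal_metric \<theta> u v = mean_of u \<bullet> (precision \<theta> *v mean_of v)
     + 1/2 * trace (precision \<theta> ** cov_of u ** precision \<theta> ** cov_of v)"

lemma bounded_linear_trace: "bounded_linear (trace :: real^'n^'n \<Rightarrow> real)"
  by (auto intro!: linearI simp: linear_conv_bounded_linear[symmetric] trace_def sum.distrib sum_distrib_left)

lemmas trace_scaleR = linear_cmul [OF bounded_linear.linear, OF bounded_linear_trace]
lemmas trace_minus = linear_neg [OF bounded_linear.linear, OF bounded_linear_trace]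

lemma has_derivative_mean_of: "(mean_of has_derivative mean_of) F"
  and has_derivative_cov_of: "(cov_of has_derivative cov_of) F"
  using bounded_linear_mean_of bounded_linear_cov_of by (auto intro: bounded_linear_imp_has_derivative)

lemma symmetric_precision:
  "\<theta> \<in> normal_manifold \<Longrightarrow> transpose (precision \<theta>) = precision \<theta>"
  by (simp add: normal_manifold_def precision_def pos_def_inv_symmetric)

lemma inner_symmetric: "transpose P = P \<Longrightarrow> a \<bullet> (P *v b) = (P *v a) \<bullet> b" for P :: "real^'n^'n"
  by (metis dot_lmul_matrix transpose_matrix_vector)

lemma has_derivative_precision:
  assumes "\<theta> \<in> normal_manifold"
  shows "(precision has_derivative (\<lambda>u. - (precision \<theta> ** cov_of u ** precision \<theta>))) (at \<theta>)"
  unfolding precision_def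
  by (rule has_derivative_compose[OF has_derivative_cov_of has_derivative_matrix_inv])
     (use assms in \<open>simp add: normal_manifold_def pos_def_invertible\<close>)

lemma log_likelihood_eq:
  fixes \<theta> :: "'d::finite normal_coords"
  assumes "\<theta> \<in> normal_manifold"
  shows "log_likelihood x \<theta> = - (1/2) * ((x - mean_of \<theta>) \<bullet> (precision \<theta> *v (x - mean_of \<theta>)))
     - real CARD('d) / 2 * ln (2 * pi) - 1/2 * ln (det (cov_of \<theta>))"
proof -
  have "det (cov_of \<theta>) > 0"
    using assms by (simp add: normal_manifold_def pos_def_det_pos)
  then show ?thesis
    unfolding log_likelihood_def normal_pdf_def precision_def
    by (subst ln_div) (auto simp: ln_mult ln_powr)
qed

text \<open>The closed form of the logarithm holds on the manifold only, but this set is open, so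
  the derivative there can be computed from it.\<close>

lemma has_derivative_log_likelihood:
  fixes \<theta> :: "'d::finite normal_coords"
  assumes "\<theta> \<in> normal_manifold"
  shows "(log_likelihood x has_derivative score \<theta> (x - mean_of \<theta>)) (at \<theta>)"
proof (rule has_derivative_transform_within_open[OF _ open_normal_manifold assms])
  let ?P = "precision \<theta>" and ?z = "x - mean_of \<theta>"
  have inv: "invertible (cov_of \<theta>)" and det: "det (cov_of \<theta>) > 0"
    using assms by (auto simp: normal_manifold_def pos_def_invertible pos_def_det_pos)
  have z: "((\<lambda>\<theta>. x - mean_of \<theta>) has_derivative (\<lambda>u. - mean_of u)) (at \<theta>)"
    using has_derivative_diff[OF has_derivative_const has_derivative_mean_of, of x] by simp
  have "((\<lambda>\<theta>. det (cov_of \<theta>)) has_derivative (\<lambda>u. det (cov_of \<theta>) * trace (?P ** cov_of u))) (at \<theta>)"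
    unfolding precision_def
    by (rule has_derivative_compose[OF has_derivative_cov_of has_derivative_det]) (use inv in simp)
  note dln = has_derivative_ln[OF det this]
  have ln: "((\<lambda>\<theta>. ln (det (cov_of \<theta>))) has_derivative (\<lambda>u. trace (?P ** cov_of u))) (at \<theta>)"
  proof -
    have "(\<lambda>u. det (cov_of \<theta>) * trace (?P ** cov_of u) * inverse (det (cov_of \<theta>))) = (\<lambda>u. trace (?P ** cov_of u))"
      using det by (auto simp: fun_eq_iff)
    then show "((\<lambda>\<theta>. ln (det (cov_of \<theta>))) has_derivative (\<lambda>u. trace (?P ** cov_of u))) (at \<theta>)"
      using dln by simp
  qed
  have "((\<lambda>\<theta>. (x - mean_of \<theta>) \<bullet> (precision \<theta> *v (x - mean_of \<theta>))) has_derivative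
     (\<lambda>u. ?z \<bullet> (?P *v (- mean_of u) + (- (?P ** cov_of u ** ?P)) *v ?z) + (- mean_of u) \<bullet> (?P *v ?z))) (at \<theta>)"
    by (intro has_derivative_inner matrix_vector.FDERIV has_derivative_precision z assms)
  then have "((\<lambda>\<theta>. - (1/2) * ((x - mean_of \<theta>) \<bullet> (precision \<theta> *v (x - mean_of \<theta>)))
     - real CARD('d) / 2 * ln (2 * pi) - 1/2 * ln (det (cov_of \<theta>))) has_derivative
     (\<lambda>u. - (1/2) * (?z \<bullet> (?P *v (- mean_of u) + (- (?P ** cov_of u ** ?P)) *v ?z) + (- mean_of u) \<bullet> (?P *v ?z))
       - 0 - 1/2 * trace (?P ** cov_of u))) (at \<theta>)"
    by (intro has_derivative_diff has_derivative_mult_right has_derivative_const ln)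
  also have "(\<lambda>u. - (1/2) * (?z \<bullet> (?P *v (- mean_of u) + (- (?P ** cov_of u ** ?P)) *v ?z) + (- mean_of u) \<bullet> (?P *v ?z))
       - 0 - 1/2 * trace (?P ** cov_of u)) = score \<theta> ?z"
  proof
    fix u
    have "?z \<bullet> (?P *v mean_of u) = mean_of u \<bullet> (?P *v ?z)"
      using inner_symmetric[OF symmetric_precision[OF assms]] by (simp add: inner_commute)
    then show "- (1/2) * (?z \<bullet> (?P *v (- mean_of u) + (- (?P ** cov_of u ** ?P)) *v ?z) + (- mean_of u) \<bullet> (?P *v ?z))
       - 0 - 1/2 * trace (?P ** cov_of u) = score \<theta> ?z u"
      by (simp add: score_def inner_add_right matrix_vector.minus_left
          matrix_vector.minus_right algebra_simps)
  qed
  finally show "((\<lambda>\<theta>. - (1/2) * ((x - mean_of \<theta>) \<bullet> (precision \<theta> *v (x - mean_of \<theta>)))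
     - real CARD('d) / 2 * ln (2 * pi) - 1/2 * ln (det (cov_of \<theta>))) has_derivative score \<theta> ?z) (at \<theta>)" .
qed (simp add: log_likelihood_eq)

text \<open>Whitening turns the metric into the Euclidean product on means plus half the Frobenius
  product on covariances, which makes symmetry and positivity evident.\<close>

lemma normal_metric_orthonormal:
  fixes \<theta> u v :: "'d::finite normal_coords" and M :: "real^'d^'d"
  assumes M: "transpose M ** cov_of \<theta> ** M = mat 1"
  shows "normal_metric \<theta> u v = (transpose M *v mean_of u) \<bullet> (transpose M *v mean_of v)
     + 1/2 * ((transpose M ** cov_of u ** M) \<bullet> (transpose M ** cov_of v ** M))"
proof -
  have P: "precision \<theta> = M ** transpose M"
    using pos_def_factor(1)[OF M] by (simp add: precision_def)
  have "mean_of u \<bullet> (precision \<theta> *v mean_of v) = (transpose M *v mean_of u) \<bullet> (transpose M *v mean_of v)"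
    unfolding P matrix_vector_mul_assoc[symmetric] by (metis dot_lmul_matrix transpose_matrix_vector transpose_transpose)
  moreover have "trace (precision \<theta> ** cov_of u ** precision \<theta> ** cov_of v) =
      (transpose M ** cov_of u ** M) \<bullet> (transpose M ** cov_of v ** M)"
    unfolding inner_matrix_eq_trace P
    using trace_mul_sym[of M "transpose M ** cov_of u ** M ** transpose M ** cov_of v"]
      trace_mul_sym[of "transpose M ** cov_of u ** M ** transpose M ** cov_of v" M]
    by (simp add: matrix_transpose_mul matrix_mul_assoc)
  ultimately show ?thesis by (simp add: normal_metric_def)
qed

text \<open>Substitute x = mean + L y, where L, the inverse of the transpose of M, is a square root
  of \<Sigma> in the sense that L times its transpose is \<Sigma>. The density becomes the standard
  one and the scores take the form treated in \<open>gauss_mean_score\<close>.\<close>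

lemma integral_score_score:
  fixes \<theta> u v :: "'d::finite normal_coords"
  assumes "\<theta> \<in> normal_manifold"
  shows "(LINT x|lborel. score \<theta> (x - mean_of \<theta>) u * score \<theta> (x - mean_of \<theta>) v * normal_pdf \<theta> x) = normal_metric \<theta> u v"
proof -
  obtain M :: "real^'d^'d" where M: "transpose M ** cov_of \<theta> ** M = mat 1"
    using assms pos_def_orthonormal_basis[of "cov_of \<theta>"] unfolding normal_manifold_def by blast
  note F = pos_def_factor[OF M]
  have P: "precision \<theta> = M ** transpose M"
    using F(1) by (simp add: precision_def)
  define L where "L = matrix_inv (transpose M)"
  have invM: "invertible (transpose M)"
    using F(4) by (simp add: invertible_det_nz)
  have MTL: "transpose M ** L = mat 1" and LTM: "transpose L ** M = mat 1"
    unfolding L_def using matrix_inv_right[OF invM]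
    by (auto simp flip: matrix_transpose_mul) (metis matrix_transpose_mul transpose_mat transpose_transpose)
  have detL: "det L = 1 / det M"
  proof -
    have "det M * det L = 1" using MTL by (metis det_I det_mul det_transpose)
    then show ?thesis using F(4) by (simp add: field_simps)
  qed
  have PL: "precision \<theta> *v (L *v y) = M *v y" for y
    unfolding P by (simp add: matrix_vector_mul_assoc matrix_mul_assoc[symmetric] MTL)
  have L_inner: "(L *v y) \<bullet> (M *v w) = y \<bullet> w" for y w
    using LTM by (metis dot_lmul_matrix matrix_vector_mul_assoc matrix_vector_mul_lid transpose_matrix_vector transpose_transpose)
  have M_inner: "(M *v y) \<bullet> w = y \<bullet> (transpose M *v w)" for y w
    by (metis dot_lmul_matrix transpose_matrix_vector transpose_transpose)
  have score: "score \<theta> (L *v y) w = (transpose M *v mean_of w) \<bullet> y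
     + 1/2 * (y \<bullet> ((transpose M ** cov_of w ** M) *v y) - trace (transpose M ** cov_of w ** M))" for y w
  proof -
    have "(L *v y) \<bullet> ((precision \<theta> ** cov_of w ** precision \<theta>) *v (L *v y)) = y \<bullet> ((transpose M ** cov_of w ** M) *v y)"
      unfolding matrix_vector_mul_assoc[symmetric] PL
      unfolding P matrix_vector_mul_assoc[symmetric] L_inner ..
    moreover have "trace (precision \<theta> ** cov_of w) = trace (transpose M ** cov_of w ** M)"
      unfolding P by (metis matrix_mul_assoc trace_mul_sym)
    moreover have "mean_of w \<bullet> (precision \<theta> *v (L *v y)) = (transpose M *v mean_of w) \<bullet> y"
      unfolding PL using M_inner[of y "mean_of w"] by (simp add: inner_commute)
    ultimately show ?thesis by (simp add: score_def)
  qed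
  have pdf: "normal_pdf \<theta> (mean_of \<theta> + L *v y) * \<bar>det L\<bar> = gauss_density y" for y :: "real^'d"
  proof -
    have "(L *v y) \<bullet> (matrix_inv (cov_of \<theta>) *v (L *v y)) = y \<bullet> y"
      using PL L_inner by (simp add: precision_def)
    moreover have "det (cov_of \<theta>) powr (1/2) = \<bar>det L\<bar>"
      using F(3) by (simp add: detL powr_half_sqrt real_sqrt_divide)
    moreover have "gauss_density y = exp (- (1/2) * (y \<bullet> y)) / (2 * pi) powr (real CARD('d) / 2)"
    proof -
      have "gauss_density y = (\<Prod>k\<in>(UNIV::'d set). 1 / sqrt (2 * pi)) * exp (\<Sum>k\<in>UNIV. - (y $ k)\<^sup>2 / 2)"
        unfolding gauss_density_def std_normal_density_def by (simp only: prod.distrib exp_sum finite)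
      also have "(\<Sum>k\<in>UNIV. - (y $ k)\<^sup>2 / 2) = - (1/2) * (y \<bullet> y)"
        by (simp add: inner_vec_def power2_eq_square sum_distrib_left sum_negf[symmetric] sum_divide_distrib)
      also have "(\<Prod>k\<in>(UNIV::'d set). 1 / sqrt (2 * pi)) = 1 / (2 * pi) powr (real CARD('d) / 2)"
        by (simp add: power_one_over powr_half_sqrt[symmetric] powr_realpow[symmetric] powr_powr del: powr_realpow) 
      finally show ?thesis by simp
    qed
    ultimately show ?thesis
      using F(4) by (simp add: normal_pdf_def detL)
  qed
  have mp: "normal_pdf \<theta> \<in> borel_measurable borel"
    unfolding normal_pdf_def
    by (intro borel_measurable_continuous_onI continuous_intros matrix_vector_mult_linear_continuous_on
        bounded_linear.continuous_on[OF matrix_vector.bounded_linear_right]) 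
      (use assms in \<open>auto simp: normal_manifold_def dest: pos_def_det_pos\<close>)
  have ms: "(\<lambda>x. score \<theta> (x - mean_of \<theta>) w) \<in> borel_measurable borel" for w
    unfolding score_def
    by (intro borel_measurable_continuous_onI continuous_intros
        bounded_linear.continuous_on[OF matrix_vector.bounded_linear_right])
  have "(LINT x|lborel. score \<theta> (x - mean_of \<theta>) u * score \<theta> (x - mean_of \<theta>) v * normal_pdf \<theta> x) =
     \<bar>det L\<bar> * (LINT y|lborel. score \<theta> (L *v y) u * score \<theta> (L *v y) v * normal_pdf \<theta> (mean_of \<theta> + L *v y))"
    by (subst integral_lborel_affine[of L _ "mean_of \<theta>"]) (use mp ms F(4) detL in simp_all)
  also have "\<dots> = (LINT y|lborel. gauss_density y * (score \<theta> (L *v y) u * score \<theta> (L *v y) v))"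
    by (subst integral_mult_right_zero[symmetric]) (simp add: pdf[symmetric] mult_ac)
  also have "\<dots> = normal_metric \<theta> u v"
  proof -
    have "transpose (transpose M ** cov_of v ** M) = transpose M ** cov_of v ** M"
      by (simp add: matrix_transpose_mul matrix_mul_assoc)
    from gauss_mean_score[OF this] show ?thesis
      unfolding score normal_metric_orthonormal[OF M] gauss_mean_def by (rule has_bochner_integral_integral_eq)
  qed
  finally show ?thesis .
qed

lemma normal_metric_bilinear: "bilinear (normal_metric \<theta>)"
  unfolding bilinear_def normal_metric_def
  by (auto intro!: linearI simp: cov_of_add
      mean_of_add
      cov_of_scaleR
      mean_of_scaleR
      trace_add
      trace_scaleR
      inner_add_left inner_add_right matrix_vector_right_distrib matrix_vector_mult_scaleR
      matrix_mult.add_left matrix_add_ldistrib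
      matrix_mult.scaleR_left matrix_mult.scaleR_right algebra_simps)

text \<open>Coefficients on coordinate vectors determine the metric; bilinearity of the closed form
  does the rest.\<close>

lemma fisher_metric_eq:
  assumes "\<theta> \<in> normal_manifold"
  shows "fisher_metric \<theta> u v = normal_metric \<theta> u v"
proof -
  have "frechet_derivative (log_likelihood x) (at \<theta>) = score \<theta> (x - mean_of \<theta>)" for x
    using frechet_derivative_at[OF has_derivative_log_likelihood[OF assms]] by simp
  then have "fisher_coeff \<theta> i j = normal_metric \<theta> (axis i 1) (axis j 1)" for i j
    by (simp add: fisher_coeff_def integral_score_score[OF assms])
  then have "fisher_metric \<theta> u v = (\<Sum>i\<in>UNIV. \<Sum>j\<in>UNIV. normal_metric \<theta> (u $ i *\<^sub>R axis i 1) (v $ j *\<^sub>R axis j 1))"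
    by (simp add: fisher_metric_def bilinear_lmul[OF normal_metric_bilinear] bilinear_rmul[OF normal_metric_bilinear] mult_ac)
  also have "\<dots> = normal_metric \<theta> (\<Sum>i\<in>UNIV. u $ i *\<^sub>R axis i 1) (\<Sum>j\<in>UNIV. v $ j *\<^sub>R axis j 1)"
    by (simp add: bilinear_sum[OF normal_metric_bilinear] sum.cartesian_product)
  also have "\<dots> = normal_metric \<theta> u v"
    using basis_expansion[of u] basis_expansion[of v] by (simp add: scalar_mult_eq_scaleR)
  finally show ?thesis .
qed

lemma normal_metric_commute:
  fixes \<theta> u v :: "'d::finite normal_coords"
  assumes "\<theta> \<in> normal_manifold"
  shows "normal_metric \<theta> u v = normal_metric \<theta> v u"
proof -
  obtain M :: "real^'d^'d" where M: "transpose M ** cov_of \<theta> ** M = mat 1"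
    using assms pos_def_orthonormal_basis[of "cov_of \<theta>"] unfolding normal_manifold_def by blast
  show ?thesis by (simp add: normal_metric_orthonormal[OF M] inner_commute)
qed

lemma normal_metric_pos:
  fixes \<theta> u :: "'d::finite normal_coords"
  assumes "\<theta> \<in> normal_manifold" "u \<noteq> 0" shows "normal_metric \<theta> u u > 0"
proof -
  obtain M :: "real^'d^'d" where M: "transpose M ** cov_of \<theta> ** M = mat 1"
    using assms pos_def_orthonormal_basis[of "cov_of \<theta>"] unfolding normal_manifold_def by blast
  note inv = pos_def_factor(2)[OF M]
  have invT: "invertible (transpose M)" using pos_def_factor(4)[OF M] by (simp add: invertible_det_nz)
  have "transpose M *v mean_of u \<noteq> 0 \<or> transpose M ** cov_of u ** M \<noteq> 0"
  proof (rule ccontr)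
    assume "\<not> ?thesis"
    then have 0: "transpose M *v mean_of u = 0" "transpose M ** cov_of u ** M = 0" by auto
    have "mean_of u = matrix_inv (transpose M) *v (transpose M *v mean_of u)"
      by (metis matrix_vector_mul_assoc matrix_inv_left[OF invT] matrix_vector_mul_lid)
    then have "mean_of u = 0" unfolding 0 by simp
    moreover have "cov_of u = matrix_inv (transpose M) ** (transpose M ** cov_of u ** M) ** matrix_inv M"
      by (metis matrix_mul_assoc matrix_mul_lid matrix_mul_rid matrix_inv_left[OF invT] matrix_inv_right[OF inv])
    then have "cov_of u = 0"
      by (simp add: 0 matrix_mult.zero_left matrix_mult.zero_right)
    ultimately have "u = 0"
      by (intro coords_eqI) (simp_all add: linear_0 bounded_linear.linear bounded_linear_mean_of bounded_linear_cov_of)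
    then show False using assms by simp
  qed
  then show ?thesis
    unfolding normal_metric_orthonormal[OF M]
    by (metis add_nonneg_pos add_pos_nonneg inner_ge_zero inner_gt_zero_iff mult_nonneg_nonneg mult_pos_pos zero_le_divide_1_iff zero_less_divide_1_iff zero_le_numeral zero_less_numeral)
qed

section \<open>The Levi-Civita connection\<close>

text \<open>The Christoffel map of the Fisher metric in closed form. Both components are symmetrised
  in \<open>u\<close> and \<open>v\<close>; on the manifold the second argument of
  \<open>coords\<close> is then a symmetric matrix, as \<open>cov_of_coords\<close> demands.\<close>

definition normal_christoffel ::
  "'d::finite normal_coords \<Rightarrow> 'd normal_coords \<Rightarrow> 'd normal_coords \<Rightarrow> 'd normal_coords" where
  "normal_christoffel \<theta> u v = (let P = precision \<theta> in coords
     (- (1/2) *\<^sub>R (cov_of u *v (P *v mean_of v) + cov_of v *v (P *v mean_of u)))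
     ((1/2) *\<^sub>R (outer (mean_of u) (mean_of v) + outer (mean_of v) (mean_of u)
        - cov_of u ** P ** cov_of v - cov_of v ** P ** cov_of u)))"

lemma mean_of_normal_christoffel:
  "mean_of (normal_christoffel \<theta> u v) =
     - (1/2) *\<^sub>R (cov_of u *v (precision \<theta> *v mean_of v) + cov_of v *v (precision \<theta> *v mean_of u))"
  by (simp add: normal_christoffel_def Let_def)

lemma cov_of_normal_christoffel:
  assumes "\<theta> \<in> normal_manifold"
  shows "cov_of (normal_christoffel \<theta> u v) =
     (1/2) *\<^sub>R (outer (mean_of u) (mean_of v) + outer (mean_of v) (mean_of u)
        - cov_of u ** precision \<theta> ** cov_of v - cov_of v ** precision \<theta> ** cov_of u)"
  unfolding normal_christoffel_def Let_def
  by (rule cov_of_coords)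
     (simp add: transpose_scaleR transpose_diff transpose_add transpose_outer matrix_transpose_mul
       symmetric_precision[OF assms] matrix_mul_assoc algebra_simps)

lemma has_derivative_normal_metric:
  assumes "\<theta> \<in> normal_manifold"
  defines "P \<equiv> precision \<theta>"
  shows "((\<lambda>\<theta>. normal_metric \<theta> v w) has_derivative (\<lambda>u. - (mean_of v \<bullet> ((P ** cov_of u ** P) *v mean_of w))
     - 1/2 * (trace (P ** cov_of u ** P ** cov_of v ** P ** cov_of w) + trace (P ** cov_of v ** P ** cov_of u ** P ** cov_of w)))) (at \<theta>)"
proof -
  let ?D = "\<lambda>u. - (P ** cov_of u ** P)"
  have P: "(precision has_derivative ?D) (at \<theta>)"
    using has_derivative_precision[OF assms(1)] by (simp add: P_def)
  have "((\<lambda>\<theta>. normal_metric \<theta> v w) has_derivative (\<lambda>u. (mean_of v \<bullet> (P *v 0 + ?D u *v mean_of w) + 0 \<bullet> (P *v mean_of w)) +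
    1/2 * trace ((P ** cov_of v ** P) ** 0 + ((P ** cov_of v) ** ?D u + (P ** 0 + ?D u ** cov_of v) ** P) ** cov_of w))) (at \<theta>)"
    unfolding normal_metric_def P_def
    by (intro has_derivative_add has_derivative_inner has_derivative_const matrix_vector.FDERIV has_derivative_mult_right
       bounded_linear.has_derivative[OF bounded_linear_trace] matrix_mult.FDERIV P[unfolded P_def])
  also have "(\<lambda>u. (mean_of v \<bullet> (P *v 0 + ?D u *v mean_of w) + 0 \<bullet> (P *v mean_of w)) +
    1/2 * trace ((P ** cov_of v ** P) ** 0 + ((P ** cov_of v) ** ?D u + (P ** 0 + ?D u ** cov_of v) ** P) ** cov_of w)) =
    (\<lambda>u. - (mean_of v \<bullet> ((P ** cov_of u ** P) *v mean_of w))
     - 1/2 * (trace (P ** cov_of u ** P ** cov_of v ** P ** cov_of w) + trace (P ** cov_of v ** P ** cov_of u ** P ** cov_of w)))"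
    by (simp add: fun_eq_iff matrix_mult.zero_right
      matrix_mult.minus_left matrix_mult.minus_right
      matrix_mult.add_left matrix_mult.diff_left
      matrix_vector.minus_left
      trace_minus trace_sub
      matrix_mul_assoc field_simps)
  finally show ?thesis .
qed

lemma normal_christoffel_commute: "normal_christoffel \<theta> u v = normal_christoffel \<theta> v u"
  by (simp add: normal_christoffel_def Let_def algebra_simps)

lemma trace_outer: "trace (outer a b) = a \<bullet> b"
  by (simp add: trace_def outer_nth inner_vec_def)

text \<open>Metric compatibility: the right-hand side is the derivative computed in
  \<open>has_derivative_normal_metric\<close>. In \<open>half\<close>, the two terms pairing with
  \<open>mean_of u\<close> change sign when \<open>v\<close> and \<open>w\<close> are exchanged, so
  they cancel in the sum.\<close>

lemma normal_metric_christoffel: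
  assumes "\<theta> \<in> normal_manifold"
  defines "P \<equiv> precision \<theta>"
  shows "normal_metric \<theta> (normal_christoffel \<theta> u v) w + normal_metric \<theta> v (normal_christoffel \<theta> u w) =
     - (mean_of v \<bullet> ((P ** cov_of u ** P) *v mean_of w))
     - 1/2 * (trace (P ** cov_of u ** P ** cov_of v ** P ** cov_of w) + trace (P ** cov_of v ** P ** cov_of u ** P ** cov_of w))"
proof -
  note sP = symmetric_precision[OF assms(1), folded P_def]
  have half: "normal_metric \<theta> (normal_christoffel \<theta> u v) w =
      - 1/2 * (mean_of v \<bullet> ((P ** cov_of u ** P) *v mean_of w)) - 1/2 * (mean_of u \<bullet> ((P ** cov_of v ** P) *v mean_of w))
      + 1/2 * (mean_of u \<bullet> ((P ** cov_of w ** P) *v mean_of v))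
      - 1/4 * trace (P ** cov_of u ** P ** cov_of v ** P ** cov_of w) - 1/4 * trace (P ** cov_of v ** P ** cov_of u ** P ** cov_of w)"
    for v w
  proof -
    have "(C *v (P *v a)) \<bullet> (P *v b) = a \<bullet> ((P ** C ** P) *v b)" if "transpose C = C" for C a b
      unfolding matrix_vector_mul_assoc[symmetric] using inner_symmetric[OF that] inner_symmetric[OF sP] by metis
    then have mean: "mean_of (normal_christoffel \<theta> u v) \<bullet> (P *v mean_of w) =
      - 1/2 * (mean_of v \<bullet> ((P ** cov_of u ** P) *v mean_of w)) - 1/2 * (mean_of u \<bullet> ((P ** cov_of v ** P) *v mean_of w))"
      unfolding mean_of_normal_christoffel P_def[symmetric]
      by (simp add: inner_add_left inner_diff_left algebra_simps)
    have out: "trace (P ** outer a b ** P ** cov_of w) = b \<bullet> ((P ** cov_of w ** P) *v a)" for a b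
    proof -
      have "trace (P ** outer a b ** P ** cov_of w) = trace (P ** cov_of w ** P ** outer a b)"
        by (metis matrix_mul_assoc trace_mul_sym)
      then show ?thesis by (simp add: matrix_mul_outer trace_outer inner_commute)
    qed
    have out': "mean_of v \<bullet> ((P ** cov_of w ** P) *v mean_of u) = mean_of u \<bullet> ((P ** cov_of w ** P) *v mean_of v)"
    proof -
      have "transpose (P ** cov_of w ** P) = P ** cov_of w ** P"
        by (simp add: matrix_transpose_mul sP matrix_mul_assoc)
      then show ?thesis using inner_symmetric by (metis inner_commute)
    qed
    have "trace (P ** cov_of (normal_christoffel \<theta> u v) ** P ** cov_of w) =
      1/2 * (trace (P ** outer (mean_of u) (mean_of v) ** P ** cov_of w) + trace (P ** outer (mean_of v) (mean_of u) ** P ** cov_of w)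
        - trace (P ** cov_of u ** P ** cov_of v ** P ** cov_of w) - trace (P ** cov_of v ** P ** cov_of u ** P ** cov_of w))"
      unfolding cov_of_normal_christoffel[OF assms(1), folded P_def]
      by (simp add: matrix_mult.add_left matrix_mult.add_right
        matrix_mult.diff_left matrix_mult.diff_right
        matrix_mult.scaleR_left matrix_mult.scaleR_right matrix_mul_assoc
        trace_add trace_sub
        trace_scaleR)
    then show ?thesis
      unfolding normal_metric_def P_def[symmetric] mean out out' by simp
  qed
  have "mean_of w \<bullet> ((P ** cov_of u ** P) *v mean_of v) = mean_of v \<bullet> ((P ** cov_of u ** P) *v mean_of w)"
  proof -
    have "transpose (P ** cov_of u ** P) = P ** cov_of u ** P"
      by (simp add: matrix_transpose_mul sP matrix_mul_assoc)
    then show ?thesis using inner_symmetric by (metis inner_commute)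
  qed
  moreover have "trace (P ** cov_of u ** P ** cov_of w ** P ** cov_of v) = trace (P ** cov_of v ** P ** cov_of u ** P ** cov_of w)"
    "trace (P ** cov_of w ** P ** cov_of u ** P ** cov_of v) = trace (P ** cov_of u ** P ** cov_of v ** P ** cov_of w)"
    using trace_mul_sym[of "P ** cov_of u ** P ** cov_of w" "P ** cov_of v"]
      trace_mul_sym[of "P ** cov_of w" "P ** cov_of u ** P ** cov_of v"]
    by (simp_all add: matrix_mul_assoc)
  ultimately show ?thesis
    unfolding normal_metric_commute[OF assms(1), of v] half by (simp add: algebra_simps)
qed

section \<open>Identifying the Christoffel symbols of a Levi-Civita connection\<close>

lemma Ck_on_const: "Ck_on k S (\<lambda>x. c)"
  by (induction k arbitrary: c) auto

lemma smooth_on_const: "smooth_on S (\<lambda>x. c)"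
  by (simp add: smooth_on_def Ck_on_const)

lemma levi_civita_torsion_const:
  assumes "levi_civita M g nabla" "p \<in> M"
  shows "christoffel nabla p u v = christoffel nabla p v u"
proof -
  have "nabla (\<lambda>_. u) (\<lambda>_. v) p - nabla (\<lambda>_. v) (\<lambda>_. u) p = lie_bracket (\<lambda>_. u) (\<lambda>_. v) p"
    using assms smooth_on_const unfolding levi_civita_def torsion_free_def by blast
  then show ?thesis by (simp add: lie_bracket_def christoffel_def)
qed

lemma levi_civita_metric_const:
  assumes "levi_civita M g nabla" "p \<in> M"
  shows "frechet_derivative (\<lambda>q. g q v w) (at p) u = g p (christoffel nabla p u v) w + g p v (christoffel nabla p u w)"
proof -
  have "metric_compatible M g nabla" using assms by (simp add: levi_civita_def)
  from this[unfolded metric_compatible_def, rule_format, OF conjI[OF smooth_on_const conjI[OF smooth_on_const smooth_on_const]] assms(2)]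
  show ?thesis unfolding christoffel_def .
qed

text \<open>The uniqueness argument for the Levi-Civita connection, carried out on constant fields,
  whose brackets vanish.\<close>

lemma christoffel_eq:
  fixes \<theta> u v :: "'d::finite normal_coords"
  assumes "levi_civita normal_manifold fisher_metric nabla" "\<theta> \<in> normal_manifold"
  shows "christoffel nabla \<theta> u v = normal_christoffel \<theta> u v"
proof -
  let ?g = "normal_metric \<theta>"
  define T where "T u v w = ?g (christoffel nabla \<theta> u v - normal_christoffel \<theta> u v) w" for u v w
  have "((\<lambda>\<theta>. fisher_metric \<theta> v w) has_derivative
      (\<lambda>u. ?g (normal_christoffel \<theta> u v) w + ?g v (normal_christoffel \<theta> u w))) (at \<theta>)" for v w
    unfolding normal_metric_christoffel[OF assms(2)]
    by (rule has_derivative_transform_within_open[OF has_derivative_normal_metric open_normal_manifold])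
       (use assms(2) in \<open>simp_all add: fisher_metric_eq\<close>)
  then have "frechet_derivative (\<lambda>\<theta>. fisher_metric \<theta> v w) (at \<theta>) u =
      ?g (normal_christoffel \<theta> u v) w + ?g v (normal_christoffel \<theta> u w)" for u v w
    by (subst frechet_derivative_at[symmetric]) (assumption, rule refl)
  then have compat: "?g (christoffel nabla \<theta> u v) w + ?g v (christoffel nabla \<theta> u w) =
      ?g (normal_christoffel \<theta> u v) w + ?g v (normal_christoffel \<theta> u w)" for u v w
    using levi_civita_metric_const[OF assms, of v w u] unfolding fisher_metric_eq[OF assms(2)] by simp
  \<comment> \<open>\<open>T\<close> is symmetric in its first two and skew in its last two arguments, hence zero.\<close>
  have skew: "T u v w = - T u w v" for u v w
    using compat[of u v w] normal_metric_commute[OF assms(2), of v]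
    by (simp add: T_def bilinear_lsub[OF normal_metric_bilinear] algebra_simps)
  have sym: "T u v w = T v u w" for u v w
    using levi_civita_torsion_const[OF assms, of u v] normal_christoffel_commute[of \<theta> u v] by (simp add: T_def)
  have "T u v w = 0" for u v w
    using skew[of u v w] sym[of u w v] skew[of w u v] sym[of w v u] skew[of v w u] sym[of v u w] by linarith
  then have "?g (christoffel nabla \<theta> u v - normal_christoffel \<theta> u v) (christoffel nabla \<theta> u v - normal_christoffel \<theta> u v) = 0"
    by (simp add: T_def)
  then show ?thesis
    using normal_metric_pos[OF assms(2)] by (metis eq_iff_diff_eq_0 less_irrefl)
qed

section \<open>Linear differential equations\<close>

text \<open>The Picard series, dominated term by term by the exponential series and differentiated
  termwise. Continuity of \<open>A\<close> is asked in the form in which a Christoffel map along a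
  curve provides it.\<close>

lemma linear_ode_exists:
  fixes A :: "real \<Rightarrow> 'a::euclidean_space \<Rightarrow> 'a"
  assumes "a \<le> b"
    and lin: "\<And>t. t \<in> {a..b} \<Longrightarrow> linear (A t)"
    and bound: "\<And>t v. t \<in> {a..b} \<Longrightarrow> norm (A t v) \<le> B * norm v"
    and cont: "\<And>V. continuous_on {a..b} V \<Longrightarrow> continuous_on {a..b} (\<lambda>t. A t (V t))"
  shows "\<exists>V. V a = v \<and> (\<forall>t\<in>{a..b}. (V has_vector_derivative A t (V t)) (at t within {a..b}))"
proof -
  \<comment> \<open>These are the terms of the series, not its partial sums: each is the integral of
    \<open>A\<close> applied to the one before.\<close>
  define f where "f = rec_nat (\<lambda>_. v) (\<lambda>_ g t. integral {a..t} (\<lambda>s. A s (g s)))"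
  have f_0: "f 0 t = v" and f_Suc: "f (Suc n) t = integral {a..t} (\<lambda>s. A s (f n s))" for n t
    by (simp_all add: f_def)
  have der: "(f (Suc n) has_vector_derivative A t (f n t)) (at t within {a..b})"
    if "continuous_on {a..b} (f n)" "t \<in> {a..b}" for n t
    using integral_has_vector_derivative[OF cont[OF that(1)] that(2)] by (simp add: f_Suc[abs_def])
  have f_cont: "continuous_on {a..b} (f n)" for n
  proof (induction n)
    case (Suc n)
    show ?case using der[OF Suc]
      by (meson continuous_on_eq_continuous_within has_vector_derivative_continuous)
  qed (simp add: f_0[abs_def])
  have f_bound: "norm (f n t) \<le> norm v * (\<bar>B\<bar> * (t - a)) ^ n / fact n" if "t \<in> {a..b}" for n t
    using that
  proof (induction n arbitrary: t)
    case (Suc n)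
    let ?F = "\<lambda>n s. norm v * (\<bar>B\<bar> * (s - a)) ^ n / fact n"
    have "((\<lambda>s. \<bar>B\<bar> * ?F n s) has_integral (?F (Suc n) t - ?F (Suc n) a)) {a..t}"
    proof (rule fundamental_theorem_of_calculus)
      fix s
      have "((\<lambda>s. ?F (Suc n) s) has_real_derivative norm v * (real (Suc n) * (\<bar>B\<bar> * (s - a)) ^ n * \<bar>B\<bar>) / fact (Suc n)) (at s within {a..t})"
      proof -
        have "((\<lambda>s. (\<bar>B\<bar> * (s - a)) ^ Suc n) has_real_derivative (1 + real n) * (\<bar>B\<bar> * (\<bar>B\<bar> * (s - a)) ^ n)) (at s within {a..t})"
          by (rule DERIV_power_Suc) (auto intro!: derivative_eq_intros)
        from DERIV_cdivide[OF DERIV_cmult[OF this, of "norm v"], of "fact (Suc n)"] show ?thesis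
          by (simp add: mult_ac)
      qed
      also have "norm v * (real (Suc n) * (\<bar>B\<bar> * (s - a)) ^ n * \<bar>B\<bar>) / fact (Suc n) = \<bar>B\<bar> * ?F n s"
        by (simp add: field_simps del: of_nat_Suc)
      finally show "(?F (Suc n) has_vector_derivative \<bar>B\<bar> * ?F n s) (at s within {a..t})"
        by (simp add: has_real_derivative_iff_has_vector_derivative)
    qed (use Suc.prems in auto)
    then have I: "((\<lambda>s. \<bar>B\<bar> * ?F n s) has_integral ?F (Suc n) t) {a..t}" by simp
    have "norm (f (Suc n) t) \<le> integral {a..t} (\<lambda>s. \<bar>B\<bar> * ?F n s)"
      unfolding f_Suc
    proof (rule integral_norm_bound_integral)
      show "(\<lambda>s. A s (f n s)) integrable_on {a..t}"
        using Suc.prems by (intro integrable_continuous_real continuous_on_subset[OF cont[OF f_cont]]) auto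
      show "(\<lambda>s. \<bar>B\<bar> * ?F n s) integrable_on {a..t}" using I by blast
      fix s assume s: "s \<in> {a..t}"
      have "norm (A s (f n s)) \<le> B * norm (f n s)" using bound s Suc.prems by auto
      also have "\<dots> \<le> \<bar>B\<bar> * norm (f n s)" by (intro mult_right_mono) auto
      also have "\<dots> \<le> \<bar>B\<bar> * ?F n s" using Suc.IH[of s] s Suc.prems by (intro mult_left_mono) auto
      finally show "norm (A s (f n s)) \<le> \<bar>B\<bar> * ?F n s" .
    qed
    also have "\<dots> = ?F (Suc n) t" using I by (rule integral_unique)
    finally show ?case .
  qed (simp add: f_0)
  define C where "C = \<bar>B\<bar> * (b - a)"
  have f_bound': "norm (f n t) \<le> norm v * C ^ n / fact n" if "t \<in> {a..b}" for n t
  proof -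
    have "norm v * (\<bar>B\<bar> * (t - a)) ^ n / fact n \<le> norm v * C ^ n / fact n"
      unfolding C_def using that by (intro divide_right_mono mult_left_mono power_mono) auto
    then show ?thesis using f_bound[OF that] by (rule order_trans[rotated])
  qed
  have sum_M: "summable (\<lambda>n. norm v * C ^ n / fact n)"
    using summable_mult[OF summable_exp[of C], of "norm v"] by (simp add: field_simps)
  define S where "S t = (\<Sum>n. f n t)" for t
  have unif: "uniform_limit {a..b} (\<lambda>n t. \<Sum>i<n. f i t) S sequentially"
    unfolding S_def by (rule Weierstrass_m_test[OF f_bound' sum_M])
  have sums: "(\<lambda>n. f n t) sums S t" if "t \<in> {a..b}" for t
    using tendsto_uniform_limitI[OF unif that] by (simp add: sums_def)
  \<comment> \<open>The derivative of term \<open>Suc m\<close> is \<open>A\<close> applied to term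
    \<open>m\<close>, while term 0 is constant; the derivative of a partial sum thus involves one
    term less.\<close>
  define f' where "f' n t h = (case n of 0 \<Rightarrow> 0 | Suc m \<Rightarrow> h *\<^sub>R A t (f m t))" for n t and h :: real
  have "\<exists>g. \<forall>t\<in>{a..b}. (\<lambda>n. f n t) sums (g t) \<and> (g has_derivative (\<lambda>h. h *\<^sub>R A t (S t))) (at t within {a..b})"
  proof (rule has_derivative_series[where f' = f' and x = a])
    show "(f n has_derivative f' n t) (at t within {a..b})" if "t \<in> {a..b}" for n t
      using der[OF f_cont that] by (cases n) (auto simp: f'_def[abs_def] f_0[abs_def] has_vector_derivative_def)
    fix e :: real assume "e > 0"
    define e' where "e' = e / (\<bar>B\<bar> + 1)"
    have "e' > 0" using \<open>e > 0\<close> by (simp add: e'_def)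
    then obtain N where N: "\<And>n t. n \<ge> N \<Longrightarrow> t \<in> {a..b} \<Longrightarrow> dist (\<Sum>i<n. f i t) (S t) < e'"
      using unif unfolding uniform_limit_iff eventually_sequentially by blast
    show "\<forall>\<^sub>F n in sequentially. \<forall>t\<in>{a..b}. \<forall>h. norm ((\<Sum>i<n. f' i t h) - h *\<^sub>R A t (S t)) \<le> e * norm h"
      unfolding eventually_sequentially
    proof (intro exI[of _ "Suc N"] allI impI ballI)
      fix n t and h :: real assume n: "Suc N \<le> n" and t: "t \<in> {a..b}"
      then obtain m where m: "n = Suc m" "m \<ge> N" by (cases n) auto
      have "(\<Sum>i<n. f' i t h) = h *\<^sub>R A t (\<Sum>i<m. f i t)"
        unfolding m(1) sum.lessThan_Suc_shift by (simp add: f'_def linear_sum[OF lin[OF t]] scaleR_sum_right)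
      then have "norm ((\<Sum>i<n. f' i t h) - h *\<^sub>R A t (S t)) = \<bar>h\<bar> * norm (A t ((\<Sum>i<m. f i t) - S t))"
        by (simp add: linear_diff[OF lin[OF t]] scaleR_diff_right flip: norm_scaleR)
      also have "\<dots> \<le> \<bar>h\<bar> * (\<bar>B\<bar> * e')"
      proof (rule mult_left_mono)
        have "norm (A t ((\<Sum>i<m. f i t) - S t)) \<le> B * norm ((\<Sum>i<m. f i t) - S t)" by (rule bound[OF t])
        also have "\<dots> \<le> \<bar>B\<bar> * e'"
          using N[OF m(2) t] by (intro mult_mono) (auto simp: dist_norm)
        finally show "norm (A t ((\<Sum>i<m. f i t) - S t)) \<le> \<bar>B\<bar> * e'" .
      qed simp
      also have "\<dots> \<le> \<bar>h\<bar> * e"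
        using \<open>e > 0\<close> by (intro mult_left_mono) (auto simp: e'_def field_simps)
      finally show "norm ((\<Sum>i<n. f' i t h) - h *\<^sub>R A t (S t)) \<le> e * norm h" by (simp add: mult.commute)
    qed
  next
    show "(\<lambda>n. f n a) sums S a" using sums \<open>a \<le> b\<close> by simp
  qed (use \<open>a \<le> b\<close> in auto)
  then obtain g where g: "\<And>t. t \<in> {a..b} \<Longrightarrow> (\<lambda>n. f n t) sums g t"
      "\<And>t. t \<in> {a..b} \<Longrightarrow> (g has_derivative (\<lambda>h. h *\<^sub>R A t (S t))) (at t within {a..b})"
    by blast
  have gS: "g t = S t" if "t \<in> {a..b}" for t
    using g(1)[OF that] sums[OF that] sums_unique2 by blast
  have "(\<lambda>n. f n a) = (\<lambda>n. if n = 0 then v else 0)"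
    by (auto simp: fun_eq_iff f_0 f_Suc gr0_conv_Suc)
  then have "(\<lambda>n. f n a) sums v"
    using sums_single[of 0 "\<lambda>_. v"] by simp
  then have "g a = v"
    using g(1)[of a] \<open>a \<le> b\<close> sums_unique2 by force
  then show ?thesis
    using g(2) gS by (intro exI[of _ g]) (auto simp: has_vector_derivative_def)
qed

section \<open>Piecewise smooth paths\<close>

lemma smooth_curve_on_imp_deriv:
  assumes "smooth_curve_on a b \<gamma>"
  obtains D where "\<And>t. t \<in> {a..b} \<Longrightarrow> (\<gamma> has_vector_derivative D t) (at t within {a..b})"
    "continuous_on {a..b} D"
proof -
  obtain E where E: "\<And>t. t \<in> {a..b} \<Longrightarrow> E 0 t = \<gamma> t"
    "\<And>k t. t \<in> {a..b} \<Longrightarrow> (E k has_vector_derivative E (Suc k) t) (at t within {a..b})"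
    using assms unfolding smooth_curve_on_def by blast
  show thesis
  proof (rule that[of "E 1"])
    show "(\<gamma> has_vector_derivative E 1 t) (at t within {a..b})" if "t \<in> {a..b}" for t
      using has_vector_derivative_transform[OF that _ E(2)[OF that, of 0]] E(1) by simp
    show "continuous_on {a..b} (E 1)"
      using E(2) by (meson continuous_on_eq_continuous_within has_vector_derivative_continuous)
  qed
qed

text \<open>Serves both reversal (\<open>m = -1\<close>) and the two halves of a join
  (\<open>m = 2\<close>).\<close>

lemma smooth_curve_on_affine:
  fixes m c :: real
  assumes "smooth_curve_on a b \<gamma>" and eq: "\<And>t. t \<in> {a'..b'} \<Longrightarrow> \<eta> t = \<gamma> (m * t + c)"
    and sub: "\<And>t. t \<in> {a'..b'} \<Longrightarrow> m * t + c \<in> {a..b}"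
  shows "smooth_curve_on a' b' \<eta>"
proof -
  obtain E where E: "\<And>t. t \<in> {a..b} \<Longrightarrow> E 0 t = \<gamma> t"
    "\<And>k t. t \<in> {a..b} \<Longrightarrow> (E k has_vector_derivative E (Suc k) t) (at t within {a..b})"
    using assms(1) unfolding smooth_curve_on_def by blast
  have "((\<lambda>t. m ^ k *\<^sub>R E k (m * t + c)) has_vector_derivative m ^ Suc k *\<^sub>R E (Suc k) (m * t + c)) (at t within {a'..b'})"
    if "t \<in> {a'..b'}" for k t
  proof -
    have "((\<lambda>t. m * t + c) has_vector_derivative m) (at t within {a'..b'})"
      by (auto intro!: derivative_eq_intros)
    moreover have "(E k has_vector_derivative E (Suc k) (m * t + c)) (at (m * t + c) within (\<lambda>t. m * t + c) ` {a'..b'})"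
      using E(2)[OF sub[OF that]] by (rule has_vector_derivative_within_subset) (use sub in auto)
    ultimately have "(E k \<circ> (\<lambda>t. m * t + c) has_vector_derivative m *\<^sub>R E (Suc k) (m * t + c)) (at t within {a'..b'})"
      by (rule vector_diff_chain_within)
    from bounded_linear.has_vector_derivative[OF bounded_linear_scaleR_right this, of "m ^ k"]
    show ?thesis by (simp add: o_def mult.commute)
  qed
  then show ?thesis
    unfolding smooth_curve_on_def using E(1) eq sub
    by (intro exI[of _ "\<lambda>k t. m ^ k *\<^sub>R E k (m * t + c)"]) auto
qed

lemma piecewise_smooth_linepath: "piecewise_smooth (linepath p q)"
proof -
  have "smooth_curve_on 0 1 (linepath p q)"
    unfolding smooth_curve_on_def
  proof (intro exI[of _ "\<lambda>k. if k = 0 then linepath p q else if k = 1 then (\<lambda>_. q - p) else (\<lambda>_. 0)"] conjI ballI allI)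
    fix k and t :: real assume "t \<in> {0..1}"
    have "(linepath p q has_vector_derivative q - p) (at t within {0..1})"
      by (rule has_vector_derivative_linepath_within)
    then show "((if k = 0 then linepath p q else if k = 1 then (\<lambda>_. q - p) else (\<lambda>_. 0)) has_vector_derivative
       (if Suc k = 0 then linepath p q else if Suc k = 1 then (\<lambda>_. q - p) else (\<lambda>_. 0)) t) (at t within {0..1})"
      by (auto intro: derivative_eq_intros)
  qed auto
  then show ?thesis
    unfolding piecewise_smooth_def by (intro exI[of _ 1] exI[of _ "\<lambda>i. real i"]) auto
qed

lemma piecewise_smooth_reversepath:
  assumes "piecewise_smooth \<gamma>" shows "piecewise_smooth (reversepath \<gamma>)"
proof -
  obtain N and s :: "nat \<Rightarrow> real" where s: "s 0 = 0" "s N = 1"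
    "\<And>i. i < N \<Longrightarrow> s i < s (Suc i)" "\<And>i. i < N \<Longrightarrow> smooth_curve_on (s i) (s (Suc i)) \<gamma>"
    using assms unfolding piecewise_smooth_def by blast
  show ?thesis
    unfolding piecewise_smooth_def
  proof (intro exI[of _ N] exI[of _ "\<lambda>i. 1 - s (N - i)"] conjI allI impI)
    fix i assume i: "i < N"
    then have Suc: "Suc (N - Suc i) = N - i" by simp
    show "1 - s (N - i) < 1 - s (N - Suc i)"
      using s(3)[of "N - Suc i"] i by (simp add: Suc)
    show "smooth_curve_on (1 - s (N - i)) (1 - s (N - Suc i)) (reversepath \<gamma>)"
      by (rule smooth_curve_on_affine[OF s(4)[of "N - Suc i"], where m = "-1" and c = 1])
        (use i in \<open>auto simp: Suc reversepath_def\<close>)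
  qed (use s in auto)
qed

lemma piecewise_smooth_join:
  assumes "piecewise_smooth \<gamma>" "piecewise_smooth \<eta>" "pathfinish \<gamma> = pathstart \<eta>"
  shows "piecewise_smooth (\<gamma> +++ \<eta>)"
proof -
  obtain N and s :: "nat \<Rightarrow> real" where s: "s 0 = 0" "s N = 1"
    "\<And>i. i < N \<Longrightarrow> s i < s (Suc i)" "\<And>i. i < N \<Longrightarrow> smooth_curve_on (s i) (s (Suc i)) \<gamma>"
    using assms(1) unfolding piecewise_smooth_def by blast
  obtain K and r :: "nat \<Rightarrow> real" where r: "r 0 = 0" "r K = 1"
    "\<And>i. i < K \<Longrightarrow> r i < r (Suc i)" "\<And>i. i < K \<Longrightarrow> smooth_curve_on (r i) (r (Suc i)) \<eta>"
    using assms(2) unfolding piecewise_smooth_def by blast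
  have s_le: "s i \<le> 1" if "i \<le> N" for i
    using that
  proof (induction rule: inc_induct)
    case (step n) then show ?case using s(3)[of n] by simp
  qed (simp add: s)
  have r_ge: "0 \<le> r i" if "i \<le> K" for i
    using that
  proof (induction i)
    case (Suc n) then show ?case using r(3)[of n] by simp
  qed (simp add: r)
  \<comment> \<open>At \<open>i = N\<close> the two formulas agree: both give 1/2.\<close>
  define u where "u i = (if i \<le> N then s i / 2 else (r (i - N) + 1) / 2)" for i
  have u_ge: "u i = (r (i - N) + 1) / 2" if "N \<le> i" for i
    using that s(2) r(1) by (auto simp: u_def)
  show ?thesis
    unfolding piecewise_smooth_def
  proof (intro exI[of _ "N + K"] exI[of _ u] conjI allI impI)
    show "u 0 = 0" using s(1) by (simp add: u_def)
    show "u (N + K) = 1" using r(2) by (simp add: u_ge)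
    fix i assume i: "i < N + K"
    have "u i < u (Suc i) \<and> smooth_curve_on (u i) (u (Suc i)) (\<gamma> +++ \<eta>)"
    proof (cases "i < N")
      case True
      have "smooth_curve_on (s i / 2) (s (Suc i) / 2) (\<gamma> +++ \<eta>)"
        by (rule smooth_curve_on_affine[OF s(4)[OF True], where m = 2 and c = 0])
          (use True s_le[of "Suc i"] in \<open>auto simp: joinpaths_def\<close>)
      then show ?thesis using True s(3)[OF True] by (simp add: u_def)
    next
      case False
      define k where "k = i - N"
      have k: "k < K" "i = N + k" using i False by (auto simp: k_def)
      have "smooth_curve_on ((r k + 1) / 2) ((r (Suc k) + 1) / 2) (\<gamma> +++ \<eta>)"
      proof (rule smooth_curve_on_affine[OF r(4)[OF k(1)], where m = 2 and c = "-1"])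
        fix t assume t: "t \<in> {(r k + 1) / 2..(r (Suc k) + 1) / 2}"
        show "2 * t + - 1 \<in> {r k..r (Suc k)}" using t by (auto simp: field_simps)
        have "t \<ge> 1 / 2" using t r_ge[of k] k by (auto simp: field_simps)
        show "(\<gamma> +++ \<eta>) t = \<eta> (2 * t + - 1)"
        \<comment> \<open>At the midpoint a joined path takes its value from
          \<open>\<gamma>\<close>; here the matching of the end points is needed.\<close>
        proof (cases "t = 1 / 2")
          case True
          show ?thesis using assms(3) unfolding True by (simp add: joinpaths_def pathfinish_def pathstart_def)
        qed (use \<open>t \<ge> 1 / 2\<close> in \<open>auto simp: joinpaths_def\<close>)
      qed
      then show ?thesis using r(3)[OF k(1)] k by (simp add: u_ge)
    qed
    then show "u i < u (Suc i)" "smooth_curve_on (u i) (u (Suc i)) (\<gamma> +++ \<eta>)" by auto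
  qed
qed

lemma piecewise_smooth_imp_path:
  assumes "piecewise_smooth \<gamma>" shows "path \<gamma>"
proof -
  obtain N and s :: "nat \<Rightarrow> real" where s: "s 0 = 0" "s N = 1"
    "\<And>i. i < N \<Longrightarrow> s i < s (Suc i)" "\<And>i. i < N \<Longrightarrow> smooth_curve_on (s i) (s (Suc i)) \<gamma>"
    using assms unfolding piecewise_smooth_def by blast
  have "k \<le> N \<Longrightarrow> 0 \<le> s k \<and> continuous_on {0..s k} \<gamma>" for k
  proof (induction k)
    case (Suc k)
    have "continuous_on {s k..s (Suc k)} \<gamma>"
      using smooth_curve_on_imp_deriv[OF s(4)[of k]] Suc.prems
      by (metis Suc_le_lessD continuous_on_eq_continuous_within has_vector_derivative_continuous)
    then have "continuous_on ({0..s k} \<union> {s k..s (Suc k)}) \<gamma>"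
      using Suc by (intro continuous_on_closed_Un) auto
    moreover have "{0..s k} \<union> {s k..s (Suc k)} = {0..s (Suc k)}"
      using Suc s(3)[of k] by auto
    ultimately show ?case using Suc s(3)[of k] by simp
  qed (simp add: s)
  from this[of N] show ?thesis using s(2) by (simp add: path_def)
qed

section \<open>Parallel transport of a metric connection\<close>

lemma bilinear_euclidean_expansion:
  assumes "bilinear f"
  shows "f u v = (\<Sum>i\<in>Basis. \<Sum>j\<in>Basis. ((u \<bullet> i) * (v \<bullet> j)) *\<^sub>R f i j)"
proof -
  have "f u v = f (\<Sum>i\<in>Basis. (u \<bullet> i) *\<^sub>R i) (\<Sum>j\<in>Basis. (v \<bullet> j) *\<^sub>R j)"
    by (simp add: euclidean_representation)
  also have "\<dots> = (\<Sum>i\<in>Basis. \<Sum>j\<in>Basis. ((u \<bullet> i) * (v \<bullet> j)) *\<^sub>R f i j)"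
    by (simp add: bilinear_sum[OF assms] sum.cartesian_product bilinear_lmul[OF assms] bilinear_rmul[OF assms] mult.commute)
  finally show ?thesis .
qed

text \<open>In finite dimension continuity for fixed arguments gives joint continuity, by expansion
  in a basis.\<close>

lemma continuous_on_bilinear:
  fixes F :: "'t::topological_space \<Rightarrow> 'a::euclidean_space \<Rightarrow> 'b::euclidean_space \<Rightarrow> 'c::real_normed_vector"
  assumes bil: "\<And>t. t \<in> S \<Longrightarrow> bilinear (F t)" and F: "\<And>i j. continuous_on S (\<lambda>t. F t i j)"
    and U: "continuous_on S U" and V: "continuous_on S V"
  shows "continuous_on S (\<lambda>t. F t (U t) (V t))"
proof -
  have "continuous_on S (\<lambda>t. \<Sum>i\<in>Basis. \<Sum>j\<in>Basis. ((U t \<bullet> i) * (V t \<bullet> j)) *\<^sub>R F t i j)"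
    by (intro continuous_intros U V F)
  also have "?this \<longleftrightarrow> ?thesis"
    by (intro continuous_on_cong refl) (simp add: bilinear_euclidean_expansion[OF bil, symmetric])
  finally show ?thesis .
qed

text \<open>The last assumption is metric compatibility, stated for constant fields only.\<close>

locale metric_connection =
  fixes M :: "(real^'n) set" and nabla :: "(real^'n) connection" and g :: "(real^'n) metric_tensor"
  assumes bilinear_christoffel: "p \<in> M \<Longrightarrow> bilinear (christoffel nabla p)"
    and continuous_christoffel: "continuous_on M (\<lambda>p. christoffel nabla p u v)"
    and bilinear_metric: "p \<in> M \<Longrightarrow> bilinear (g p)"
    and metric_pos: "p \<in> M \<Longrightarrow> u \<noteq> 0 \<Longrightarrow> g p u u > 0"
    and has_derivative_metric: "p \<in> M \<Longrightarrow> ((\<lambda>q. g q v w) has_derivative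
       (\<lambda>u. g p (christoffel nabla p u v) w + g p v (christoffel nabla p u w))) (at p)"
begin

abbreviation "\<Gamma> \<equiv> christoffel nabla"

lemma continuous_metric: "continuous_on M (\<lambda>p. g p u v)"
  using has_derivative_metric by (meson continuous_at_imp_continuous_on has_derivative_continuous)

text \<open>Each parallel field brings its own witness for the velocity of the curve; uniqueness of
  one-dimensional derivatives identifies them.\<close>

lemma parallel_along_common_derivative:
  assumes "parallel_along nabla \<gamma> V" "parallel_along nabla \<gamma> W"
  shows "\<exists>S. finite S \<and> (\<forall>t\<in>{0..1} - S. \<exists>\<gamma>'. (\<gamma> has_vector_derivative \<gamma>') (at t within {0..1}) \<and>
      (V has_vector_derivative - \<Gamma> (\<gamma> t) \<gamma>' (V t)) (at t within {0..1}) \<and>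
      (W has_vector_derivative - \<Gamma> (\<gamma> t) \<gamma>' (W t)) (at t within {0..1}))"
proof -
  have *: "\<exists>S. finite S \<and> (\<forall>t\<in>{0..1} - S. \<exists>\<gamma>'. (\<gamma> has_vector_derivative \<gamma>') (at t within {0..1}) \<and>
      (V has_vector_derivative - \<Gamma> (\<gamma> t) \<gamma>' (V t)) (at t within {0..1}))"
    if "parallel_along nabla \<gamma> V" for V
    using that unfolding parallel_along_def has_cov_derivative_def by (metis eq_neg_iff_add_eq_0)
  obtain S T where "finite S" "finite T" and
    V: "\<And>t. t \<in> {0..1} - S \<Longrightarrow> \<exists>\<gamma>'. (\<gamma> has_vector_derivative \<gamma>') (at t within {0..1}) \<and>
      (V has_vector_derivative - \<Gamma> (\<gamma> t) \<gamma>' (V t)) (at t within {0..1})" and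
    W: "\<And>t. t \<in> {0..1} - T \<Longrightarrow> \<exists>\<gamma>'. (\<gamma> has_vector_derivative \<gamma>') (at t within {0..1}) \<and>
      (W has_vector_derivative - \<Gamma> (\<gamma> t) \<gamma>' (W t)) (at t within {0..1})"
    using *[OF assms(1)] *[OF assms(2)] by blast
  moreover have "at t within {0..1} \<noteq> bot" if "t \<in> {0..1}" for t :: real
    using that by (simp add: trivial_limit_within islimpt_Icc)
  ultimately show ?thesis
    by (intro exI[of _ "S \<union> T"] conjI finite_UnI ballI)
      (use vector_derivative_unique_within in blast)+
qed

text \<open>Expanded in a basis, the inner product is a finite sum of products of real functions.
  The product rule and compatibility give derivative 0 off a finite set, and continuity bridges that
  set.\<close>

lemma parallel_inner_const:
  assumes \<gamma>: "path \<gamma>" "path_image \<gamma> \<subseteq> M"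
    and "parallel_along nabla \<gamma> V" "parallel_along nabla \<gamma> W" "t \<in> {0..1}"
  shows "g (\<gamma> t) (V t) (W t) = g (\<gamma> 0) (V 0) (W 0)"
proof -
  have M: "\<gamma> t \<in> M" if "t \<in> {0..1}" for t
    using \<gamma>(2) that by (auto simp: path_image_def)
  obtain S where S: "finite S" "\<And>t. t \<in> {0..1} - S \<Longrightarrow>
      \<exists>\<gamma>'. (\<gamma> has_vector_derivative \<gamma>') (at t within {0..1}) \<and>
        (V has_vector_derivative - \<Gamma> (\<gamma> t) \<gamma>' (V t)) (at t within {0..1}) \<and>
        (W has_vector_derivative - \<Gamma> (\<gamma> t) \<gamma>' (W t)) (at t within {0..1})"
    using parallel_along_common_derivative[OF assms(3,4)] by blast
  have cV: "continuous_on {0..1} V" and cW: "continuous_on {0..1} W"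
    using assms(3,4) by (auto simp: parallel_along_def)
  let ?h = "\<lambda>t. g (\<gamma> t) (V t) (W t)"
  have c\<gamma>: "continuous_on {0..1} \<gamma>" using \<gamma>(1) by (simp add: path_def)
  have "continuous_on {0..1} ?h"
  proof (rule continuous_on_bilinear[where F = "\<lambda>t. g (\<gamma> t)", OF _ _ cV cW])
    show "continuous_on {0..1} (\<lambda>t. g (\<gamma> t) i j)" for i j
      by (rule continuous_on_compose2[OF continuous_metric c\<gamma>]) (use M in auto)
  qed (use M bilinear_metric in auto)
  moreover have "(?h has_derivative (\<lambda>_. 0)) (at t within {0..1})" if t: "t \<in> {0..1} - S" for t
  proof -
    obtain \<gamma>' V' W' where \<gamma>': "(\<gamma> has_vector_derivative \<gamma>') (at t within {0..1})"
      and V': "(V has_vector_derivative V') (at t within {0..1})" "V' = - \<Gamma> (\<gamma> t) \<gamma>' (V t)"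
      and W': "(W has_vector_derivative W') (at t within {0..1})" "W' = - \<Gamma> (\<gamma> t) \<gamma>' (W t)"
      using S(2)[OF t] by blast
    have tM: "\<gamma> t \<in> M" using M t by auto
    note bg = bilinear_metric[OF tM]
    have comp: "((\<lambda>t. V t \<bullet> i) has_real_derivative V' \<bullet> i) (at t within {0..1})"
      "((\<lambda>t. W t \<bullet> i) has_real_derivative W' \<bullet> i) (at t within {0..1})" for i
      using V'(1) W'(1) by (auto simp: has_real_derivative_iff_has_vector_derivative
        intro: bounded_linear.has_vector_derivative[OF bounded_linear_inner_left])
    have gcomp: "((\<lambda>t. g (\<gamma> t) i j) has_real_derivative
        g (\<gamma> t) (\<Gamma> (\<gamma> t) \<gamma>' i) j + g (\<gamma> t) i (\<Gamma> (\<gamma> t) \<gamma>' j)) (at t within {0..1})" for i j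
    proof -
      have "((\<lambda>t. g (\<gamma> t) i j) has_derivative
        (\<lambda>h. g (\<gamma> t) (\<Gamma> (\<gamma> t) (h *\<^sub>R \<gamma>') i) j + g (\<gamma> t) i (\<Gamma> (\<gamma> t) (h *\<^sub>R \<gamma>') j))) (at t within {0..1})"
        using \<gamma>' unfolding has_vector_derivative_def
        by (rule has_derivative_compose[where f = \<gamma> and x = t and g = "\<lambda>q. g q i j", OF _ has_derivative_metric[OF tM]])
      then show ?thesis
        unfolding has_field_derivative_def
        by (simp add: bilinear_lmul[OF bilinear_christoffel[OF tM]] bilinear_lmul[OF bg] bilinear_rmul[OF bg]
            distrib_left[symmetric] mult_commute_abs)
    qed
    have "((\<lambda>t. \<Sum>i\<in>Basis. \<Sum>j\<in>Basis. ((V t \<bullet> i) * (W t \<bullet> j)) * g (\<gamma> t) i j) has_real_derivative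
      (\<Sum>i\<in>Basis. \<Sum>j\<in>Basis. ((V' \<bullet> i) * (W t \<bullet> j) + (W' \<bullet> j) * (V t \<bullet> i)) * g (\<gamma> t) i j +
         (g (\<gamma> t) (\<Gamma> (\<gamma> t) \<gamma>' i) j + g (\<gamma> t) i (\<Gamma> (\<gamma> t) \<gamma>' j)) * ((V t \<bullet> i) * (W t \<bullet> j)))) (at t within {0..1})"
      by (intro DERIV_sum DERIV_mult comp gcomp)
    also have "(\<Sum>i\<in>Basis. \<Sum>j\<in>Basis. ((V' \<bullet> i) * (W t \<bullet> j) + (W' \<bullet> j) * (V t \<bullet> i)) * g (\<gamma> t) i j +
         (g (\<gamma> t) (\<Gamma> (\<gamma> t) \<gamma>' i) j + g (\<gamma> t) i (\<Gamma> (\<gamma> t) \<gamma>' j)) * ((V t \<bullet> i) * (W t \<bullet> j))) =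
       g (\<gamma> t) V' (W t) + g (\<gamma> t) (V t) W' + (g (\<gamma> t) (\<Gamma> (\<gamma> t) \<gamma>' (V t)) (W t) + g (\<gamma> t) (V t) (\<Gamma> (\<gamma> t) \<gamma>' (W t)))"
    proof -
      have l: "linear (\<Gamma> (\<gamma> t) \<gamma>')" using bilinear_christoffel[OF tM] by (simp add: bilinear_def)
      have b: "bilinear (\<lambda>v w. g (\<gamma> t) (\<Gamma> (\<gamma> t) \<gamma>' v) w)" "bilinear (\<lambda>v w. g (\<gamma> t) v (\<Gamma> (\<gamma> t) \<gamma>' w))"
        using bg l by (auto simp: bilinear_def intro: linear_compose[unfolded o_def])
      note e = bilinear_euclidean_expansion[OF bg, of V' "W t"] bilinear_euclidean_expansion[OF bg, of "V t" W']
        bilinear_euclidean_expansion[OF b(1), of "V t" "W t"] bilinear_euclidean_expansion[OF b(2), of "V t" "W t"]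
      show ?thesis
        by (simp only: e) (simp add: sum.distrib algebra_simps)
    qed
    also have "\<dots> = 0"
      by (simp add: V'(2) W'(2) bilinear_lneg[OF bg] bilinear_rneg[OF bg])
    finally have "((\<lambda>t. \<Sum>i\<in>Basis. \<Sum>j\<in>Basis. ((V t \<bullet> i) * (W t \<bullet> j)) * g (\<gamma> t) i j) has_real_derivative 0) (at t within {0..1})" .
    note der = this
    have eq: "(\<Sum>i\<in>Basis. \<Sum>j\<in>Basis. ((V t \<bullet> i) * (W t \<bullet> j)) * g (\<gamma> t) i j) = ?h t" if "t \<in> {0..1}" for t
      by (subst bilinear_euclidean_expansion[OF bilinear_metric[OF M[OF that]], of "V t"]) simp
    have "(?h has_real_derivative 0) (at t within {0..1})"
      by (rule has_field_derivative_transform_within[OF der zero_less_one]) (use t eq in auto)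
    then show ?thesis unfolding has_field_derivative_def lambda_zero .
  qed
  ultimately show ?thesis
    using has_derivative_zero_unique_strong_interval[of S 0 1 ?h "?h 0" t] S(1) assms(5) by auto
qed

lemma parallel_along_lincomb:
  assumes "path_image \<gamma> \<subseteq> M" "parallel_along nabla \<gamma> V" "parallel_along nabla \<gamma> W"
  shows "parallel_along nabla \<gamma> (\<lambda>t. c *\<^sub>R V t + W t)"
proof -
  have M: "\<gamma> t \<in> M" if "t \<in> {0..1}" for t
    using assms(1) that by (auto simp: path_image_def)
  obtain S where S: "finite S" "\<And>t. t \<in> {0..1} - S \<Longrightarrow>
      \<exists>\<gamma>'. (\<gamma> has_vector_derivative \<gamma>') (at t within {0..1}) \<and>
        (V has_vector_derivative - \<Gamma> (\<gamma> t) \<gamma>' (V t)) (at t within {0..1}) \<and>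
        (W has_vector_derivative - \<Gamma> (\<gamma> t) \<gamma>' (W t)) (at t within {0..1})"
    using parallel_along_common_derivative[OF assms(2,3)] by blast
  have cV: "continuous_on {0..1} V" and cW: "continuous_on {0..1} W"
    using assms(2,3) by (auto simp: parallel_along_def)
  have "has_cov_derivative nabla \<gamma> (\<lambda>t. c *\<^sub>R V t + W t) t 0" if t: "t \<in> {0..1} - S" for t
  proof -
    obtain \<gamma>' V' W' where \<gamma>': "(\<gamma> has_vector_derivative \<gamma>') (at t within {0..1})"
      and V': "(V has_vector_derivative V') (at t within {0..1})" "V' = - \<Gamma> (\<gamma> t) \<gamma>' (V t)"
      and W': "(W has_vector_derivative W') (at t within {0..1})" "W' = - \<Gamma> (\<gamma> t) \<gamma>' (W t)"
      using S(2)[OF t] by blast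
    have tM: "\<gamma> t \<in> M" using M t by auto
    note b = bilinear_christoffel[OF tM]
    have "((\<lambda>t. c *\<^sub>R V t + W t) has_vector_derivative c *\<^sub>R V' + W') (at t within {0..1})"
      by (intro has_vector_derivative_add W'(1) bounded_linear.has_vector_derivative[OF bounded_linear_scaleR_right V'(1)])
    moreover have "c *\<^sub>R V' + W' + \<Gamma> (\<gamma> t) \<gamma>' (c *\<^sub>R V t + W t) = 0"
      by (simp add: V'(2) W'(2) bilinear_radd[OF b] bilinear_rmul[OF b])
    ultimately show ?thesis
      unfolding has_cov_derivative_def using \<gamma>'
      by (intro exI[of _ \<gamma>'] exI[of _ "c *\<^sub>R V' + W'"]) simp
  qed
  then show ?thesis
    unfolding parallel_along_def using S(1) cV cW
    by (intro conjI exI[of _ S] continuous_intros) auto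
qed

lemma ode_on_piece:
  assumes "a \<le> b" "smooth_curve_on a b \<gamma>" "\<gamma> ` {a..b} \<subseteq> M"
  shows "\<exists>W. W a = w \<and> (\<forall>t\<in>{a..b}. \<exists>\<gamma>' W'. (\<gamma> has_vector_derivative \<gamma>') (at t within {a..b}) \<and>
     (W has_vector_derivative W') (at t within {a..b}) \<and> W' + \<Gamma> (\<gamma> t) \<gamma>' (W t) = 0)"
proof -
  obtain D where D: "\<And>t. t \<in> {a..b} \<Longrightarrow> (\<gamma> has_vector_derivative D t) (at t within {a..b})"
    "continuous_on {a..b} D"
    using smooth_curve_on_imp_deriv[OF assms(2)] by blast
  have M: "\<gamma> t \<in> M" if "t \<in> {a..b}" for t using assms(3) that by blast
  have c\<gamma>: "continuous_on {a..b} \<gamma>"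
    using D(1) by (meson continuous_on_eq_continuous_within has_vector_derivative_continuous)
  define A where "A t v = - \<Gamma> (\<gamma> t) (D t) v" for t v
  have cont: "continuous_on {a..b} (\<lambda>t. \<Gamma> (\<gamma> t) (D t) (V t))" if "continuous_on {a..b} V" for V
  proof (rule continuous_on_bilinear[where F = "\<lambda>t. \<Gamma> (\<gamma> t)", OF _ _ D(2) that])
    show "continuous_on {a..b} (\<lambda>t. \<Gamma> (\<gamma> t) i j)" for i j
      by (rule continuous_on_compose2[OF continuous_christoffel c\<gamma>]) (use M in auto)
  qed (use M bilinear_christoffel in auto)
  define \<beta> where "\<beta> t = (\<Sum>j\<in>Basis. norm (\<Gamma> (\<gamma> t) (D t) j))" for t
  have "continuous_on {a..b} \<beta>"
    unfolding \<beta>_def by (intro continuous_intros cont)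
  then have "bounded (\<beta> ` {a..b})"
    by (intro compact_imp_bounded compact_continuous_image) auto
  then obtain B where B: "\<And>t. t \<in> {a..b} \<Longrightarrow> norm (\<beta> t) \<le> B"
    unfolding bounded_iff by blast
  have "\<exists>W. W a = w \<and> (\<forall>t\<in>{a..b}. (W has_vector_derivative A t (W t)) (at t within {a..b}))"
  proof (rule linear_ode_exists[OF assms(1)])
    fix t assume t: "t \<in> {a..b}"
    have l: "linear (\<Gamma> (\<gamma> t) (D t))" using bilinear_christoffel[OF M[OF t]] by (simp add: bilinear_def)
    then show "linear (A t)" unfolding A_def by (intro linear_compose_neg)
    fix v :: "real^'n"
    have "\<Gamma> (\<gamma> t) (D t) v = \<Gamma> (\<gamma> t) (D t) (\<Sum>j\<in>Basis. (v \<bullet> j) *\<^sub>R j)"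
      by (simp add: euclidean_representation)
    also have "\<dots> = (\<Sum>j\<in>Basis. (v \<bullet> j) *\<^sub>R \<Gamma> (\<gamma> t) (D t) j)"
      by (simp add: linear_sum[OF l] linear_cmul[OF l])
    also have "norm \<dots> \<le> (\<Sum>j\<in>Basis. norm v * norm (\<Gamma> (\<gamma> t) (D t) j))"
      by (intro order_trans[OF norm_sum] sum_mono) (auto intro!: mult_right_mono Basis_le_norm)
    also have "\<dots> = norm v * \<beta> t" by (simp add: \<beta>_def sum_distrib_left)
    also have "\<dots> \<le> norm v * B" using B[OF t] by (intro mult_left_mono) auto
    finally show "norm (A t v) \<le> B * norm v" by (simp add: A_def mult.commute)
  next
    show "continuous_on {a..b} (\<lambda>t. A t (V t))" if "continuous_on {a..b} V" for V
      unfolding A_def using cont[OF that] by (intro continuous_intros)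
  qed
  then show ?thesis using D(1) unfolding A_def by (metis add.left_inverse)
qed

lemma parallel_exists:
  assumes "piecewise_smooth \<gamma>" "path_image \<gamma> \<subseteq> M"
  shows "\<exists>V. parallel_along nabla \<gamma> V \<and> V 0 = v"
proof -
  obtain N and s :: "nat \<Rightarrow> real" where s: "s 0 = 0" "s N = 1"
    "\<And>i. i < N \<Longrightarrow> s i < s (Suc i)" "\<And>i. i < N \<Longrightarrow> smooth_curve_on (s i) (s (Suc i)) \<gamma>"
    using assms(1) unfolding piecewise_smooth_def by blast
  have s_le: "s i \<le> 1" if "i \<le> N" for i
    using that
  proof (induction rule: inc_induct)
    case (step n) then show ?case using s(3)[of n] by simp
  qed (simp add: s)
  \<comment> \<open>Two-sided derivatives are asked away from the breakpoints, so that goodness is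
    local and survives the gluing of consecutive pieces.\<close>
  define good where "good V t \<longleftrightarrow> (\<exists>\<gamma>' V'. (\<gamma> has_vector_derivative \<gamma>') (at t) \<and>
      (V has_vector_derivative V') (at t) \<and> V' + \<Gamma> (\<gamma> t) \<gamma>' (V t) = 0)" for V t
  have "k \<le> N \<Longrightarrow> 0 \<le> s k \<and> (\<exists>V. V 0 = v \<and> continuous_on {0..s k} V \<and> (\<forall>t\<in>{0..s k} - s ` {..k}. good V t))" for k
  proof (induction k)
    case (Suc k)
    then obtain V where V: "V 0 = v" "continuous_on {0..s k} V" "\<And>t. t \<in> {0..s k} - s ` {..k} \<Longrightarrow> good V t"
      and k: "0 \<le> s k" "s k < s (Suc k)" "s (Suc k) \<le> 1"
      using s(3)[of k] s_le by auto
    have "\<gamma> ` {s k..s (Suc k)} \<subseteq> M"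
      using assms(2) k unfolding path_image_def by (auto simp: image_subset_iff)
    from ode_on_piece[OF less_imp_le[OF k(2)] s(4) this, of "V (s k)"] Suc.prems
    obtain W where W: "W (s k) = V (s k)" "\<And>t. t \<in> {s k..s (Suc k)} \<Longrightarrow>
      \<exists>\<gamma>' W'. (\<gamma> has_vector_derivative \<gamma>') (at t within {s k..s (Suc k)}) \<and>
       (W has_vector_derivative W') (at t within {s k..s (Suc k)}) \<and> W' + \<Gamma> (\<gamma> t) \<gamma>' (W t) = 0"
      by auto
    define U where "U t = (if t \<le> s k then V t else W t)" for t
    have cW: "continuous_on {s k..s (Suc k)} W"
      using W(2) by (meson continuous_on_eq_continuous_within has_vector_derivative_continuous)
    have "continuous_on ({0..s k} \<union> {s k..s (Suc k)}) U"
      unfolding U_def by (rule continuous_on_If) (use V(2) cW W(1) in auto)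
    moreover have "{0..s k} \<union> {s k..s (Suc k)} = {0..s (Suc k)}"
      using k by auto
    moreover have "good U t" if t: "t \<in> {0..s (Suc k)} - s ` {..Suc k}" for t
    proof -
      have tn: "t \<noteq> s k" "t \<noteq> s (Suc k)" using t by auto
      consider "t < s k" | "s k < t" "t < s (Suc k)" using t tn by fastforce
      then show ?thesis
      proof cases
        case 1
        have "good V t" using V(3)[of t] 1 t by (auto simp: atMost_Suc)
        then obtain \<gamma>' V' where "(\<gamma> has_vector_derivative \<gamma>') (at t)"
          "(V has_vector_derivative V') (at t)" "V' + \<Gamma> (\<gamma> t) \<gamma>' (V t) = 0" unfolding good_def by blast
        moreover have "(U has_vector_derivative V') (at t)"
          by (rule has_vector_derivative_transform_within_open[OF calculation(2), of "{..<s k}"]) (use 1 in \<open>auto simp: U_def\<close>)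
        ultimately show ?thesis using 1 unfolding good_def by (auto simp: U_def)
      next
        case 2
        have at: "at t within {s k..s (Suc k)} = at t"
          using 2 by (intro at_within_interior) auto
        obtain \<gamma>' W' where "(\<gamma> has_vector_derivative \<gamma>') (at t)"
          "(W has_vector_derivative W') (at t)" "W' + \<Gamma> (\<gamma> t) \<gamma>' (W t) = 0"
          using W(2)[of t] 2 unfolding at by auto
        moreover have "(U has_vector_derivative W') (at t)"
          by (rule has_vector_derivative_transform_within_open[OF calculation(2), of "{s k<..}"]) (use 2 in \<open>auto simp: U_def\<close>)
        ultimately show ?thesis using 2 unfolding good_def by (auto simp: U_def)
      qed
    qed
    moreover have "U 0 = v" using V(1) k by (simp add: U_def)
    ultimately show ?case using k by auto
  qed (auto simp: s intro!: exI[of _ "\<lambda>_. v"])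
  from this[of N] obtain V where V: "V 0 = v" "continuous_on {0..1} V" "\<And>t. t \<in> {0..1} - s ` {..N} \<Longrightarrow> good V t"
    using s(2) by auto
  have "has_cov_derivative nabla \<gamma> V t 0" if "t \<in> {0..1} - s ` {..N}" for t
    using V(3)[OF that] unfolding good_def has_cov_derivative_def by (metis has_vector_derivative_at_within)
  then have "parallel_along nabla \<gamma> V"
    unfolding parallel_along_def using V(2) by (intro conjI exI[of _ "s ` {..N}"]) auto
  then show ?thesis using V(1) by blast
qed

text \<open>A relational form of parallel transport, usable before existence and uniqueness justify
  the definite description in \<open>parallel_transport\<close>.\<close>

definition transports :: "(real \<Rightarrow> real^'n) \<Rightarrow> real^'n \<Rightarrow> real^'n \<Rightarrow> bool" where
  "transports \<gamma> v w \<longleftrightarrow> (\<exists>V. parallel_along nabla \<gamma> V \<and> V 0 = v \<and> V 1 = w)"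

lemma transports_inner:
  assumes "path \<gamma>" "path_image \<gamma> \<subseteq> M" "transports \<gamma> v v'" "transports \<gamma> w w'"
  shows "g (pathfinish \<gamma>) v' w' = g (pathstart \<gamma>) v w"
  using parallel_inner_const[OF assms(1,2), of _ _ 1] assms(3,4)
  unfolding transports_def pathfinish_def pathstart_def by auto

lemma transports_lincomb:
  assumes "path_image \<gamma> \<subseteq> M" "transports \<gamma> v v'" "transports \<gamma> w w'"
  shows "transports \<gamma> (c *\<^sub>R v + w) (c *\<^sub>R v' + w')"
proof -
  obtain V W where "parallel_along nabla \<gamma> V" "V 0 = v" "V 1 = v'" "parallel_along nabla \<gamma> W" "W 0 = w" "W 1 = w'"
    using assms(2,3) unfolding transports_def by blast
  then show ?thesis
    unfolding transports_def using parallel_along_lincomb[OF assms(1), of V W c]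
    by (intro exI[of _ "\<lambda>t. c *\<^sub>R V t + W t"]) simp
qed

text \<open>A parallel field has constant length. This takes the place of a uniqueness theorem for
  the differential equation.\<close>

lemma parallel_eq_0:
  assumes "path \<gamma>" "path_image \<gamma> \<subseteq> M" "parallel_along nabla \<gamma> V" "s \<in> {0..1}" "t \<in> {0..1}" "V s = 0"
  shows "V t = 0"
proof (rule ccontr)
  assume "V t \<noteq> 0"
  have M: "\<gamma> t \<in> M" "\<gamma> s \<in> M"
    using assms by (auto simp: path_image_def)
  have "g (\<gamma> t) (V t) (V t) = g (\<gamma> s) (V s) (V s)"
    using parallel_inner_const[OF assms(1-3,3,4)] parallel_inner_const[OF assms(1-3,3,5)] by simp
  also have "\<dots> = 0" using bilinear_lzero[OF bilinear_metric[OF M(2)]] assms(6) by simp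
  finally show False using metric_pos[OF M(1) \<open>V t \<noteq> 0\<close>] by simp
qed

lemma transports_unique:
  assumes "path \<gamma>" "path_image \<gamma> \<subseteq> M" "transports \<gamma> v w" "transports \<gamma> v w'"
  shows "w' = w"
proof -
  have "transports \<gamma> ((-1) *\<^sub>R v + v) ((-1) *\<^sub>R w + w')"
    using assms by (intro transports_lincomb)
  then obtain V where "parallel_along nabla \<gamma> V" "V 0 = 0" "V 1 = w' - w"
    unfolding transports_def by auto
  then show ?thesis using parallel_eq_0[OF assms(1,2), of V 0 1] by simp
qed

definition admissible :: "(real \<Rightarrow> real^'n) \<Rightarrow> bool" where
  "admissible \<gamma> \<longleftrightarrow> piecewise_smooth \<gamma> \<and> path_image \<gamma> \<subseteq> M"

lemma admissible_path: "admissible \<gamma> \<Longrightarrow> path \<gamma>" and admissible_image: "admissible \<gamma> \<Longrightarrow> path_image \<gamma> \<subseteq> M"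
  by (auto simp: admissible_def piecewise_smooth_imp_path)

lemma parallel_transport_eqI:
  assumes "admissible \<gamma>" "transports \<gamma> v w" shows "parallel_transport nabla \<gamma> v = w"
  unfolding parallel_transport_def
  using assms transports_unique[OF admissible_path admissible_image] unfolding transports_def
  by (intro the_equality) blast+

lemma transports_parallel_transport:
  assumes "admissible \<gamma>" shows "transports \<gamma> v (parallel_transport nabla \<gamma> v)"
proof -
  obtain V where "parallel_along nabla \<gamma> V" "V 0 = v"
    using parallel_exists assms unfolding admissible_def by blast
  then have "transports \<gamma> v (V 1)" unfolding transports_def by blast
  then show ?thesis using parallel_transport_eqI[OF assms] by simp
qed

lemma linear_parallel_transport:
  assumes "admissible \<gamma>" shows "linear (parallel_transport nabla \<gamma>)"
proof -
  let ?P = "parallel_transport nabla \<gamma>"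
  have *: "?P (c *\<^sub>R v + w) = c *\<^sub>R ?P v + ?P w" for c v w
    by (intro parallel_transport_eqI[OF assms] transports_lincomb admissible_image[OF assms] transports_parallel_transport assms)
  have "?P 0 = 0" using *[of "-1" 0 0] by simp
  then show ?thesis using *[of 1] *[of _ _ 0] by (intro linearI) auto
qed

lemma parallel_transport_isometry:
  assumes "admissible \<gamma>"
  shows "g (pathfinish \<gamma>) (parallel_transport nabla \<gamma> v) (parallel_transport nabla \<gamma> w) = g (pathstart \<gamma>) v w"
  by (intro transports_inner admissible_path admissible_image transports_parallel_transport assms)

lemma parallel_along_sum:
  assumes "admissible \<gamma>" "\<And>j. parallel_along nabla \<gamma> (V j)" "finite I"
  shows "parallel_along nabla \<gamma> (\<lambda>t. \<Sum>j\<in>I. c j *\<^sub>R V j t)"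
  using assms(3)
proof (induction I rule: finite_induct)
  case empty
  have "parallel_along nabla \<gamma> (\<lambda>t. (-1) *\<^sub>R V undefined t + V undefined t)"
    by (intro parallel_along_lincomb admissible_image assms)
  then show ?case by simp
next
  case (insert j I)
  then show ?case by (simp add: parallel_along_lincomb admissible_image assms)
qed

text \<open>The determinant of a fundamental system is continuous and never vanishes, so it stays positive.\<close>

lemma parallel_transport_det_pos:
  assumes "admissible \<gamma>" shows "det (matrix (parallel_transport nabla \<gamma>)) > 0"
proof -
  have "\<forall>j. \<exists>V. parallel_along nabla \<gamma> V \<and> V 0 = axis j 1"
    using parallel_exists assms unfolding admissible_def by blast
  then obtain V where V: "\<And>j. parallel_along nabla \<gamma> (V j)" "\<And>j. V j 0 = axis j 1" by metis
  define \<Phi> where "\<Phi> t = (\<chi> i j. V j t $ i)" for t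
  have app: "\<Phi> t *v y = (\<Sum>j\<in>UNIV. y $ j *\<^sub>R V j t)" for t y
    by (simp add: \<Phi>_def vec_eq_iff matrix_vector_mult_def mult.commute)
  have \<Phi>0: "\<Phi> 0 = mat 1" by (simp add: \<Phi>_def V(2) vec_eq_iff axis_apply mat_def)
  have nz: "det (\<Phi> t) \<noteq> 0" if "t \<in> {0..1}" for t
  proof -
    \<comment> \<open>A combination of parallel fields is parallel; vanishing at \<open>t\<close> it
      vanishes at 0, where the fields are the coordinate axes.\<close>
    have "y = 0" if "\<Phi> t *v y = 0" for y
    proof -
      have "\<Phi> 0 *v y = 0"
        using parallel_eq_0[OF admissible_path[OF assms] admissible_image[OF assms] parallel_along_sum[OF assms V(1) finite], of t 0]
          that \<open>t \<in> {0..1}\<close> unfolding app by simp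
      then show ?thesis by (simp add: \<Phi>0)
    qed
    then show ?thesis
      by (metis invertible_det_nz invertible_left_inverse matrix_left_invertible_ker)
  qed
  have cont: "continuous_on {0..1} (\<lambda>t. det (\<Phi> t))"
    using V(1) unfolding \<Phi>_def parallel_along_def by (intro continuous_intros) auto
  have "det (\<Phi> 1) > 0"
  proof (rule ccontr)
    assume "\<not> ?thesis"
    then have "\<exists>t\<ge>0. t \<le> 1 \<and> det (\<Phi> t) = 0"
      using IVT2'[of "\<lambda>t. det (\<Phi> t)" 1 0 0] cont by (simp add: \<Phi>0)
    then show False using nz by auto
  qed
  also have "\<Phi> 1 = matrix (parallel_transport nabla \<gamma>)"
  proof -
    have "parallel_transport nabla \<gamma> (axis j 1) = V j 1" for j
      using V by (intro parallel_transport_eqI[OF assms]) (auto simp: transports_def)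
    then show ?thesis by (simp add: \<Phi>_def matrix_def)
  qed
  finally show ?thesis .
qed

text \<open>Parallelism survives reparametrisation: the factor \<open>m\<close> comes out of both
  terms, since the Christoffel map is linear in the velocity. At interior times derivatives within
  the interval are two-sided, so the chain rule applies.\<close>

lemma has_cov_derivative_affine:
  fixes m c :: real
  assumes "has_cov_derivative nabla \<gamma> V (m * t + c) 0" "0 < m * t + c" "m * t + c < 1"
    and "\<gamma> (m * t + c) \<in> M" "open U" "t \<in> U"
    and eq: "\<And>s. s \<in> U \<Longrightarrow> \<eta> s = \<gamma> (m * s + c)" "\<And>s. s \<in> U \<Longrightarrow> X s = V (m * s + c)"
  shows "has_cov_derivative nabla \<eta> X t 0"
proof -
  have at: "at (m * t + c) within {0..1} = at (m * t + c)"
    using assms(2,3) by (intro at_within_interior) auto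
  obtain \<gamma>' V' where *: "(\<gamma> has_vector_derivative \<gamma>') (at (m * t + c))"
    "(V has_vector_derivative V') (at (m * t + c))" "V' + \<Gamma> (\<gamma> (m * t + c)) \<gamma>' (V (m * t + c)) = 0"
    using assms(1) unfolding has_cov_derivative_def at by auto
  have aff: "((\<lambda>s. m * s + c) has_vector_derivative m) (at t)"
    by (auto intro!: derivative_eq_intros)
  have "(\<eta> has_vector_derivative m *\<^sub>R \<gamma>') (at t)"
    by (rule has_vector_derivative_transform_within_open[OF vector_diff_chain_at[OF aff *(1)] assms(5,6)]) (simp add: eq)
  moreover have "(X has_vector_derivative m *\<^sub>R V') (at t)"
    by (rule has_vector_derivative_transform_within_open[OF vector_diff_chain_at[OF aff *(2)] assms(5,6)]) (simp add: eq)
  moreover have "m *\<^sub>R V' + \<Gamma> (\<eta> t) (m *\<^sub>R \<gamma>') (X t) = m *\<^sub>R (V' + \<Gamma> (\<gamma> (m * t + c)) \<gamma>' (V (m * t + c)))"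
    by (simp add: eq assms(6) bilinear_lmul[OF bilinear_christoffel[OF assms(4)]] scaleR_add_right)
  ultimately show ?thesis
    unfolding has_cov_derivative_def *(3)
    by (intro exI[of _ "m *\<^sub>R \<gamma>'"] exI[of _ "m *\<^sub>R V'"]) (simp add: has_vector_derivative_at_within)
qed

section \<open>Transport along joined and reversed paths\<close>

lemma admissible_join:
  "admissible \<gamma> \<Longrightarrow> admissible \<eta> \<Longrightarrow> pathfinish \<gamma> = pathstart \<eta> \<Longrightarrow> admissible (\<gamma> +++ \<eta>)"
  unfolding admissible_def by (simp add: piecewise_smooth_join path_image_join)

lemma admissible_reversepath: "admissible \<gamma> \<Longrightarrow> admissible (reversepath \<gamma>)"
  unfolding admissible_def by (simp add: piecewise_smooth_reversepath)

lemma transports_join: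
  assumes "admissible \<gamma>" "admissible \<eta>" and v: "transports \<gamma> u v" and w: "transports \<eta> v w"
  shows "transports (\<gamma> +++ \<eta>) u w"
proof -
  have M: "\<gamma> t \<in> M" "\<eta> t \<in> M" if "t \<in> {0..1}" for t
    using assms(1,2) that by (auto simp: path_image_def admissible_def)
  obtain V where V: "parallel_along nabla \<gamma> V" "V 0 = u" "V 1 = v"
    using v unfolding transports_def by blast
  obtain W where W: "parallel_along nabla \<eta> W" "W 0 = v" "W 1 = w"
    using w unfolding transports_def by blast
  obtain S where S: "finite S" "\<And>t. t \<in> {0..1} - S \<Longrightarrow> has_cov_derivative nabla \<gamma> V t 0"
    and cV: "continuous_on {0..1} V"
    using V(1) unfolding parallel_along_def by blast
  obtain T where T: "finite T" "\<And>t. t \<in> {0..1} - T \<Longrightarrow> has_cov_derivative nabla \<eta> W t 0"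
    and cW: "continuous_on {0..1} W"
    using W(1) unfolding parallel_along_def by blast
  let ?X = "V +++ W"
  have "path ?X"
    using cV cW V(3) W(2) by (intro path_join_imp) (auto simp: path_def pathfinish_def pathstart_def)
  \<comment> \<open>End points and midpoint are added to the rescaled exceptional sets, so that only
    interior times of the two halves remain.\<close>
  define E where "E = {0, 1 / 2, 1} \<union> (\<lambda>s. s / 2) ` S \<union> (\<lambda>s. (s + 1) / 2) ` T"
  have "has_cov_derivative nabla (\<gamma> +++ \<eta>) ?X t 0" if t: "t \<in> {0..1} - E" for t
  proof (cases "t < 1 / 2")
    case True
    have S': "2 * t \<notin> S"
    proof
      assume "2 * t \<in> S"
      then have "2 * t / 2 \<in> E" unfolding E_def by blast
      then show False using t by simp
    qed
    have t': "0 < t" "t < 1 / 2" using t True by (auto simp: E_def)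
    show ?thesis
    proof (rule has_cov_derivative_affine[where \<gamma> = \<gamma> and V = V and m = 2 and c = 0 and U = "{..<1/2}"])
      show "has_cov_derivative nabla \<gamma> V (2 * t + 0) 0" using S(2)[of "2 * t"] S' t' by simp
      show "\<gamma> (2 * t + 0) \<in> M" using M(1)[of "2 * t"] t' by simp
    qed (use t' in \<open>simp_all add: joinpaths_def\<close>)
  next
    case False
    have T': "2 * t - 1 \<notin> T"
    proof
      assume "2 * t - 1 \<in> T"
      then have "(2 * t - 1 + 1) / 2 \<in> E" unfolding E_def by blast
      then show False using t by simp
    qed
    have t': "1 / 2 < t" "t < 1" using t False by (auto simp: E_def)
    show ?thesis
    proof (rule has_cov_derivative_affine[where \<gamma> = \<eta> and V = W and m = 2 and c = "-1" and U = "{1/2<..}"])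
      show "has_cov_derivative nabla \<eta> W (2 * t + -1) 0" using T(2)[of "2 * t - 1"] T' t' by simp
      show "\<eta> (2 * t + -1) \<in> M" using M(2)[of "2 * t - 1"] t' by simp
    qed (use t' in \<open>simp_all add: joinpaths_def\<close>)
  qed
  moreover have "finite E" using S(1) T(1) by (simp add: E_def)
  ultimately have "parallel_along nabla (\<gamma> +++ \<eta>) ?X"
    unfolding parallel_along_def using \<open>path ?X\<close> unfolding path_def by blast
  then show ?thesis
    unfolding transports_def using V(2) W(3) by (intro exI[of _ ?X]) (auto simp: joinpaths_def)
qed

lemma transports_reversepath:
  assumes "admissible \<gamma>" and v: "transports \<gamma> u v"
  shows "transports (reversepath \<gamma>) v u"
proof -
  have M: "\<gamma> t \<in> M" if "t \<in> {0..1}" for t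
    using assms(1) that by (auto simp: path_image_def admissible_def)
  obtain V where V: "parallel_along nabla \<gamma> V" "V 0 = u" "V 1 = v"
    using v unfolding transports_def by blast
  obtain S where S: "finite S" "\<And>t. t \<in> {0..1} - S \<Longrightarrow> has_cov_derivative nabla \<gamma> V t 0"
    and cV: "continuous_on {0..1} V"
    using V(1) unfolding parallel_along_def by blast
  let ?X = "reversepath V"
  have "path ?X" using cV by (simp add: path_def[of V, symmetric])
  define E where "E = {0, 1} \<union> (\<lambda>s. 1 - s) ` S"
  have "has_cov_derivative nabla (reversepath \<gamma>) ?X t 0" if t: "t \<in> {0..1} - E" for t
  proof -
    have S': "1 - t \<notin> S"
    proof
      assume "1 - t \<in> S"
      then have "1 - (1 - t) \<in> E" unfolding E_def by blast
      then show False using t by simp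
    qed
    have t': "0 < t" "t < 1" using t by (auto simp: E_def less_le)
    show ?thesis
    proof (rule has_cov_derivative_affine[where \<gamma> = \<gamma> and V = V and m = "-1" and c = 1 and U = UNIV])
      show "has_cov_derivative nabla \<gamma> V (-1 * t + 1) 0" using S(2)[of "1 - t"] S' t' by simp
      show "\<gamma> (-1 * t + 1) \<in> M" using M[of "1 - t"] t' by simp
    qed (use t' in \<open>simp_all add: reversepath_def\<close>)
  qed
  moreover have "finite E" using S(1) by (simp add: E_def)
  ultimately have "parallel_along nabla (reversepath \<gamma>) ?X"
    unfolding parallel_along_def using \<open>path ?X\<close> unfolding path_def by blast
  then show ?thesis
    unfolding transports_def using V(2,3) by (intro exI[of _ ?X]) (auto simp: reversepath_def)
qed

lemma parallel_transport_join:
  assumes "admissible \<gamma>" "admissible \<eta>" "pathfinish \<gamma> = pathstart \<eta>"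
  shows "parallel_transport nabla (\<gamma> +++ \<eta>) = parallel_transport nabla \<eta> \<circ> parallel_transport nabla \<gamma>"
proof
  fix v
  show "parallel_transport nabla (\<gamma> +++ \<eta>) v = (parallel_transport nabla \<eta> \<circ> parallel_transport nabla \<gamma>) v"
    using transports_join[OF assms(1,2) transports_parallel_transport[OF assms(1)] transports_parallel_transport[OF assms(2)]]
    by (intro parallel_transport_eqI admissible_join assms) simp
qed

lemma parallel_transport_reversepath:
  assumes "admissible \<gamma>"
  shows "parallel_transport nabla (reversepath \<gamma>) (parallel_transport nabla \<gamma> v) = v"
  by (intro parallel_transport_eqI admissible_reversepath transports_reversepath transports_parallel_transport assms)

end

section \<open>Orthonormal frames\<close>

definition frame_columns :: "('n \<Rightarrow> real^'n) \<Rightarrow> real^'n^'n::finite" where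
  "frame_columns e = (\<chi> i j. e j $ i)"

lemma frame_columns_axis: "frame_columns e *v axis j 1 = e j"
  by (simp add: frame_columns_def matrix_vector_mult_def vec_eq_iff axis_apply if_distrib cong: if_cong)

context
  fixes h :: "real^'n \<Rightarrow> real^'n \<Rightarrow> real" and e :: "'n \<Rightarrow> real^'n"
  assumes bil: "bilinear h" and orth: "\<And>i j. h (e i) (e j) = (if i = j then 1 else 0)"
begin

text \<open>The matrix of the dual basis: row \<open>i\<close> is the functional
  \<open>h (e i)\<close>, and orthonormality makes it the inverse of
  \<open>frame_columns e\<close>.\<close>

definition frame_coords :: "real^'n^'n" where
  "frame_coords = (\<chi> i s. h (e i) (axis s 1))"

lemma frame_coords_apply: "(frame_coords *v w) $ i = h (e i) w"
proof -
  have "h (e i) w = h (e i) (\<Sum>s\<in>UNIV. w $ s *\<^sub>R axis s 1)"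
    using basis_expansion[of w] by (simp add: scalar_mult_eq_scaleR)
  also have "\<dots> = (\<Sum>s\<in>UNIV. h (e i) (axis s 1) * w $ s)"
    using bil unfolding bilinear_def by (simp add: linear_sum linear_cmul mult.commute)
  finally show ?thesis by (simp add: frame_coords_def matrix_vector_mult_def)
qed

lemma frame_coords_columns: "frame_coords ** frame_columns e = mat 1"
proof -
  have "(frame_coords ** frame_columns e) *v axis j 1 = mat 1 *v axis j 1" for j
    unfolding matrix_vector_mul_assoc[symmetric] frame_columns_axis
    by (simp add: vec_eq_iff frame_coords_apply orth axis_apply)
  then show ?thesis
    by (simp add: matrix_vector_mult_basis vec_eq_iff column_def)
qed

lemma frame_columns_coords: "frame_columns e ** frame_coords = mat 1"
  using frame_coords_columns matrix_left_right_inverse by blast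

lemma inner_frame_coords: "(frame_coords *v u) \<bullet> (frame_coords *v v) = h u v"
proof -
  have exp: "u = (\<Sum>k\<in>UNIV. (frame_coords *v u) $ k *\<^sub>R e k)" for u
  proof -
    have "u = frame_columns e *v (frame_coords *v u)"
      by (simp add: matrix_vector_mul_assoc frame_columns_coords)
    also have "\<dots> = (\<Sum>k\<in>UNIV. (frame_coords *v u) $ k *\<^sub>R e k)"
      by (simp add: frame_columns_def vec_eq_iff matrix_vector_mult_def mult.commute)
    finally show ?thesis .
  qed
  have "h u v = h (\<Sum>k\<in>UNIV. (frame_coords *v u) $ k *\<^sub>R e k) v"
    using exp[of u] by simp
  also have "\<dots> = (\<Sum>k\<in>UNIV. (frame_coords *v u) $ k * h (e k) v)"
    using bil unfolding bilinear_def by (simp add: linear_sum[of "\<lambda>x. h x v"] linear_cmul[of "\<lambda>x. h x v"])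
  finally show ?thesis by (simp add: inner_vec_def frame_coords_apply)
qed

end

locale orthonormal_frame_at = metric_connection M nabla g
  for M :: "(real^'n) set" and nabla g +
  fixes x :: "real^'n" and e :: "'n \<Rightarrow> real^'n"
  assumes x: "x \<in> M" and frame: "orthonormal_frame g x e"
begin

lemma frame_orth: "g x (e i) (e j) = (if i = j then 1 else 0)"
  using frame by (simp add: orthonormal_frame_def)

abbreviation "cols \<equiv> frame_columns e"
abbreviation "crds \<equiv> frame_coords (g x) e"

lemmas coords_columns = frame_coords_columns[OF bilinear_metric[OF x] frame_orth]
lemmas columns_coords = frame_columns_coords[OF bilinear_metric[OF x] frame_orth]
lemmas coords_apply = frame_coords_apply[OF bilinear_metric[OF x] frame_orth]
lemmas inner_coords = inner_frame_coords[OF bilinear_metric[OF x] frame_orth]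

text \<open>An ordinary change of basis, from which composition and determinants follow by matrix
  algebra.\<close>

lemma frame_matrix_eq:
  assumes "linear f" shows "frame_matrix g x e f = crds ** matrix f ** cols"
proof -
  have "(crds ** matrix f ** cols) *v axis j 1 = frame_matrix g x e f *v axis j 1" for j
    unfolding matrix_vector_mul_assoc[symmetric] frame_columns_axis fun_cong[OF matrix_vector_mul(2)[OF assms]]
    by (simp add: vec_eq_iff coords_apply frame_matrix_def matrix_vector_mult_basis column_def)
  then show ?thesis
    by (simp add: matrix_vector_mult_basis vec_eq_iff column_def)
qed

lemma frame_matrix_compose:
  assumes "linear f" "linear h"
  shows "frame_matrix g x e (f \<circ> h) = frame_matrix g x e f ** frame_matrix g x e h"
proof -
  have "crds ** matrix f ** cols ** (crds ** matrix h ** cols) = crds ** matrix f ** (cols ** crds) ** matrix h ** cols"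
    by (simp add: matrix_mul_assoc)
  then show ?thesis
    using assms by (simp add: frame_matrix_eq linear_compose matrix_compose columns_coords matrix_mul_assoc)
qed

lemma frame_matrix_id: "frame_matrix g x e (\<lambda>v. v) = mat 1"
  by (simp add: frame_matrix_def frame_orth mat_def vec_eq_iff)

lemma rotation_frame_matrix:
  assumes "linear f" "\<And>v w. g x (f v) (f w) = g x v w" "det (matrix f) > 0"
  shows "rotation_matrix (frame_matrix g x e f)"
proof -
  let ?B = "frame_matrix g x e f"
  have B: "column j ?B = crds *v f (e j)" for j
    by (simp add: vec_eq_iff column_def frame_matrix_def coords_apply)
  have "orthogonal_matrix ?B"
  proof -
    have "(transpose ?B ** ?B) $ i $ j = column i ?B \<bullet> column j ?B" for i j
      by (simp add: matrix_matrix_mult_def transpose_def column_def inner_vec_def)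
    then have "transpose ?B ** ?B = mat 1"
      by (simp add: vec_eq_iff B inner_coords assms(2) frame_orth mat_def)
    then show ?thesis by (simp add: orthogonal_matrix)
  qed
  moreover have "det ?B = det (matrix f)"
  proof -
    have "det crds * det cols = 1" using coords_columns by (metis det_I det_mul)
    then show ?thesis by (simp add: frame_matrix_eq assms(1) det_mul)
  qed
  ultimately show ?thesis
    using det_orthogonal_matrix[of ?B] assms(3) by (auto simp: rotation_matrix_def)
qed

lemma loop_iff: "\<gamma> \<in> smooth_loops M y \<longleftrightarrow> admissible \<gamma> \<and> pathstart \<gamma> = y \<and> pathfinish \<gamma> = y"
  by (auto simp: smooth_loops_def admissible_def)

lemma transports_const: "transports (linepath x x) v v"
proof -
  have "has_cov_derivative nabla (linepath x x) (\<lambda>_. v) t 0" for t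
    unfolding has_cov_derivative_def
    by (intro exI[of _ 0] conjI) (auto simp: linepath_refl bilinear_lzero[OF bilinear_christoffel[OF x]])
  then show ?thesis
    unfolding transports_def parallel_along_def by (intro exI[of _ "\<lambda>_. v"]) auto
qed

lemma admissible_const: "admissible (linepath x x)"
  using x by (simp add: admissible_def piecewise_smooth_linepath)

lemma matrix_group_holonomy: "matrix_group (frame_matrix g x e ` holonomy_group M nabla x)"
proof
  let ?P = "parallel_transport nabla"
  show rot: "rotation_matrix B" if "B \<in> frame_matrix g x e ` holonomy_group M nabla x" for B
    using that parallel_transport_isometry
    by (auto simp: holonomy_group_def loop_iff intro!: rotation_frame_matrix linear_parallel_transport parallel_transport_det_pos) metis
  show "mat 1 \<in> frame_matrix g x e ` holonomy_group M nabla x"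
  proof -
    have "?P (linepath x x) = (\<lambda>v. v)"
      using parallel_transport_eqI[OF admissible_const transports_const] by blast
    moreover have "linepath x x \<in> smooth_loops M x" by (simp add: loop_iff admissible_const)
    ultimately show ?thesis unfolding holonomy_group_def using frame_matrix_id by (metis imageI)
  qed
  show "B ** C \<in> frame_matrix g x e ` holonomy_group M nabla x"
    if BC: "B \<in> frame_matrix g x e ` holonomy_group M nabla x" "C \<in> frame_matrix g x e ` holonomy_group M nabla x" for B C
  proof -
    obtain \<gamma> \<eta> where *: "\<gamma> \<in> smooth_loops M x" "\<eta> \<in> smooth_loops M x" "B = frame_matrix g x e (?P \<gamma>)" "C = frame_matrix g x e (?P \<eta>)"
      using BC unfolding holonomy_group_def by blast
    \<comment> \<open>The loop traversed first corresponds to the right factor, hence the order of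
      the join.\<close>
    then have "B ** C = frame_matrix g x e (?P (\<eta> +++ \<gamma>))"
      by (simp add: loop_iff parallel_transport_join frame_matrix_compose linear_parallel_transport)
    moreover have "\<eta> +++ \<gamma> \<in> smooth_loops M x"
      using * by (simp add: loop_iff admissible_join)
    ultimately show ?thesis unfolding holonomy_group_def by blast
  qed
  show "transpose B \<in> frame_matrix g x e ` holonomy_group M nabla x"
    if B: "B \<in> frame_matrix g x e ` holonomy_group M nabla x" for B
  proof -
    obtain \<gamma> where *: "\<gamma> \<in> smooth_loops M x" "B = frame_matrix g x e (?P \<gamma>)"
      using B unfolding holonomy_group_def by blast
    then have \<gamma>: "admissible \<gamma>" by (simp add: loop_iff)
    let ?C = "frame_matrix g x e (?P (reversepath \<gamma>))"
    have "?C ** B = frame_matrix g x e (?P (reversepath \<gamma>) \<circ> ?P \<gamma>)"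
      by (simp add: * frame_matrix_compose linear_parallel_transport admissible_reversepath \<gamma>)
    also have "\<dots> = mat 1"
      using parallel_transport_reversepath[OF \<gamma>] by (simp add: o_def frame_matrix_id)
    finally have "?C ** B ** transpose B = transpose B" by simp
    moreover have "B ** transpose B = mat 1"
      using rot[OF B] by (simp add: rotation_matrix_def orthogonal_matrix_def)
    ultimately have "?C = transpose B" by (simp add: matrix_mul_assoc[symmetric])
    moreover have "reversepath \<gamma> \<in> smooth_loops M x"
      using * by (simp add: loop_iff admissible_reversepath)
    ultimately show ?thesis unfolding holonomy_group_def by (metis imageI)
  qed
qed

end

context metric_connection
begin

text \<open>Carry the frame at \<open>y\<close> back along the segment to a frame \<open>k\<close>
  at \<open>x\<close>. A loop at \<open>x\<close>, flanked by the segment, has at \<open>y\<close>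
  the same matrix as the loop has in the frame \<open>k\<close>; passing from \<open>k\<close> to
  \<open>e\<close> is conjugation by an orthogonal matrix.\<close>

lemma holonomy_base_point:
  assumes "convex M" "x \<in> M" "y \<in> M" "orthonormal_frame g x e" "orthonormal_frame g y f"
    and full: "frame_matrix g x e ` holonomy_group M nabla x = special_orthogonal"
  shows "frame_matrix g y f ` holonomy_group M nabla y = special_orthogonal"
proof -
  interpret X: orthonormal_frame_at M nabla g x e by unfold_locales fact+
  interpret Y: orthonormal_frame_at M nabla g y f by unfold_locales fact+
  interpret G: matrix_group "frame_matrix g y f ` holonomy_group M nabla y"
    by (rule Y.matrix_group_holonomy)
  let ?P = "parallel_transport nabla"
  define \<sigma> where "\<sigma> = linepath x y"
  have \<sigma>: "admissible \<sigma>" "pathstart \<sigma> = x" "pathfinish \<sigma> = y"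
    using assms(1-3) by (auto simp: \<sigma>_def admissible_def piecewise_smooth_linepath closed_segment_subset)
  have \<sigma>': "admissible (reversepath \<sigma>)" by (rule admissible_reversepath[OF \<sigma>(1)])
  define k where "k j = ?P (reversepath \<sigma>) (f j)" for j
  have Pk: "?P \<sigma> (k j) = f j" for j
    using parallel_transport_reversepath[OF \<sigma>', of "f j"] by (simp add: k_def)
  have "g x (k i) (k j) = g y (f i) (f j)" for i j
    using parallel_transport_isometry[OF \<sigma>(1), of "k i" "k j"] by (simp add: Pk \<sigma>)
  then have frame_k: "orthonormal_frame g x k" using assms(5) by (simp add: orthonormal_frame_def)
  interpret K: orthonormal_frame_at M nabla g x k by unfold_locales fact+
  have "R \<in> frame_matrix g y f ` holonomy_group M nabla y" if R: "rotation_matrix R" for R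
  proof -
    define Q where "Q = X.crds ** K.cols"
    have colQ: "column j Q = X.crds *v k j" for j
      using matrix_vector_mult_basis[of Q j] by (simp add: Q_def frame_columns_axis flip: matrix_vector_mul_assoc)
    have "(transpose Q ** Q) $ i $ j = column i Q \<bullet> column j Q" for i j
      by (simp add: matrix_matrix_mult_def transpose_def column_def inner_vec_def)
    then have "transpose Q ** Q = mat 1"
      by (simp add: vec_eq_iff colQ X.inner_coords K.frame_orth mat_def)
    then have oQ: "orthogonal_matrix Q" by (simp add: orthogonal_matrix)
    \<comment> \<open>The determinant of \<open>Q\<close> may be -1, but it enters twice.\<close>
    have "rotation_matrix (Q ** R ** transpose Q)"
      using R oQ det_orthogonal_matrix[OF oQ]
      by (auto simp: rotation_matrix_def det_mul intro!: orthogonal_matrix_mul)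
    then have "Q ** R ** transpose Q \<in> frame_matrix g x e ` holonomy_group M nabla x"
      unfolding full by (simp add: special_orthogonal_def)
    then obtain h where h: "h \<in> holonomy_group M nabla x" "Q ** R ** transpose Q = frame_matrix g x e h"
      by blast
    then obtain \<gamma> where \<gamma>: "\<gamma> \<in> smooth_loops M x" "frame_matrix g x e (?P \<gamma>) = Q ** R ** transpose Q"
      unfolding holonomy_group_def by auto
    have ad: "admissible \<gamma>" "pathstart \<gamma> = x" "pathfinish \<gamma> = x" using \<gamma>(1) by (auto simp: X.loop_iff)
    note lin = linear_parallel_transport[OF ad(1)]
    have K: "frame_matrix g x k (?P \<gamma>) = R"
    proof -
      have "matrix (?P \<gamma>) = (X.cols ** X.crds) ** matrix (?P \<gamma>) ** (X.cols ** X.crds)"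
        by (simp add: X.columns_coords)
      also have "\<dots> = X.cols ** (X.crds ** matrix (?P \<gamma>) ** X.cols) ** X.crds"
        by (simp only: matrix_mul_assoc)
      also have "\<dots> = X.cols ** (Q ** R ** transpose Q) ** X.crds"
        using \<gamma>(2) by (simp add: X.frame_matrix_eq[OF lin])
      finally have "frame_matrix g x k (?P \<gamma>) = K.crds ** (X.cols ** (Q ** R ** transpose Q) ** X.crds) ** K.cols"
        by (simp add: K.frame_matrix_eq[OF lin])
      also have "\<dots> = (K.crds ** X.cols ** Q) ** R ** (transpose Q ** Q)" by (simp add: matrix_mul_assoc Q_def)
      also have "K.crds ** X.cols ** Q = K.crds ** (X.cols ** X.crds) ** K.cols" by (simp add: Q_def matrix_mul_assoc)
      also have "\<dots> = mat 1" by (simp add: X.columns_coords K.coords_columns)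
      finally show ?thesis using oQ by (simp add: orthogonal_matrix)
    qed
    let ?\<delta> = "(reversepath \<sigma> +++ \<gamma>) +++ \<sigma>"
    have \<delta>: "?\<delta> \<in> smooth_loops M y"
      by (simp add: X.loop_iff admissible_join \<sigma> \<sigma>' ad)
    have "?P ?\<delta> = ?P \<sigma> \<circ> (?P \<gamma> \<circ> ?P (reversepath \<sigma>))"
      by (simp add: parallel_transport_join admissible_join \<sigma> \<sigma>' ad)
    then have "frame_matrix g y f (?P ?\<delta>) $ i $ j = frame_matrix g x k (?P \<gamma>) $ i $ j" for i j
      using parallel_transport_isometry[OF \<sigma>(1), of "k i" "?P \<gamma> (k j)"]
      by (simp add: frame_matrix_def Pk \<sigma> flip: k_def)
    then have "frame_matrix g y f (?P ?\<delta>) = R" by (simp add: vec_eq_iff K)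
    then show ?thesis using \<delta> unfolding holonomy_group_def by blast
  qed
  then show ?thesis using G.rotation by (auto simp: special_orthogonal_def)
qed

end

lemma holonomy_group_eq_restricted:
  assumes "convex M" shows "holonomy_group M nabla x = restricted_holonomy_group M nabla x"
proof -
  have "homotopic_paths M \<gamma> (\<lambda>_. x)" if "\<gamma> \<in> smooth_loops M x" for \<gamma>
  proof -
    have "simply_connected M" by (rule convex_imp_simply_connected[OF assms])
    then have "homotopic_paths M \<gamma> (linepath (pathstart \<gamma>) (pathstart \<gamma>))"
      using that unfolding simply_connected_eq_contractible_path smooth_loops_def by (auto simp: piecewise_smooth_imp_path)
    then show ?thesis using that by (simp add: smooth_loops_def linepath_refl)
  qed
  then show ?thesis
    unfolding holonomy_group_def restricted_holonomy_group_def by (metis (mono_tags, lifting) Collect_cong Collect_mem_eq)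
qed

section \<open>Explicit parallel transport\<close>

text \<open>An off-diagonal entry occurs twice in a symmetric matrix, so with the factor \<open>1/2\<close> of the metric only
  the diagonal units need rescaling.\<close>

definition kappa :: "'d uprod \<Rightarrow> real" where
  "kappa p = (if \<exists>i. p = Upair i i then sqrt 2 else 1)"

lemma kappa_Upair: "kappa (Upair i j) = (if i = j then sqrt 2 else 1)"
  by (auto simp: kappa_def)

lemma freq_eq_kappa: "freq i j = kappa (Upair i j) / 2"
  by (simp add: freq_def kappa_Upair real_div_sqrt field_simps)

definition mean_part :: "real^('d::finite + 'd uprod) \<Rightarrow> 'd normal_coords" where
  "mean_part y = (\<chi> s. case s of Inl j \<Rightarrow> y $ Inl j | Inr p \<Rightarrow> 0)"

definition cov_part :: "real^('d::finite + 'd uprod) \<Rightarrow> 'd normal_coords" where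
  "cov_part y = (\<chi> s. case s of Inl j \<Rightarrow> 0 | Inr p \<Rightarrow> kappa p * y $ Inr p)"

text \<open>The tangent vector at a point with covariance \<open>r\<close> times the identity that has coordinates \<open>y\<close>
  in the standard orthonormal frame.\<close>

definition scaled :: "real \<Rightarrow> real^('d::finite + 'd uprod) \<Rightarrow> 'd normal_coords" where
  "scaled r y = sqrt r *\<^sub>R mean_part y + r *\<^sub>R cov_part y"

lemma linear_mean_part: "linear mean_part" and linear_cov_part: "linear cov_part"
  by (auto intro!: linearI simp: mean_part_def cov_part_def vec_eq_iff algebra_simps split: sum.split)

lemma linear_scaled: "linear (scaled r)"
  unfolding scaled_def by (intro linear_compose_add linear_compose_scale_right linear_mean_part linear_cov_part)

lemma mean_of_scaled: "mean_of (scaled r y) $ j = sqrt r * y $ Inl j"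
  and cov_of_scaled: "cov_of (scaled r y) $ i $ j = r * (kappa (Upair i j) * y $ Inr (Upair i j))"
  by (simp_all add: mean_of_def cov_of_def scaled_def mean_part_def cov_part_def)

lemma sum_UNIV_sum: "(\<Sum>s\<in>UNIV. f s) = (\<Sum>i\<in>UNIV. f (Inl i)) + (\<Sum>j\<in>UNIV. f (Inr j))"
  for f :: "'a::finite + 'b::finite \<Rightarrow> real"
  by (simp add: UNIV_Plus_UNIV[symmetric] sum.Plus del: UNIV_Plus_UNIV)

text \<open>An off-diagonal pair arises from two ordered pairs of weight 1/2, a diagonal one from a
  single ordered pair of weight 1.\<close>

lemma sum_uprod:
  fixes f :: "'d::finite uprod \<Rightarrow> real"
  shows "(\<Sum>i\<in>UNIV. \<Sum>j\<in>UNIV. (kappa (Upair i j))\<^sup>2 / 2 * f (Upair i j)) = (\<Sum>p\<in>UNIV. f p)"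
proof -
  have sum_if: "(\<Sum>j\<in>J. if c then h j else 0) = (if c then sum h J else 0)" for c J and h :: "'d \<Rightarrow> real"
    by simp
  have one: "(\<Sum>i\<in>UNIV. \<Sum>j\<in>UNIV. if Upair i j = p then (kappa p)\<^sup>2 / 2 else 0) = 1" for p :: "'d uprod"
  proof -
    obtain a b where p: "p = Upair a b" by (metis uprod_exhaust)
    show ?thesis
    proof (cases "a = b")
      case True
      have "(if Upair i j = p then (kappa p)\<^sup>2 / 2 else 0) = (if i = a then if j = a then 1 else 0 else 0)" for i j
        by (simp add: p True kappa_Upair)
      then show ?thesis by (simp add: sum_if)
    next
      case False
      have "(if Upair i j = p then (kappa p)\<^sup>2 / 2 else 0) =
          (if i = a then if j = b then 1 / 2 else 0 else 0) + (if i = b then if j = a then 1 / 2 else 0 else 0)" for i j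
        using False by (auto simp: p kappa_Upair)
      then show ?thesis by (simp add: sum.distrib sum_if)
    qed
  qed
  have "(\<Sum>p\<in>UNIV. f p) = (\<Sum>p\<in>UNIV. \<Sum>i\<in>UNIV. \<Sum>j\<in>UNIV. if Upair i j = p then (kappa p)\<^sup>2 / 2 * f p else 0)"
  proof (rule sum.cong[OF refl])
    fix p
    have "f p = (\<Sum>i\<in>UNIV. \<Sum>j\<in>UNIV. if Upair i j = p then (kappa p)\<^sup>2 / 2 else 0) * f p" by (simp add: one)
    also have "\<dots> = (\<Sum>i\<in>UNIV. \<Sum>j\<in>UNIV. if Upair i j = p then (kappa p)\<^sup>2 / 2 * f p else 0)"
      by (simp only: sum_distrib_right if_distrib[of "\<lambda>x. x * f p"] mult_zero_left)
    finally show "f p = (\<Sum>i\<in>UNIV. \<Sum>j\<in>UNIV. if Upair i j = p then (kappa p)\<^sup>2 / 2 * f p else 0)" .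
  qed
  also have "\<dots> = (\<Sum>i\<in>UNIV. \<Sum>p\<in>UNIV. \<Sum>j\<in>UNIV. if Upair i j = p then (kappa p)\<^sup>2 / 2 * f p else 0)"
    by (rule sum.swap)
  also have "\<dots> = (\<Sum>i\<in>UNIV. \<Sum>j\<in>UNIV. \<Sum>p\<in>UNIV. if Upair i j = p then (kappa p)\<^sup>2 / 2 * f p else 0)"
    by (intro sum.cong refl sum.swap)
  finally show ?thesis by simp
qed

section \<open>Points whose covariance is a multiple of the identity\<close>

lemma precision_scalar:
  assumes "cov_of \<theta> = r *\<^sub>R mat 1" "r > 0" shows "precision \<theta> = (1 / r) *\<^sub>R mat 1"
  unfolding precision_def
  by (rule matrix_inv_eqI) (use assms in \<open>simp add: matrix_mult.scaleR_left matrix_mult.scaleR_right\<close>)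

lemma scalar_in_manifold:
  assumes "cov_of \<theta> = r *\<^sub>R mat 1" "r > 0" shows "\<theta> \<in> normal_manifold"
  using assms by (simp add: normal_manifold_def pos_def_def matrix_vector.scaleR_left transpose_scaleR)

lemma normal_metric_scaled:
  assumes "cov_of \<theta> = mat 1" shows "normal_metric \<theta> (scaled 1 u) (scaled 1 v) = u \<bullet> v"
proof -
  have P: "precision \<theta> = mat 1" using precision_scalar[of \<theta> 1] assms by simp
  have "trace (cov_of (scaled 1 u) ** cov_of (scaled 1 v)) = cov_of (scaled 1 u) \<bullet> cov_of (scaled 1 v)"
    by (simp add: inner_matrix_eq_trace)
  also have "\<dots> = 2 * (\<Sum>i\<in>UNIV. \<Sum>j\<in>UNIV. (kappa (Upair i j))\<^sup>2 / 2 * (u $ Inr (Upair i j) * v $ Inr (Upair i j)))"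
    by (simp add: inner_matrix cov_of_scaled power2_eq_square sum_distrib_left mult_ac)
  also have "\<dots> = 2 * (\<Sum>p\<in>UNIV. u $ Inr p * v $ Inr p)"
    by (subst sum_uprod) simp
  finally show ?thesis
    by (simp add: normal_metric_def P inner_vec_def[of u] sum_UNIV_sum)
      (simp add: inner_vec_def mean_of_scaled)
qed

section \<open>The rotations and their generator in coordinates\<close>

lemma shift_rotation_apply:
  "shift_rotation i t *v y = y + (\<Sum>j\<in>UNIV.
     ((cos (freq i j * t) - 1) * y $ Inl j + sin (freq i j * t) * y $ Inr (Upair i j)) *\<^sub>R mean_axis j +
     ((cos (freq i j * t) - 1) * y $ Inr (Upair i j) - sin (freq i j * t) * y $ Inl j) *\<^sub>R cov_axis i j)"
proof -
  have mv: "(\<Sum>j\<in>J. B j) *v y = (\<Sum>j\<in>J. B j *v y)" for B :: "'a \<Rightarrow> real^('a + 'a uprod)^('a + 'a uprod)" and J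
    by (rule matrix_vector.sum_left)
  show ?thesis
    unfolding shift_rotation_def matrix_vector_mult_add_rdistrib mv matrix_vector_mul_lid
    by (simp add: matrix_vector.scaleR_left outer_mul_vector wedge_mul_vector inner_axis' algebra_simps)
qed

lemma shift_rotation_Inl: "(shift_rotation i t *v y) $ Inl j =
    cos (freq i j * t) * y $ Inl j + sin (freq i j * t) * y $ Inr (Upair i j)"
  and shift_rotation_Inr: "(shift_rotation i t *v y) $ Inr (Upair i j) =
    cos (freq i j * t) * y $ Inr (Upair i j) - sin (freq i j * t) * y $ Inl j"
  and shift_rotation_other: "(\<And>j. p \<noteq> Upair i j) \<Longrightarrow> (shift_rotation i t *v y) $ Inr p = y $ Inr p"
  unfolding shift_rotation_apply
  by (simp_all add: axis_apply sum.distrib if_distrib[of "\<lambda>x. _ * x"] if_distrib[of "\<lambda>x. x * _"]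
      left_diff_distrib cong: if_cong del: Upair_inject)

lemma vec_eq_shift_iff:
  fixes u v :: "real^('d::finite + 'd uprod)"
  assumes "\<And>j. u $ Inl j = v $ Inl j" "\<And>j. u $ Inr (Upair i j) = v $ Inr (Upair i j)"
    "\<And>p. (\<And>j. p \<noteq> Upair i j) \<Longrightarrow> u $ Inr p = v $ Inr p"
  shows "u = v"
proof -
  have "u $ s = v $ s" for s
    using assms by (cases s) metis+
  then show ?thesis by (simp add: vec_eq_iff)
qed

lemma shift_rotation_add: "shift_rotation i (s + t) *v y = shift_rotation i s *v (shift_rotation i t *v y)"
  by (rule vec_eq_shift_iff[of _ _ i])
    (simp_all add: shift_rotation_Inl shift_rotation_Inr shift_rotation_other cos_add sin_add algebra_simps)

definition shift_generator :: "'d::finite \<Rightarrow> real^('d + 'd uprod)^('d + 'd uprod)" where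
  "shift_generator i = (\<Sum>j\<in>UNIV. freq i j *\<^sub>R wedge (mean_axis j) (cov_axis i j))"

lemma shift_generator_apply:
  "shift_generator i *v y = (\<Sum>j\<in>UNIV.
     (freq i j * y $ Inr (Upair i j)) *\<^sub>R mean_axis j - (freq i j * y $ Inl j) *\<^sub>R cov_axis i j)"
  unfolding shift_generator_def matrix_vector.sum_left
  by (simp add: matrix_vector.scaleR_left wedge_mul_vector inner_axis' scaleR_diff_right)

lemma shift_generator_Inl: "(shift_generator i *v y) $ Inl j = freq i j * y $ Inr (Upair i j)"
  and shift_generator_Inr: "(shift_generator i *v y) $ Inr (Upair i j) = - (freq i j * y $ Inl j)"
  and shift_generator_other: "(\<And>j. p \<noteq> Upair i j) \<Longrightarrow> (shift_generator i *v y) $ Inr p = 0"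
  unfolding shift_generator_apply
  by (simp_all add: axis_apply sum_subtractf sum_negf if_distrib[of "\<lambda>x. _ * x"] cong: if_cong del: Upair_inject)

text \<open>The group law moves the derivative at 0 to any \<open>t\<close>.\<close>

lemma has_vector_derivative_shift_rotation_apply:
  "((\<lambda>t. shift_rotation i t *v y) has_vector_derivative shift_generator i *v (shift_rotation i t *v y)) (at t)"
proof -
  have "((\<lambda>s. s - t) has_vector_derivative 1) (at t)"
    by (auto intro!: derivative_eq_intros)
  from vector_diff_chain_at[OF this, of "shift_rotation i" "shift_generator i"]
  have "((\<lambda>s. shift_rotation i (s - t)) has_vector_derivative shift_generator i) (at t)"
    using has_vector_derivative_shift_rotation[of i] by (simp add: o_def shift_generator_def)
  from bounded_linear.has_vector_derivative[OF matrix_vector.bounded_linear_left this, of "shift_rotation i t *v y"]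
  show ?thesis by (simp flip: shift_rotation_add)
qed

section \<open>The holonomy group of the normal distribution manifold\<close>

text \<open>For constant coefficients and constant fields the Leibniz term drops out.\<close>

lemma bilinear_christoffel_affine:
  fixes nabla :: "'a::euclidean_space connection"
  assumes "affine_connection M nabla" "p \<in> M" shows "bilinear (christoffel nabla p)"
proof -
  have 1: "christoffel nabla p (c *\<^sub>R u + u') v = c *\<^sub>R christoffel nabla p u v + christoffel nabla p u' v" for c u u' v
  proof -
    have "\<forall>(f :: 'a \<Rightarrow> real) X X' Y. smooth_on M f \<and> smooth_on M X \<and> smooth_on M X' \<and> smooth_on M Y \<longrightarrow>
        (\<forall>p\<in>M. nabla (\<lambda>q. f q *\<^sub>R X q + X' q) Y p = f p *\<^sub>R nabla X Y p + nabla X' Y p)"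
      using assms(1) unfolding affine_connection_def by (elim conjE)
    from this[rule_format, of "\<lambda>_. c" "\<lambda>_. u" "\<lambda>_. u'" "\<lambda>_. v" p] show ?thesis
      using assms(2) by (simp add: christoffel_def smooth_on_const)
  qed
  have 2: "christoffel nabla p u (c *\<^sub>R v + v') = c *\<^sub>R christoffel nabla p u v + christoffel nabla p u v'" for c u v v'
  proof -
    have "\<forall>(f :: 'a \<Rightarrow> real) X Y Y'. smooth_on M f \<and> smooth_on M X \<and> smooth_on M Y \<and> smooth_on M Y' \<longrightarrow>
        (\<forall>p\<in>M. nabla X (\<lambda>q. f q *\<^sub>R Y q + Y' q) p =
           frechet_derivative f (at p) (X p) *\<^sub>R Y p + f p *\<^sub>R nabla X Y p + nabla X Y' p)"
      using assms(1) unfolding affine_connection_def by (elim conjE)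
    from this[rule_format, of "\<lambda>_. c" "\<lambda>_. u" "\<lambda>_. v" "\<lambda>_. v'" p] show ?thesis
      using assms(2) by (simp add: christoffel_def smooth_on_const)
  qed
  have 0: "christoffel nabla p 0 v = 0" "christoffel nabla p u 0 = 0" for u v
    using 1[of "-1" 0 0 v] 2[of u "-1" 0 0] by simp_all
  show ?thesis
    unfolding bilinear_def
    using 1[of 1] 2[of _ 1] 1[of _ _ 0] 2[of _ _ _ 0] by (auto intro!: linearI simp: 0)
qed

lemma continuous_christoffel_affine:
  fixes nabla :: "'a::euclidean_space connection"
  assumes "affine_connection M nabla" shows "continuous_on M (\<lambda>p. christoffel nabla p u v)"
proof -
  have "smooth_on M (nabla (\<lambda>_. u) (\<lambda>_. v))"
  proof -
    have "\<forall>X Y. smooth_on M X \<and> smooth_on M Y \<longrightarrow> smooth_on M (nabla X Y)"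
      using assms unfolding affine_connection_def by (elim conjE)
    then show ?thesis using smooth_on_const by blast
  qed
  then have "Ck_on 0 M (nabla (\<lambda>_. u) (\<lambda>_. v))" unfolding smooth_on_def by blast
  then show ?thesis by (simp add: christoffel_def)
qed

text \<open>The closed form \<open>normal_metric\<close>, which agrees with the Fisher metric on the
  manifold, serves as the metric from here on.\<close>

lemma metric_connection_normal:
  fixes nabla :: "'d::finite normal_coords connection"
  assumes "levi_civita normal_manifold fisher_metric nabla"
  shows "metric_connection normal_manifold nabla normal_metric"
proof
  fix p u v w :: "'d normal_coords"
  have aff: "affine_connection normal_manifold nabla"
    using assms by (simp add: levi_civita_def)
  show "continuous_on normal_manifold (\<lambda>p. christoffel nabla p u v)"
    by (rule continuous_christoffel_affine[OF aff])
  assume p: "p \<in> normal_manifold"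
  show "bilinear (christoffel nabla p)"
    by (rule bilinear_christoffel_affine[OF aff p])
  show "bilinear (normal_metric p)" by (rule normal_metric_bilinear)
  show "normal_metric p u u > 0" if "u \<noteq> 0" using normal_metric_pos[OF p that] .
  show "((\<lambda>q. normal_metric q v w) has_derivative
       (\<lambda>u. normal_metric p (christoffel nabla p u v) w + normal_metric p v (christoffel nabla p u w))) (at p)"
    unfolding christoffel_eq[OF assms p] normal_metric_christoffel[OF p] by (rule has_derivative_normal_metric[OF p])
qed

lemma parts: "cov_of (mean_part y) = 0" "mean_of (cov_part y) = 0"
  by (simp_all add: vec_eq_iff mean_of_def cov_of_def mean_part_def cov_part_def)

lemma parallel_along_linepathI:
  assumes LC: "levi_civita normal_manifold fisher_metric nabla"
    and M: "\<And>t. t \<in> {0..1} \<Longrightarrow> linepath p q t \<in> normal_manifold"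
    and V: "\<And>t. t \<in> {0..1} \<Longrightarrow> (V has_vector_derivative V' t) (at t)"
    and eq: "\<And>t. t \<in> {0..1} \<Longrightarrow> V' t + normal_christoffel (linepath p q t) (q - p) (V t) = 0"
  shows "parallel_along nabla (linepath p q) V"
proof -
  have "has_cov_derivative nabla (linepath p q) V t 0" if t: "t \<in> {0..1}" for t
    unfolding has_cov_derivative_def
    using eq[OF t] by (intro exI[of _ "q - p"] exI[of _ "V' t"] conjI has_vector_derivative_linepath_within
        has_vector_derivative_at_within[OF V[OF t]]) (simp add: christoffel_eq[OF LC M[OF t]])
  moreover have "continuous_on {0..1} V"
    using V by (meson continuous_at_imp_continuous_on has_vector_derivative_continuous)
  ultimately show ?thesis unfolding parallel_along_def by (intro conjI exI[of _ "{}"]) auto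
qed

text \<open>In the direction (b - a) I the Christoffel map multiplies means by - (b - a) / (2 r) and
  covariances by - (b - a) / r. Parallel fields thus grow like sqrt r and r, the two factors in
  \<open>scaled\<close>.\<close>

lemma parallel_vertical:
  fixes p q :: "'d::finite normal_coords"
  assumes LC: "levi_civita normal_manifold fisher_metric nabla"
    and pq: "mean_of p = mean_of q" "cov_of p = a *\<^sub>R mat 1" "cov_of q = b *\<^sub>R mat 1" and "a > 0" "b > 0"
  shows "parallel_along nabla (linepath p q) (\<lambda>t. scaled ((1 - t) * a + t * b) y)"
proof (rule parallel_along_linepathI[OF LC])
  define r where "r t = (1 - t) * a + t * b" for t
  fix t :: real assume t: "t \<in> {0..1}"
  have r: "r t > 0"
  proof (cases "t = 0")
    case False
    then show ?thesis using t \<open>a > 0\<close> \<open>b > 0\<close> unfolding r_def by (intro add_nonneg_pos mult_nonneg_nonneg mult_pos_pos) auto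
  qed (use \<open>a > 0\<close> in \<open>simp add: r_def\<close>)
  have cov: "cov_of (linepath p q t) = r t *\<^sub>R mat 1"
    by (simp add: linepath_def cov_of_linear pq r_def scaleR_add_left)
  show "linepath p q t \<in> normal_manifold" by (rule scalar_in_manifold[OF cov r])
  let ?V' = "\<lambda>t. ((b - a) / (2 * sqrt (r t))) *\<^sub>R mean_part y + (b - a) *\<^sub>R cov_part y"
  have dr: "(r has_real_derivative b - a) (at t)"
    unfolding r_def by (auto intro!: derivative_eq_intros)
  have "((\<lambda>t. sqrt (r t)) has_real_derivative (b - a) / (2 * sqrt (r t))) (at t)"
    using DERIV_chain2[OF DERIV_real_sqrt[OF r] dr] by (simp add: field_simps)
  then have "((\<lambda>t. scaled (r t) y) has_vector_derivative ?V' t) (at t)"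
    unfolding scaled_def
    using has_vector_derivative_add[OF has_vector_derivative_scaleR[OF _ has_vector_derivative_const]
        has_vector_derivative_scaleR[OF dr has_vector_derivative_const]]
    by simp
  then show "((\<lambda>t. scaled ((1 - t) * a + t * b) y) has_vector_derivative ?V' t) (at t)"
    by (simp add: r_def)
  have P: "precision (linepath p q t) = (1 / r t) *\<^sub>R mat 1" by (rule precision_scalar[OF cov r])
  define w where "w = q - p"
  have d: "mean_of w = 0" "cov_of w = (b - a) *\<^sub>R mat 1"
    by (simp_all add: w_def mean_of_linear cov_of_linear pq scaleR_diff_left)
  have s: "sqrt (r t) / r t = 1 / sqrt (r t)" using r real_div_sqrt[of "r t"] by (simp add: field_simps)
  have "?V' t + normal_christoffel (linepath p q t) w (scaled (r t) y) = 0"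
  proof (rule coords_eqI)
    show "mean_of (?V' t + normal_christoffel (linepath p q t) w (scaled (r t) y)) = mean_of 0"
      using r s by (simp add: mean_of_linear mean_of_normal_christoffel d P scaled_def parts cov_of_linear
          matrix_vector.scaleR_left matrix_vector_mult_scaleR)
    show "cov_of (?V' t + normal_christoffel (linepath p q t) w (scaled (r t) y)) = cov_of 0"
      using r by (simp add: cov_of_linear cov_of_normal_christoffel[OF scalar_in_manifold[OF cov r]] d P scaled_def parts
          outer.zero_left outer.zero_right
          matrix_mult.scaleR_left matrix_mult.scaleR_right) (simp add: vec_eq_iff field_simps)
  qed
  then show "?V' t + normal_christoffel (linepath p q t) (q - p) (scaled ((1 - t) * a + t * b) y) = 0"
    by (simp add: r_def w_def)
qed

text \<open>At constant r the parallel equation in scaled coordinates has constant coefficients: the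
  derivative of y is s / sqrt r times \<open>shift_generator i *v y\<close>. The factor 1 / sqrt r
  is the source of the holonomy.\<close>

lemma parallel_horizontal:
  fixes p q :: "'d::finite normal_coords"
  assumes LC: "levi_civita normal_manifold fisher_metric nabla"
    and pq: "mean_of q = mean_of p + s *\<^sub>R axis i 1" "cov_of p = r *\<^sub>R mat 1" "cov_of q = r *\<^sub>R mat 1" and r: "r > 0"
  shows "parallel_along nabla (linepath p q) (\<lambda>t. scaled r (shift_rotation i (s / sqrt r * t) *v y))"
proof (rule parallel_along_linepathI[OF LC])
  fix t :: real assume t: "t \<in> {0..1}"
  have cov: "cov_of (linepath p q t) = r *\<^sub>R mat 1"
    by (simp add: linepath_def cov_of_linear pq left_diff_distrib flip: scaleR_add_left)
  show M: "linepath p q t \<in> normal_manifold" by (rule scalar_in_manifold[OF cov r])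
  let ?y = "\<lambda>t. shift_rotation i (s / sqrt r * t) *v y"
  have "((\<lambda>t. s / sqrt r * t) has_vector_derivative s / sqrt r) (at t)"
    by (auto intro!: derivative_eq_intros)
  from vector_diff_chain_at[OF this has_vector_derivative_shift_rotation_apply]
  have "(?y has_vector_derivative (s / sqrt r) *\<^sub>R (shift_generator i *v ?y t)) (at t)"
    by (simp add: o_def)
  then show "((\<lambda>t. scaled r (?y t)) has_vector_derivative scaled r ((s / sqrt r) *\<^sub>R (shift_generator i *v ?y t))) (at t)"
    by (rule bounded_linear.has_vector_derivative[OF linear_conv_bounded_linear[THEN iffD1, OF linear_scaled]])
  have P: "precision (linepath p q t) = (1 / r) *\<^sub>R mat 1" by (rule precision_scalar[OF cov r])
  have d: "mean_of (q - p) = s *\<^sub>R axis i 1" "cov_of (q - p) = 0"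
    by (simp_all add: mean_of_linear cov_of_linear pq)
  have sr: "s / sqrt r * r = s * sqrt r" "s / sqrt r * sqrt r = s"
    using r real_div_sqrt[of r] by (auto simp: field_simps)
  let ?z = "?y t"
  show "scaled r ((s / sqrt r) *\<^sub>R (shift_generator i *v ?z)) + normal_christoffel (linepath p q t) (q - p) (scaled r ?z) = 0"
  proof (rule coords_eqI)
    have "mean_of (scaled r ((s / sqrt r) *\<^sub>R (shift_generator i *v ?z))) $ j =
        s / 2 * (kappa (Upair i j) * ?z $ Inr (Upair i j))" for j
      using r by (simp add: mean_of_scaled shift_generator_Inl freq_eq_kappa)
    moreover have "mean_of (normal_christoffel (linepath p q t) (q - p) (scaled r ?z)) $ j =
        - (s / 2 * (kappa (Upair i j) * ?z $ Inr (Upair i j)))" for j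
    proof -
      have "(cov_of (scaled r ?z) *v axis i 1) $ j = r * (kappa (Upair i j) * ?z $ Inr (Upair i j))"
        by (simp add: matrix_vector_mult_basis column_def cov_of_scaled Upair_commute[of j i])
      then show ?thesis
        using r by (simp add: mean_of_normal_christoffel d P matrix_vector.scaleR_left matrix_vector_mult_scaleR)
    qed
    ultimately show "mean_of (scaled r ((s / sqrt r) *\<^sub>R (shift_generator i *v ?z)) +
        normal_christoffel (linepath p q t) (q - p) (scaled r ?z)) = mean_of 0"
      by (simp add: vec_eq_iff mean_of_linear)
    have "cov_of (scaled r ((s / sqrt r) *\<^sub>R (shift_generator i *v ?z))) $ k $ l =
        s * sqrt r * (kappa (Upair k l) * (shift_generator i *v ?z) $ Inr (Upair k l))" for k l
      unfolding sr(1)[symmetric] by (simp add: cov_of_scaled)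
    moreover have "cov_of (normal_christoffel (linepath p q t) (q - p) (scaled r ?z)) $ k $ l =
        s * sqrt r * (1/2 * ((if k = i then ?z $ Inl l else 0) + (if l = i then ?z $ Inl k else 0)))" for k l
      by (simp add: cov_of_normal_christoffel[OF M] d P outer_nth mean_of_scaled axis_apply
          matrix_mult.zero_left matrix_mult.zero_right)
    \<comment> \<open>The product of \<open>kappa\<close> and \<open>freq\<close> is 1/2 off the
      diagonal and 1 on it, where both summands on the right contribute.\<close>
    moreover have "kappa (Upair k l) * (shift_generator i *v ?z) $ Inr (Upair k l) =
        - (1/2 * ((if k = i then ?z $ Inl l else 0) + (if l = i then ?z $ Inl k else 0)))" for k l
    proof -
      consider "k = i" | "l = i" "k \<noteq> i" | "k \<noteq> i" "l \<noteq> i" by blast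
      then show ?thesis
      proof cases
        case 1
        then show ?thesis by (simp add: shift_generator_Inr freq_eq_kappa kappa_Upair del: Upair_inject)
      next
        case 2
        then show ?thesis
          using shift_generator_Inr[of i ?z k]
          by (simp add: Upair_commute[of k i] freq_eq_kappa kappa_Upair del: Upair_inject)
      next
        case 3
        then show ?thesis by (subst shift_generator_other) auto
      qed
    qed
    ultimately show "cov_of (scaled r ((s / sqrt r) *\<^sub>R (shift_generator i *v ?z)) +
        normal_christoffel (linepath p q t) (q - p) (scaled r ?z)) = cov_of 0"
      by (simp add: vec_eq_iff cov_of_linear)
  qed
qed

lemma holonomy_at_standard_normal:
  fixes nabla :: "'d::finite normal_coords connection"
  assumes LC: "levi_civita normal_manifold fisher_metric nabla"
  defines "base \<equiv> coords 0 (mat 1) :: 'd normal_coords"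
  defines "c \<equiv> (\<lambda>s. scaled 1 (axis s 1)) :: 'd + 'd uprod \<Rightarrow> 'd normal_coords"
  shows "orthonormal_frame normal_metric base c"
    and "frame_matrix normal_metric base c ` holonomy_group normal_manifold nabla base = special_orthogonal"
proof -
  interpret metric_connection normal_manifold nabla normal_metric
    by (rule metric_connection_normal[OF LC])
  have cov_base: "cov_of base = mat 1" and mean_base: "mean_of base = 0"
    by (simp_all add: base_def cov_of_coords)
  show frame: "orthonormal_frame normal_metric base c"
    unfolding orthonormal_frame_def c_def by (simp add: normal_metric_scaled[OF cov_base] inner_axis_1)
  have base_M: "base \<in> normal_manifold" using scalar_in_manifold[of base 1] cov_base by simp
  interpret O: orthonormal_frame_at normal_manifold nabla normal_metric base c
    by unfold_locales (rule base_M, rule frame)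
  show "frame_matrix normal_metric base c ` holonomy_group normal_manifold nabla base = special_orthogonal"
  proof (rule all_rotations_if_shift_rotations[OF O.matrix_group_holonomy])
    fix i :: 'd and t :: real
    \<comment> \<open>The side at r = 4 contributes the time s / 2 and the way back at r = 1
      contributes - s, in total - s / 2 = t.\<close>
    define s where "s = - 2 * t"
    define pt where "pt m r = coords (m *\<^sub>R axis i 1) (r *\<^sub>R mat 1) " for m r :: real
    have pt: "mean_of (pt m r) = m *\<^sub>R axis i 1" "cov_of (pt m r) = r *\<^sub>R mat 1" for m r
      by (simp_all add: pt_def cov_of_coords transpose_scaleR)
    have pt_base: "pt 0 1 = base" by (rule coords_eqI) (simp_all add: pt cov_base mean_base)
    have seg: "admissible (linepath (pt m r) (pt m' r'))" if "r > 0" "r' > 0" for m r m' r'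
      unfolding admissible_def path_image_linepath
      by (intro conjI piecewise_smooth_linepath closed_segment_subset convex_normal_manifold scalar_in_manifold[OF pt(2)] that)
    have vert: "transports (linepath (pt m a) (pt m b)) (scaled a y) (scaled b y)" if "a > 0" "b > 0" for m a b y
      using parallel_vertical[OF LC, of "pt m a" "pt m b" a b y] that pt unfolding transports_def
      by (intro exI[of _ "\<lambda>t. scaled ((1 - t) * a + t * b) y"]) simp
    have horiz: "transports (linepath (pt m r) (pt m' r)) (scaled r y) (scaled r (shift_rotation i ((m' - m) / sqrt r) *v y))"
      if "r > 0" for m m' r y
      using parallel_horizontal[OF LC, of "pt m' r" "pt m r" "m' - m" i r y] that pt unfolding transports_def
      by (intro exI[of _ "\<lambda>t. scaled r (shift_rotation i ((m' - m) / sqrt r * t) *v y)"])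
        (simp add: shift_rotation_0 flip: scaleR_add_left)
    \<comment> \<open>A rectangle in the plane of \<open>m\<close> and \<open>r\<close>. Its
      vertical sides are invisible in the scaled coordinates.\<close>
    let ?\<gamma>1 = "linepath (pt 0 1) (pt 0 4)" and ?\<gamma>2 = "linepath (pt 0 4) (pt s 4)"
      and ?\<gamma>3 = "linepath (pt s 4) (pt s 1)" and ?\<gamma>4 = "linepath (pt s 1) (pt 0 1)"
    let ?\<gamma> = "((?\<gamma>1 +++ ?\<gamma>2) +++ ?\<gamma>3) +++ ?\<gamma>4"
    have ad: "admissible ?\<gamma>" by (simp add: admissible_join seg)
    then have loop: "?\<gamma> \<in> smooth_loops normal_manifold base"
      by (simp add: O.loop_iff pt_base)
    have "transports ?\<gamma> (scaled 1 y) (scaled 1 (shift_rotation i ((0 - s) / sqrt 1) *v (shift_rotation i ((s - 0) / sqrt 4) *v y)))" for y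
      by (intro transports_join[where v = "scaled 4 y"] transports_join[where v = "scaled 4 (shift_rotation i ((s - 0) / sqrt 4) *v y)"]
          transports_join[where v = "scaled 1 (shift_rotation i ((s - 0) / sqrt 4) *v y)"] vert horiz admissible_join seg) simp_all
    then have "transports ?\<gamma> (scaled 1 y) (scaled 1 (shift_rotation i t *v y))" for y
      by (simp add: s_def flip: shift_rotation_add)
    then have "parallel_transport nabla ?\<gamma> (scaled 1 y) = scaled 1 (shift_rotation i t *v y)" for y
      by (rule parallel_transport_eqI[OF ad])
    note PT = this
    \<comment> \<open>\<open>scaled 1\<close> carries the Euclidean product to the metric at
      \<open>base\<close>, so the frame matrix is the matrix acting on the coordinates.\<close>
    have "frame_matrix normal_metric base c (parallel_transport nabla ?\<gamma>) = shift_rotation i t"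
      unfolding frame_matrix_def c_def PT normal_metric_scaled[OF cov_base]
      by (simp add: vec_eq_iff matrix_vector_mult_basis inner_axis' column_def)
    moreover have "frame_matrix normal_metric base c (parallel_transport nabla ?\<gamma>)
        \<in> frame_matrix normal_metric base c ` holonomy_group normal_manifold nabla base"
      unfolding holonomy_group_def by (intro imageI loop)
    ultimately show "shift_rotation i t \<in> frame_matrix normal_metric base c ` holonomy_group normal_manifold nabla base"
      by simp
  qed
qed

theorem theorem5p3:
  fixes nabla :: "'d::finite normal_coords connection"
    and x :: "'d normal_coords"
    and e :: "'d + 'd uprod \<Rightarrow> 'd normal_coords"
  assumes "CARD('d) \<in> {1, 2, 3}"
    and "levi_civita normal_manifold fisher_metric nabla"
    and "x \<in> normal_manifold"
    and "orthonormal_frame fisher_metric x e"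
  shows "holonomy_group normal_manifold nabla x = restricted_holonomy_group normal_manifold nabla x
       \<and> frame_matrix fisher_metric x e ` restricted_holonomy_group normal_manifold nabla x
           = special_orthogonal"
proof -
  interpret metric_connection normal_manifold nabla normal_metric
    by (rule metric_connection_normal[OF assms(2)])
  have g: "fisher_metric x u v = normal_metric x u v" for u v
    by (rule fisher_metric_eq[OF assms(3)])
  have frame: "orthonormal_frame normal_metric x e"
    using assms(4) by (simp add: orthonormal_frame_def g)
  \<comment> \<open>Full holonomy at the standard normal distribution is carried to \<open>x\<close>
    along a segment of the convex manifold.\<close>
  have "frame_matrix normal_metric x e ` holonomy_group normal_manifold nabla x = special_orthogonal"
    by (rule holonomy_base_point[OF convex_normal_manifold scalar_in_manifold[of _ 1] assms(3)
          holonomy_at_standard_normal(1)[OF assms(2)] frame holonomy_at_standard_normal(2)[OF assms(2)]])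
      (simp_all add: cov_of_coords)
  moreover have "frame_matrix fisher_metric x e = frame_matrix normal_metric x e"
    by (simp add: fun_eq_iff frame_matrix_def g)
  ultimately show ?thesis
    using holonomy_group_eq_restricted[OF convex_normal_manifold, of nabla x] by simp
qed

end
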